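(* Let $X$ be a metric space with bounded geometry and $1\leq p<\infty$. The quadruple $$\bigl(U\mathbb C^p[X],\ \mathbb C_u[X],\ E^{<}_{\mathrm{alg}},\ E^{>}_{\mathrm{alg}}\bigr)$$ is a compatible dense subcontext of the Morita equivalence $(E^{<},E^{>})$ between $UB^p(X)$ and $B_u^p(X)$ described in the context.
   Context: Banach spaces are complex. $X$ has bounded geometry if $\sup_{x\in X}|B(x,r)|<\infty$ for every $r\geq0$. Let $1/p+1/q=1$ ($q=\infty$ if $p=1$). A matrix indexed by $X\times X$ has finite propagation if $\sup\{d(x,y):\text{the }(x,y)\text{ entry is nonzero}\}<\infty$. $\ell^p=\ell^p(\mathbb N)$ and $\ell^p(X,\ell^p)=(\bigoplus_{x\in X}\ell^p)_{\ell^p}$. $\mathbb C_u[X]$ is the algebra of finite-propagation $X\times X$ complex matrices with uniformly bounded entries, acting on $\ell^p(X)$, and $B_u^p(X)$ is its closure in $B(\ell^p(X))$. $U\mathbb C^p[X]$ is the algebra of finite-propagation operators $T=(T_{xy})\in B(\ell^p(X,\ell^p))$, $T_{xy}\in B(\ell^p)$, with $\sup_{x,y}\operatorname{rank}(T_{xy})<\infty$, and $UB^p(X)$ is its operator-norm closure. $E^{>}_{\mathrm{alg}}$ is the space of finite-propagation $X\times X$ matrices with uniformly bounded entries in $\ell^p$, regarded as operators $\ell^p(X)\to\ell^p(X,\ell^p)$; $E^{<}_{\mathrm{alg}}$ is the space of finite-propagation $X\times X$ matrices with uniformly bounded entries in $\ell^q$ (acting as functionals on $\ell^p$), regarded as operators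 $\ell^p(X,\ell^p)\to\ell^p(X)$. $E^{>},E^{<}$ are their operator-norm completions. With module actions given by composition of operators, $E^{>}$ is a $UB^p(X)$-$B_u^p(X)$-bimodule and $E^{<}$ is a $B_u^p(X)$-$UB^p(X)$-bimodule; with pairings $\langle e^{<},e^{>}\rangle_{B_u^p(X)}=e^{<}e^{>}$ and ${}_{UB^p(X)}\langle e^{>},e^{<}\rangle=e^{>}e^{<}$ they form a Morita equivalence between $UB^p(X)$ and $B_u^p(X)$ (known theorem of Chung), meaning: contractive bimodule actions and pairings of norm at most one satisfying the evident bilinearity, balancing and associativity identities, nondegenerate actions, and full pairings. A compatible dense subcontext $(A_0,B_0,E_0^{<},E_0^{>})$ of a Morita equivalence $(E^{<},E^{>})$ between Banach algebras $A$ and $B$ ($E^{<}$ a $B$-$A$-bimodule, $E^{>}$ an $A$-$B$-bimodule) consists of dense subalgebras $A_0\subseteq A$, $B_0\subseteq B$ and dense linear subspaces $E_0^{<}\subseteq E^{<}$, $E_0^{>}\subseteq E^{>}$ satisfying $B_0E_0^{<}\subseteq E_0^{<}$, $E_0^{<}A_0\subseteq E_0^{<}$, $A_0E_0^{>}\subseteq E_0^{>}$, $E_0^{>}B_0\subseteq E_0^{>}$, $\langle E_0^{<},E_0^{>}\rangle_B\subseteq B_0$ and ${}_A\langle E_0^{>},E_0^{<}\rangle\subseteq A_0$. *)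

theory Defs
  imports "HOL-Analysis.Analysis" "HOL-Library.Function_Algebras" "HOL-Library.Extended_Nat"
begin

section \<open>Complex Banach spaces, Banach algebras and Morita equivalences\<close>

text \<open>The exponent \<open>p\<close> is a term variable, so \<open>\<ell>\<^sup>p\<close> cannot be a type depending on it. A complex normed
  space is therefore a carrier set in an additive group (for function types, the pointwise one of
  \<^theory>\<open>HOL-Library.Function_Algebras\<close>) together with a complex scalar multiplication
  and a norm; only the values of the norm on the carrier matter.\<close>

record 'a cspace =
  vecs :: "'a set"
  scl :: "complex \<Rightarrow> 'a \<Rightarrow> 'a"
  nrm :: "'a \<Rightarrow> real"

locale complex_normed_space = vector_space "scl V" for V :: "'a::ab_group_add cspace" +
  assumes subspace_vecs: "subspace (vecs V)"
    and nrm_nonneg: "u \<in> vecs V \<Longrightarrow> 0 \<le> nrm V u"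
    and nrm_eq_0: "u \<in> vecs V \<Longrightarrow> nrm V u = 0 \<longleftrightarrow> u = 0"
    and nrm_triangle: "u \<in> vecs V \<Longrightarrow> v \<in> vecs V \<Longrightarrow> nrm V (u + v) \<le> nrm V u + nrm V v"
    and nrm_scl: "u \<in> vecs V \<Longrightarrow> nrm V (scl V c u) = cmod c * nrm V u"

locale complex_banach_space = complex_normed_space +
  assumes complete:
    "(\<And>n. s n \<in> vecs V) \<Longrightarrow> (\<And>e. e > 0 \<Longrightarrow> \<exists>N. \<forall>m\<ge>N. \<forall>n\<ge>N. nrm V (s m - s n) < e)
      \<Longrightarrow> \<exists>u\<in>vecs V. (\<lambda>n. nrm V (s n - u)) \<longlonglongrightarrow> 0"

definition norm_closure :: "'a::ab_group_add cspace \<Rightarrow> 'a set \<Rightarrow> 'a set" where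
  "norm_closure V S = {v \<in> vecs V. \<forall>e>0. \<exists>s\<in>S. nrm V (v - s) < e}"

definition dense_in :: "'a::ab_group_add cspace \<Rightarrow> 'a set \<Rightarrow> bool" where
  "dense_in V S \<longleftrightarrow> S \<subseteq> vecs V \<and> norm_closure V S = vecs V"

definition lin_span :: "'a::ab_group_add cspace \<Rightarrow> 'a set \<Rightarrow> 'a set" where
  "lin_span V S = module.span (scl V) S"

definition lin_subspace :: "'a::ab_group_add cspace \<Rightarrow> 'a set \<Rightarrow> bool" where
  "lin_subspace V S \<longleftrightarrow> S \<subseteq> vecs V \<and> module.subspace (scl V) S"

definition contractive_bilinear ::
  "'a::ab_group_add cspace \<Rightarrow> 'b::ab_group_add cspace \<Rightarrow> 'c::ab_group_add cspace \<Rightarrow> ('a \<Rightarrow> 'b \<Rightarrow> 'c) \<Rightarrow> bool"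
where
  "contractive_bilinear V W U m \<longleftrightarrow>
     (\<forall>v\<in>vecs V. \<forall>w\<in>vecs W. m v w \<in> vecs U \<and> nrm U (m v w) \<le> nrm V v * nrm W w) \<and>
     (\<forall>v\<in>vecs V. \<forall>v'\<in>vecs V. \<forall>w\<in>vecs W. m (v + v') w = m v w + m v' w) \<and>
     (\<forall>v\<in>vecs V. \<forall>w\<in>vecs W. \<forall>w'\<in>vecs W. m v (w + w') = m v w + m v w') \<and>
     (\<forall>c. \<forall>v\<in>vecs V. \<forall>w\<in>vecs W. m (scl V c v) w = scl U c (m v w) \<and> m v (scl W c w) = scl U c (m v w))"

locale banach_algebra = complex_banach_space A for A :: "'a::ab_group_add cspace" +
  fixes mul :: "'a \<Rightarrow> 'a \<Rightarrow> 'a"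
  assumes mul_contractive_bilinear: "contractive_bilinear A A A mul"
    and mul_assoc: "a \<in> vecs A \<Longrightarrow> a' \<in> vecs A \<Longrightarrow> a'' \<in> vecs A \<Longrightarrow> mul (mul a a') a'' = mul a (mul a' a'')"

definition subalgebra :: "'a::ab_group_add cspace \<Rightarrow> ('a \<Rightarrow> 'a \<Rightarrow> 'a) \<Rightarrow> 'a set \<Rightarrow> bool" where
  "subalgebra A mul S \<longleftrightarrow> lin_subspace A S \<and> (\<forall>a\<in>S. \<forall>a'\<in>S. mul a a' \<in> S)"

text \<open>An \<open>A\<close>-\<open>B\<close>-bimodule with left action \<open>l\<close> and right action \<open>r\<close>. Nondegeneracy is the usual
  one for Banach modules: the products span a dense subspace.\<close>

locale nondegenerate_banach_bimodule =
  alg_left: banach_algebra A mulA + alg_right: banach_algebra B mulB + complex_banach_space E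
  for A :: "'a::ab_group_add cspace" and mulA :: "'a \<Rightarrow> 'a \<Rightarrow> 'a"
    and B :: "'b::ab_group_add cspace" and mulB :: "'b \<Rightarrow> 'b \<Rightarrow> 'b"
    and E :: "'e::ab_group_add cspace" +
  fixes l :: "'a \<Rightarrow> 'e \<Rightarrow> 'e" and r :: "'e \<Rightarrow> 'b \<Rightarrow> 'e"
  assumes left_contractive_bilinear: "contractive_bilinear A E E l"
    and right_contractive_bilinear: "contractive_bilinear E B E r"
    and left_action: "a \<in> vecs A \<Longrightarrow> a' \<in> vecs A \<Longrightarrow> e \<in> vecs E \<Longrightarrow> l (mulA a a') e = l a (l a' e)"
    and right_action: "b \<in> vecs B \<Longrightarrow> b' \<in> vecs B \<Longrightarrow> e \<in> vecs E \<Longrightarrow> r e (mulB b b') = r (r e b) b'"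
    and actions_commute: "a \<in> vecs A \<Longrightarrow> b \<in> vecs B \<Longrightarrow> e \<in> vecs E \<Longrightarrow> r (l a e) b = l a (r e b)"
    and left_nondegenerate: "dense_in E (lin_span E {l a e | a e. a \<in> vecs A \<and> e \<in> vecs E})"
    and right_nondegenerate: "dense_in E (lin_span E {r e b | e b. e \<in> vecs E \<and> b \<in> vecs B})"

text \<open>\<open>El\<close> is \<open>E\<^sup><\<close>, a \<open>B\<close>-\<open>A\<close>-bimodule, and \<open>Eg\<close> is \<open>E\<^sup>>\<close>, an \<open>A\<close>-\<open>B\<close>-bimodule; \<open>prB\<close> and \<open>prA\<close> are the
  pairings with values in \<open>B\<close> and \<open>A\<close>.\<close>

locale morita_equivalence =
  El: nondegenerate_banach_bimodule B mulB A mulA El lEl rEl +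
  Eg: nondegenerate_banach_bimodule A mulA B mulB Eg lEg rEg
  for A :: "'a::ab_group_add cspace" and mulA :: "'a \<Rightarrow> 'a \<Rightarrow> 'a"
    and B :: "'b::ab_group_add cspace" and mulB :: "'b \<Rightarrow> 'b \<Rightarrow> 'b"
    and El :: "'el::ab_group_add cspace" and lEl :: "'b \<Rightarrow> 'el \<Rightarrow> 'el" and rEl :: "'el \<Rightarrow> 'a \<Rightarrow> 'el"
    and Eg :: "'eg::ab_group_add cspace" and lEg :: "'a \<Rightarrow> 'eg \<Rightarrow> 'eg" and rEg :: "'eg \<Rightarrow> 'b \<Rightarrow> 'eg" +
  fixes prB :: "'el \<Rightarrow> 'eg \<Rightarrow> 'b" and prA :: "'eg \<Rightarrow> 'el \<Rightarrow> 'a"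
  assumes prB_contractive_bilinear: "contractive_bilinear El Eg B prB"
    and prA_contractive_bilinear: "contractive_bilinear Eg El A prA"
    and prB_left: "b \<in> vecs B \<Longrightarrow> x \<in> vecs El \<Longrightarrow> y \<in> vecs Eg \<Longrightarrow> prB (lEl b x) y = mulB b (prB x y)"
    and prB_right: "b \<in> vecs B \<Longrightarrow> x \<in> vecs El \<Longrightarrow> y \<in> vecs Eg \<Longrightarrow> prB x (rEg y b) = mulB (prB x y) b"
    and prB_balanced: "a \<in> vecs A \<Longrightarrow> x \<in> vecs El \<Longrightarrow> y \<in> vecs Eg \<Longrightarrow> prB (rEl x a) y = prB x (lEg a y)"
    and prA_left: "a \<in> vecs A \<Longrightarrow> x \<in> vecs El \<Longrightarrow> y \<in> vecs Eg \<Longrightarrow> prA (lEg a y) x = mulA a (prA y x)"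
    and prA_right: "a \<in> vecs A \<Longrightarrow> x \<in> vecs El \<Longrightarrow> y \<in> vecs Eg \<Longrightarrow> prA y (rEl x a) = mulA (prA y x) a"
    and prA_balanced: "b \<in> vecs B \<Longrightarrow> x \<in> vecs El \<Longrightarrow> y \<in> vecs Eg \<Longrightarrow> prA (rEg y b) x = prA y (lEl b x)"
    and associative_l: "x \<in> vecs El \<Longrightarrow> y \<in> vecs Eg \<Longrightarrow> x' \<in> vecs El \<Longrightarrow> lEl (prB x y) x' = rEl x (prA y x')"
    and associative_g: "y \<in> vecs Eg \<Longrightarrow> x \<in> vecs El \<Longrightarrow> y' \<in> vecs Eg \<Longrightarrow> rEg y (prB x y') = lEg (prA y x) y'"
    and prB_full: "dense_in B (lin_span B {prB x y | x y. x \<in> vecs El \<and> y \<in> vecs Eg})"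
    and prA_full: "dense_in A (lin_span A {prA y x | x y. x \<in> vecs El \<and> y \<in> vecs Eg})"

locale compatible_dense_subcontext =
  morita_equivalence A mulA B mulB El lEl rEl Eg lEg rEg prB prA
  for A :: "'a::ab_group_add cspace" and mulA
    and B :: "'b::ab_group_add cspace" and mulB
    and El :: "'el::ab_group_add cspace" and lEl rEl
    and Eg :: "'eg::ab_group_add cspace" and lEg rEg
    and prB prA +
  fixes A0 :: "'a set" and B0 :: "'b set" and El0 :: "'el set" and Eg0 :: "'eg set"
  assumes A0_dense_subalgebra: "subalgebra A mulA A0" "dense_in A A0"
    and B0_dense_subalgebra: "subalgebra B mulB B0" "dense_in B B0"
    and El0_dense_subspace: "lin_subspace El El0" "dense_in El El0"
    and Eg0_dense_subspace: "lin_subspace Eg Eg0" "dense_in Eg Eg0"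
    and B0_El0: "b \<in> B0 \<Longrightarrow> x \<in> El0 \<Longrightarrow> lEl b x \<in> El0"
    and El0_A0: "x \<in> El0 \<Longrightarrow> a \<in> A0 \<Longrightarrow> rEl x a \<in> El0"
    and A0_Eg0: "a \<in> A0 \<Longrightarrow> y \<in> Eg0 \<Longrightarrow> lEg a y \<in> Eg0"
    and Eg0_B0: "y \<in> Eg0 \<Longrightarrow> b \<in> B0 \<Longrightarrow> rEg y b \<in> Eg0"
    and prB_El0_Eg0: "x \<in> El0 \<Longrightarrow> y \<in> Eg0 \<Longrightarrow> prB x y \<in> B0"
    and prA_Eg0_El0: "y \<in> Eg0 \<Longrightarrow> x \<in> El0 \<Longrightarrow> prA y x \<in> A0"


section \<open>The spaces \<open>\<ell>\<^sup>p\<close> and bounded operators\<close>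

definition scalars :: "complex cspace" where
  "scalars = \<lparr>vecs = UNIV, scl = (*), nrm = cmod\<rparr>"

text \<open>The \<open>\<ell>\<^sup>p\<close>-direct sum of copies of \<open>F\<close> indexed by \<open>'i\<close>, for real \<open>p \<ge> 1\<close>.\<close>

definition lp_sum :: "real \<Rightarrow> 'a cspace \<Rightarrow> ('i \<Rightarrow> 'a) cspace" where
  "lp_sum p F =
    \<lparr>vecs = {u. (\<forall>i. u i \<in> vecs F) \<and> (\<lambda>i. nrm F (u i) powr p) summable_on UNIV},
     scl = (\<lambda>c u i. scl F c (u i)),
     nrm = (\<lambda>u. (\<Sum>\<^sub>\<infinity>i. nrm F (u i) powr p) powr (1 / p))\<rparr>"

definition lp :: "real \<Rightarrow> ('i \<Rightarrow> complex) cspace" where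
  "lp p = lp_sum p scalars"

definition lp_lp :: "real \<Rightarrow> ('i \<Rightarrow> nat \<Rightarrow> complex) cspace" where
  "lp_lp p = lp_sum p (lp p)"

definition linf :: "(nat \<Rightarrow> complex) cspace" where
  "linf = \<lparr>vecs = {f. bounded (range f)}, scl = (\<lambda>c f n. c * f n), nrm = (\<lambda>f. SUP n. cmod (f n))\<rparr>"

text \<open>\<open>\<ell>\<^sup>q(\<nat>)\<close> for the exponent \<open>q\<close> with \<open>1/p + 1/q = 1\<close>.\<close>

definition lq :: "real \<Rightarrow> (nat \<Rightarrow> complex) cspace" where
  "lq p = (if p = 1 then linf else lp (p / (p - 1)))"

text \<open>Bounded linear operators; they are extended by \<open>0\<close> outside the carrier of the domain, so
  that operators agreeing on the carrier are equal and \<open>(\<circ>)\<close> is the composition of operators.\<close>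

definition bounded_ops ::
  "'a::ab_group_add cspace \<Rightarrow> 'b::ab_group_add cspace \<Rightarrow> ('a \<Rightarrow> 'b) cspace" where
  "bounded_ops V W =
    \<lparr>vecs = {T. (\<forall>u\<in>vecs V. T u \<in> vecs W) \<and> (\<forall>u. u \<notin> vecs V \<longrightarrow> T u = 0) \<and>
               (\<forall>u\<in>vecs V. \<forall>v\<in>vecs V. T (u + v) = T u + T v) \<and>
               (\<forall>c. \<forall>u\<in>vecs V. T (scl V c u) = scl W c (T u)) \<and>
               (\<exists>C. \<forall>u\<in>vecs V. nrm W (T u) \<le> C * nrm V u)},
     scl = (\<lambda>c T u. scl W c (T u)),
     nrm = (\<lambda>T. SUP u\<in>{u \<in> vecs V. nrm V u \<le> 1}. nrm W (T u))\<rparr>"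

text \<open>The library's \<^const>\<open>vector_space.dim\<close> is \<open>0\<close> on infinite-dimensional spaces, hence the
  case distinction.\<close>

definition op_rank :: "'a cspace \<Rightarrow> 'b::ab_group_add cspace \<Rightarrow> ('a \<Rightarrow> 'b) \<Rightarrow> enat" where
  "op_rank V W T =
    (if \<exists>S. finite S \<and> T ` vecs V \<subseteq> lin_span W S
     then enat (vector_space.dim (scl W) (T ` vecs V)) else \<infinity>)"


section \<open>Matrices and operators over a metric space\<close>

definition bounded_geometry :: "'x::metric_space itself \<Rightarrow> bool" where
  "bounded_geometry _ \<longleftrightarrow> (\<forall>r\<ge>0. \<exists>N. \<forall>x::'x. finite (cball x r) \<and> card (cball x r) \<le> N)"

definition finite_propagation :: "('x::metric_space \<Rightarrow> 'x \<Rightarrow> 'e::zero) \<Rightarrow> bool" where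
  "finite_propagation m \<longleftrightarrow> bdd_above {dist x y | x y. m x y \<noteq> 0}"

definition uniformly_bounded_entries :: "'e cspace \<Rightarrow> ('x \<Rightarrow> 'x \<Rightarrow> 'e) \<Rightarrow> bool" where
  "uniformly_bounded_entries F m \<longleftrightarrow>
     (\<forall>x y. m x y \<in> vecs F) \<and> (\<exists>C. \<forall>x y. nrm F (m x y) \<le> C)"

text \<open>The operator with domain \<open>V\<close> given by a matrix whose entries are maps. Over a space of bounded
  geometry the rows of a matrix of finite propagation have finitely many nonzero entries, so the
  sum below is then a sum over a finite set.\<close>

definition matrix_op ::
  "('x \<Rightarrow> 'a) cspace \<Rightarrow> ('x \<Rightarrow> 'x \<Rightarrow> 'a \<Rightarrow> 'b::ab_group_add) \<Rightarrow> ('x \<Rightarrow> 'a) \<Rightarrow> 'x \<Rightarrow> 'b" where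
  "matrix_op V m = (\<lambda>u. if u \<in> vecs V then (\<lambda>x. \<Sum>y | m x y \<noteq> 0. m x y (u y)) else 0)"

definition Cu_alg :: "real \<Rightarrow> (('x::metric_space \<Rightarrow> complex) \<Rightarrow> 'x \<Rightarrow> complex) set" where
  "Cu_alg p = {matrix_op (lp p) (\<lambda>x y c. a x y * c) | a.
     finite_propagation a \<and> uniformly_bounded_entries scalars a}"

definition Bu :: "real \<Rightarrow> (('x::metric_space \<Rightarrow> complex) \<Rightarrow> 'x \<Rightarrow> complex) cspace" where
  "Bu p = (bounded_ops (lp p) (lp p))\<lparr>vecs := norm_closure (bounded_ops (lp p) (lp p)) (Cu_alg p)\<rparr>"

definition op_entry ::
  "(('x \<Rightarrow> nat \<Rightarrow> complex) \<Rightarrow> 'x \<Rightarrow> nat \<Rightarrow> complex) \<Rightarrow> 'x \<Rightarrow> 'x \<Rightarrow> (nat \<Rightarrow> complex) \<Rightarrow> nat \<Rightarrow> complex" where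
  "op_entry T x y = (\<lambda>v. T (\<lambda>z. if z = y then v else 0) x)"

definition UC_alg ::
  "real \<Rightarrow> (('x::metric_space \<Rightarrow> nat \<Rightarrow> complex) \<Rightarrow> 'x \<Rightarrow> nat \<Rightarrow> complex) set" where
  "UC_alg p = {T \<in> vecs (bounded_ops (lp_lp p) (lp_lp p)).
     finite_propagation (op_entry T) \<and> (SUP (x, y). op_rank (lp p) (lp p) (op_entry T x y)) < \<infinity>}"

definition UB :: "real \<Rightarrow> (('x::metric_space \<Rightarrow> nat \<Rightarrow> complex) \<Rightarrow> 'x \<Rightarrow> nat \<Rightarrow> complex) cspace" where
  "UB p = (bounded_ops (lp_lp p) (lp_lp p))
     \<lparr>vecs := norm_closure (bounded_ops (lp_lp p) (lp_lp p)) (UC_alg p)\<rparr>"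

text \<open>A vector \<open>e x y \<in> \<ell>\<^sup>p\<close> is identified with the operator \<open>c \<mapsto> c \<cdot> e x y\<close> from the scalars to \<open>\<ell>\<^sup>p\<close>,
  and \<open>f x y \<in> \<ell>\<^sup>q\<close> with the functional on \<open>\<ell>\<^sup>p\<close> given by the bilinear pairing.\<close>

definition Eg_alg :: "real \<Rightarrow> (('x::metric_space \<Rightarrow> complex) \<Rightarrow> 'x \<Rightarrow> nat \<Rightarrow> complex) set" where
  "Eg_alg p = {matrix_op (lp p) (\<lambda>x y c n. c * e x y n) | e.
     finite_propagation e \<and> uniformly_bounded_entries (lp p) e}"

definition El_alg :: "real \<Rightarrow> (('x::metric_space \<Rightarrow> nat \<Rightarrow> complex) \<Rightarrow> 'x \<Rightarrow> complex) set" where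
  "El_alg p = {matrix_op (lp_lp p) (\<lambda>x y v. \<Sum>\<^sub>\<infinity>n. f x y n * v n) | f.
     finite_propagation f \<and> uniformly_bounded_entries (lq p) f}"

text \<open>The completions in the operator norm, realised as closures in the Banach spaces of bounded
  operators.\<close>

definition Eg_space :: "real \<Rightarrow> (('x::metric_space \<Rightarrow> complex) \<Rightarrow> 'x \<Rightarrow> nat \<Rightarrow> complex) cspace" where
  "Eg_space p = (bounded_ops (lp p) (lp_lp p))
     \<lparr>vecs := norm_closure (bounded_ops (lp p) (lp_lp p)) (Eg_alg p)\<rparr>"

definition El_space :: "real \<Rightarrow> (('x::metric_space \<Rightarrow> nat \<Rightarrow> complex) \<Rightarrow> 'x \<Rightarrow> complex) cspace" where
  "El_space p = (bounded_ops (lp_lp p) (lp p))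
     \<lparr>vecs := norm_closure (bounded_ops (lp_lp p) (lp p)) (El_alg p)\<rparr>"

end

theory Submission
  imports Defs
begin

text \<open>Over a space of bounded geometry, a bounded operator between two \<open>\<ell>\<^sup>p\<close>-sums over \<open>X\<close> has finite
  propagation iff it is a matrix of finite propagation with uniformly bounded entries. So all four
  algebraic spaces consist of the bounded operators of finite propagation, with bounded ranks of
  the entries in the case of \<open>U\<complex>\<^sup>p[X]\<close>, and the inclusions required of a subcontext
  express that such operators are closed under composition.

  Let \<open>J : \<ell>\<^sup>p(X) \<rightarrow> \<ell>\<^sup>p(X, \<ell>\<^sup>p)\<close> and \<open>P\<close> in the other direction be the embedding and the projection at a
  basis vector of \<open>\<ell>\<^sup>p\<close>. They lie in \<open>E\<^sup>>\<close> and \<open>E\<^sup><\<close>, and \<open>P J = 1\<close>; hence \<open>y = (y P) J\<close>, \<open>x = P (J x)\<close> and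
  \<open>b = (b P) J\<close>, which gives nondegeneracy and fullness of the pairing into \<open>B\<^sub>u\<^sup>p(X)\<close>.

  For the other pairing, an operator \<open>S\<close> of rank \<open>n\<close> into \<open>\<ell>\<^sup>p\<close> is a sum of \<open>n\<close> rank-one operators whose
  norms are bounded by a multiple, depending only on \<open>n\<close>, of the norm of \<open>S\<close>: subtract
  \<open>v \<mapsto> \<psi>(S v) / \<psi>(S u) \<cdot> S u\<close>, where \<open>\<psi>\<close> norms \<open>S u \<noteq> 0\<close>; this lowers the rank. Applying it to all
  entries and enumerating the balls of \<open>X\<close> writes every element of \<open>U\<complex>\<^sup>p[X]\<close> as a finite sum of products
  of elements of \<open>E\<^sup>>\<^sub>a\<^sub>l\<^sub>g\<close> and \<open>E\<^sup><\<^sub>a\<^sub>l\<^sub>g\<close>.\<close>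

section \<open>Normed spaces and bounded operators\<close>

text \<open>The obstacle is uniformity over all pairs of points. A single entry of finite rank
  always splits into rank-one pieces, but the pieces assemble to elements of \<open>Eg_alg\<close>
  and \<open>El_alg\<close> only if their norms are bounded independently of the entry; the rank
  bound in \<open>UC_alg\<close> has to control both their number and their size. Any nonzero
  \<open>S u\<close> may be used in the splitting: it is normalised, and all of the size goes into
  the functional. The norming functional has norm at most 2, so one step leaves a remainder of norm
  at most 3 times that of \<open>S\<close>, and n steps give the factor \<open>3 ^ n\<close>. The 2
  comes from the crude Young inequality \<open>a powr (p - 1) * t <= a powr p + t powr p\<close>;
  like the constants that count points in balls, it only has to be uniform. Balls are enumerated
  because the vector of a rank-one piece at \<open>(x, y)\<close> depends on both points: once
  \<open>y\<close> is the \<open>i\<close>-th point of the ball about \<open>x\<close>, the vector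
  depends on \<open>x\<close> and \<open>i\<close> alone and fits on the diagonal of a left
  factor.\<close>

context complex_normed_space
begin

lemma zero_in_vecs [simp]: "0 \<in> vecs V"
  using subspace_vecs by (rule subspace_0)

lemma add_in_vecs: "u \<in> vecs V \<Longrightarrow> v \<in> vecs V \<Longrightarrow> u + v \<in> vecs V"
  using subspace_vecs by (rule subspace_add)

lemma scl_in_vecs: "u \<in> vecs V \<Longrightarrow> scl V c u \<in> vecs V"
  using subspace_vecs by (rule subspace_scale)

lemma minus_in_vecs: "u \<in> vecs V \<Longrightarrow> - u \<in> vecs V"
  using subspace_vecs by (rule subspace_neg)

lemma diff_in_vecs: "u \<in> vecs V \<Longrightarrow> v \<in> vecs V \<Longrightarrow> u - v \<in> vecs V"
  using subspace_vecs by (rule subspace_diff)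

lemma sum_in_vecs: "(\<And>i. i \<in> I \<Longrightarrow> f i \<in> vecs V) \<Longrightarrow> sum f I \<in> vecs V"
  using subspace_vecs by (rule subspace_sum)

lemma nrm_zero [simp]: "nrm V 0 = 0"
  by (simp add: nrm_eq_0)

lemma nrm_minus: "u \<in> vecs V \<Longrightarrow> nrm V (- u) = nrm V u"
  using nrm_scl[of u "- 1"] by simp

lemma nrm_minus_commute: "u \<in> vecs V \<Longrightarrow> v \<in> vecs V \<Longrightarrow> nrm V (u - v) = nrm V (v - u)"
  using nrm_minus[of "u - v"] by (simp add: diff_in_vecs)

lemma nrm_diff_triangle:
  assumes "u \<in> vecs V" "v \<in> vecs V" "w \<in> vecs V"
  shows "nrm V (u - w) \<le> nrm V (u - v) + nrm V (v - w)"
  using nrm_triangle[of "u - v" "v - w"] assms by (simp add: diff_in_vecs)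

lemma nrm_diff_le:
  assumes "u \<in> vecs V" "v \<in> vecs V"
  shows "nrm V (u - v) \<le> nrm V u + nrm V v"
  using nrm_triangle[of "u" "- v"] assms by (simp add: minus_in_vecs nrm_minus)

lemma nrm_sum_le:
  assumes "\<And>i. i \<in> I \<Longrightarrow> f i \<in> vecs V"
  shows "nrm V (sum f I) \<le> (\<Sum>i\<in>I. nrm V (f i))"
  using assms
proof (induction I rule: infinite_finite_induct)
  case (insert i I)
  then have "nrm V (f i + sum f I) \<le> nrm V (f i) + nrm V (sum f I)"
    by (intro nrm_triangle sum_in_vecs) auto
  with insert show ?case by auto
qed auto

text \<open>A Cauchy estimate survives when one of its two indices tends to infinity; it is applied
  with \<open>w = s n u\<close> to pointwise limits of operators.\<close>

lemma nrm_limit_le: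
  assumes lim: "(\<lambda>n. nrm V (s n - u)) \<longlonglongrightarrow> 0" and mem: "\<And>n. s n \<in> vecs V" "u \<in> vecs V" "w \<in> vecs V"
    and le: "\<And>n. n \<ge> N \<Longrightarrow> nrm V (s n - w) \<le> c"
  shows "nrm V (u - w) \<le> c"
proof (rule LIMSEQ_le_const)
  show "(\<lambda>n. nrm V (s n - u) + c) \<longlonglongrightarrow> c"
    using tendsto_add[OF lim tendsto_const[of c]] by simp
  have "nrm V (u - w) \<le> nrm V (s n - u) + c" if "n \<ge> N" for n
    using nrm_diff_triangle[of u "s n" w] nrm_minus_commute[of u "s n"] le[OF that] mem by simp
  then show "\<exists>N. \<forall>n\<ge>N. nrm V (u - w) \<le> nrm V (s n - u) + c" by blast
qed

text \<open>Convergence is expressed through the norm on a carrier only, so uniqueness of limits has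
  its own proof; it yields linearity of pointwise limits of operators.\<close>

lemma nrm_limit_unique:
  assumes "(\<lambda>n. nrm V (s n - u)) \<longlonglongrightarrow> 0" "(\<lambda>n. nrm V (s n - v)) \<longlonglongrightarrow> 0"
    and "\<And>n. s n \<in> vecs V" "u \<in> vecs V" "v \<in> vecs V"
  shows "u = v"
proof -
  have "nrm V (u - v) \<le> nrm V (s n - u) + nrm V (s n - v)" for n
    using nrm_diff_triangle[of u "s n" v] nrm_minus_commute[of u "s n"] assms by simp
  moreover have "(\<lambda>n. nrm V (s n - u) + nrm V (s n - v)) \<longlonglongrightarrow> 0"
    using tendsto_add[OF assms(1,2)] by simp
  ultimately have "nrm V (u - v) \<le> 0"
    by (intro LIMSEQ_le_const) auto
  then have "nrm V (u - v) = 0"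
    using nrm_nonneg[of "u - v"] assms by (simp add: diff_in_vecs)
  then show ?thesis using nrm_eq_0[of "u - v"] assms by (simp add: diff_in_vecs)
qed

section \<open>Norm closures and density\<close>

lemma norm_closure_subset: "norm_closure V S \<subseteq> vecs V"
  by (auto simp: norm_closure_def)

lemma subset_norm_closure: "S \<subseteq> vecs V \<Longrightarrow> S \<subseteq> norm_closure V S"
  unfolding norm_closure_def by force

lemma norm_closureI:
  assumes "v \<in> vecs V" "\<And>e. e > 0 \<Longrightarrow> \<exists>s\<in>S. nrm V (v - s) < e"
  shows "v \<in> norm_closure V S"
  using assms by (auto simp: norm_closure_def)

lemma norm_closureE:
  assumes "v \<in> norm_closure V S" "e > 0"
  obtains s where "s \<in> S" "nrm V (v - s) < e"
  using assms by (auto simp: norm_closure_def)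

lemma lin_subspace_norm_closure:
  assumes "lin_subspace V S"
  shows "lin_subspace V (norm_closure V S)"
  unfolding lin_subspace_def
proof (intro conjI subspaceI)
  have S: "S \<subseteq> vecs V" "subspace S" using assms by (auto simp: lin_subspace_def)
  show "norm_closure V S \<subseteq> vecs V" by (rule norm_closure_subset)
  show "0 \<in> norm_closure V S" using subset_norm_closure[OF S(1)] subspace_0[OF S(2)] by blast
  show "u + v \<in> norm_closure V S" if "u \<in> norm_closure V S" "v \<in> norm_closure V S" for u v
  proof (rule norm_closureI)
    have uv: "u \<in> vecs V" "v \<in> vecs V" using that norm_closure_subset by auto
    then show "u + v \<in> vecs V" by (rule add_in_vecs)
    fix e :: real assume e: "e > 0"
    then obtain s t where st: "s \<in> S" "t \<in> S" "nrm V (u - s) < e / 2" "nrm V (v - t) < e / 2"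
      using norm_closureE[of u S "e / 2"] norm_closureE[of v S "e / 2"]
      by (metis half_gt_zero \<open>u \<in> norm_closure V S\<close> \<open>v \<in> norm_closure V S\<close>)
    have eq: "u + v - (s + t) = (u - s) + (v - t)" by (simp add: algebra_simps)
    have "nrm V ((u - s) + (v - t)) \<le> nrm V (u - s) + nrm V (v - t)"
      using uv st S by (intro nrm_triangle diff_in_vecs) auto
    also have "\<dots> < e" using st by simp
    finally have "nrm V (u + v - (s + t)) < e" unfolding eq .
    then show "\<exists>s\<in>S. nrm V (u + v - s) < e"
      using st subspace_add[OF S(2)] by blast
  qed
  show "scl V c u \<in> norm_closure V S" if "u \<in> norm_closure V S" for c u
  proof (rule norm_closureI)
    have u: "u \<in> vecs V" using that norm_closure_subset by auto
    then show "scl V c u \<in> vecs V" by (rule scl_in_vecs)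
    fix e :: real assume "e > 0"
    \<comment> \<open>The summand 1 covers \<open>c = 0\<close>.\<close>
    then have "e / (cmod c + 1) > 0" by (simp add: add_nonneg_pos)
    then obtain s where s: "s \<in> S" "nrm V (u - s) < e / (cmod c + 1)"
      using norm_closureE[of u S] \<open>u \<in> norm_closure V S\<close> by blast
    have "nrm V (scl V c u - scl V c s) = cmod c * nrm V (u - s)"
      using u s S by (simp add: nrm_scl diff_in_vecs subset_iff flip: scale_right_diff_distrib)
    also have "\<dots> \<le> (cmod c + 1) * nrm V (u - s)"
      using u s S by (intro mult_right_mono nrm_nonneg diff_in_vecs) auto
    also have "\<dots> < e" using s(2) by (simp add: pos_less_divide_eq add_nonneg_pos mult.commute)
    finally show "\<exists>s\<in>S. nrm V (scl V c u - s) < e"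
      using s subspace_scale[OF S(2)] by blast
  qed
qed

lemma complex_normed_space_restrict:
  assumes "lin_subspace V S"
  shows "complex_normed_space (V\<lparr>vecs := S\<rparr>)"
proof -
  have S: "S \<subseteq> vecs V" "subspace S" using assms by (auto simp: lin_subspace_def)
  show ?thesis
    using S by unfold_locales
      (auto simp: scale_right_distrib scale_left_distrib nrm_nonneg nrm_eq_0 nrm_triangle nrm_scl subset_iff)
qed

lemma dense_in_closure:
  assumes "S \<subseteq> vecs V"
  shows "dense_in (V\<lparr>vecs := norm_closure V S\<rparr>) S"
  using subset_norm_closure[OF assms] norm_closure_subset
  by (auto simp: dense_in_def norm_closure_def)

text \<open>It suffices that the span reaches some dense set: \<open>A0\<close> for the pairing into
  \<open>A\<close>, the whole carrier in the other density claims.\<close>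

lemma dense_in_lin_span:
  assumes "X \<subseteq> vecs V" "dense_in V S" "S \<subseteq> lin_span V X"
  shows "dense_in V (lin_span V X)"
proof -
  have "lin_span V X \<subseteq> vecs V"
    unfolding lin_span_def using assms(1) subspace_vecs by (rule span_minimal)
  then show ?thesis
    using assms(2,3) unfolding dense_in_def norm_closure_def by (auto; blast)
qed

end

text \<open>The ambient space supplies the limit, and an approximant from \<open>S\<close> of a late
  term of the sequence also approximates the limit.\<close>

lemma complex_banach_space_closure:
  assumes "complex_banach_space V" "lin_subspace V S"
  shows "complex_banach_space (V\<lparr>vecs := norm_closure V S\<rparr>)"
proof -
  interpret complex_banach_space V by fact
  interpret C: complex_normed_space "V\<lparr>vecs := norm_closure V S\<rparr>"
    by (intro complex_normed_space_restrict lin_subspace_norm_closure assms)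
  show ?thesis
  proof
    fix s :: "nat \<Rightarrow> 'a"
    assume s: "\<And>n. s n \<in> vecs (V\<lparr>vecs := norm_closure V S\<rparr>)"
      and "\<And>e. e > 0 \<Longrightarrow> \<exists>N. \<forall>m\<ge>N. \<forall>n\<ge>N. nrm (V\<lparr>vecs := norm_closure V S\<rparr>) (s m - s n) < e"
    then have cauchy: "\<And>e. e > 0 \<Longrightarrow> \<exists>N. \<forall>m\<ge>N. \<forall>n\<ge>N. nrm V (s m - s n) < e" by simp
    have sV: "s n \<in> vecs V" for n using s[of n] norm_closure_subset by auto
    obtain u where u: "u \<in> vecs V" "(\<lambda>n. nrm V (s n - u)) \<longlonglongrightarrow> 0"
      using complete[OF sV cauchy] by blast
    have "u \<in> norm_closure V S"
    proof (rule norm_closureI[OF u(1)])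
      fix e :: real assume "e > 0"
      then obtain n where n: "nrm V (s n - u) < e / 2"
        using order_tendstoD(2)[OF u(2), of "e / 2"] eventually_sequentially by auto
      obtain t where t: "t \<in> S" "nrm V (s n - t) < e / 2"
        using norm_closureE[of "s n" S "e / 2"] s[of n] \<open>e > 0\<close> by auto
      then have "t \<in> vecs V" using assms(2) by (auto simp: lin_subspace_def)
      then show "\<exists>t\<in>S. nrm V (u - t) < e"
        using nrm_diff_triangle[OF u(1) sV[of n] \<open>t \<in> vecs V\<close>] nrm_minus_commute[OF u(1) sV[of n]] t n
        by (intro bexI[of _ t]) auto
    qed
    with u show "\<exists>u\<in>vecs (V\<lparr>vecs := norm_closure V S\<rparr>).
        (\<lambda>n. nrm (V\<lparr>vecs := norm_closure V S\<rparr>) (s n - u)) \<longlonglongrightarrow> 0" by auto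
  qed
qed

section \<open>Bounded operators and the operator norm\<close>

lemma bounded_ops_iff:
  "T \<in> vecs (bounded_ops V W) \<longleftrightarrow>
     (\<forall>u\<in>vecs V. T u \<in> vecs W) \<and> (\<forall>u. u \<notin> vecs V \<longrightarrow> T u = 0) \<and>
     (\<forall>u\<in>vecs V. \<forall>v\<in>vecs V. T (u + v) = T u + T v) \<and>
     (\<forall>c. \<forall>u\<in>vecs V. T (scl V c u) = scl W c (T u)) \<and>
     (\<exists>C. \<forall>u\<in>vecs V. nrm W (T u) \<le> C * nrm V u)"
  by (simp add: bounded_ops_def)

lemma scl_bounded_ops [simp]: "scl (bounded_ops V W) c T = (\<lambda>u. scl W c (T u))"
  by (simp add: bounded_ops_def)

lemma bounded_opsI:
  assumes "\<And>u. u \<in> vecs V \<Longrightarrow> T u \<in> vecs W" "\<And>u. u \<notin> vecs V \<Longrightarrow> T u = 0"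
    and "\<And>u v. u \<in> vecs V \<Longrightarrow> v \<in> vecs V \<Longrightarrow> T (u + v) = T u + T v"
    and "\<And>c u. u \<in> vecs V \<Longrightarrow> T (scl V c u) = scl W c (T u)"
    and "\<And>u. u \<in> vecs V \<Longrightarrow> nrm W (T u) \<le> C * nrm V u"
  shows "T \<in> vecs (bounded_ops V W)"
  using assms unfolding bounded_ops_iff by blast

lemma
  assumes "T \<in> vecs (bounded_ops V W)"
  shows bounded_ops_in: "u \<in> vecs V \<Longrightarrow> T u \<in> vecs W"
    and bounded_ops_outside: "u \<notin> vecs V \<Longrightarrow> T u = 0"
    and bounded_ops_add: "u \<in> vecs V \<Longrightarrow> v \<in> vecs V \<Longrightarrow> T (u + v) = T u + T v"
    and bounded_ops_scl: "u \<in> vecs V \<Longrightarrow> T (scl V c u) = scl W c (T u)"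
  using assms by (simp_all add: bounded_ops_iff)

locale normed_space_pair = dom: complex_normed_space V + cod: complex_normed_space W
  for V :: "'a::ab_group_add cspace" and W :: "'b::ab_group_add cspace"
begin

lemma bounded_ops_zero [simp]:
  assumes "T \<in> vecs (bounded_ops V W)" shows "T 0 = 0"
  using bounded_ops_add[OF assms, of 0 0] by simp

lemma bounded_ops_minus:
  assumes "T \<in> vecs (bounded_ops V W)" "u \<in> vecs V" shows "T (- u) = - T u"
  using bounded_ops_scl[OF assms, of "-1"] by simp

lemma bounded_ops_diff:
  assumes "T \<in> vecs (bounded_ops V W)" "u \<in> vecs V" "v \<in> vecs V"
  shows "T (u - v) = T u - T v"
  using bounded_ops_add[OF assms(1), of u "- v"] assms by (simp add: bounded_ops_minus dom.minus_in_vecs)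

lemma bounded_ops_sum:
  assumes "T \<in> vecs (bounded_ops V W)" "\<And>i. i \<in> I \<Longrightarrow> f i \<in> vecs V"
  shows "T (sum f I) = (\<Sum>i\<in>I. T (f i))"
  using assms(2)
proof (induction I rule: infinite_finite_induct)
  case (insert i I)
  then show ?case using bounded_ops_add[OF assms(1), of "f i" "sum f I"] by (simp add: dom.sum_in_vecs)
qed (use assms(1) in auto)

text \<open>A real supremum over an unbounded set says nothing, so every upper estimate by the
  operator norm rests on this.\<close>

lemma bdd_above_unit_ball_image:
  assumes "T \<in> vecs (bounded_ops V W)"
  shows "bdd_above ((\<lambda>u. nrm W (T u)) ` {u \<in> vecs V. nrm V u \<le> 1})"
proof -
  obtain C where C: "\<And>u. u \<in> vecs V \<Longrightarrow> nrm W (T u) \<le> C * nrm V u"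
    using assms unfolding bounded_ops_iff by blast
  \<comment> \<open>The absolute value is taken because the constant in \<open>bounded_ops\<close>
    has no prescribed sign.\<close>
  have "nrm W (T u) \<le> \<bar>C\<bar>" if "u \<in> vecs V" "nrm V u \<le> 1" for u
  proof -
    have "C * nrm V u \<le> \<bar>C\<bar> * 1"
      using that dom.nrm_nonneg by (intro mult_mono) auto
    then show ?thesis using C[OF that(1)] by simp
  qed
  then show ?thesis by (auto intro!: bdd_aboveI)
qed

lemma nrm_bounded_ops_def:
  "nrm (bounded_ops V W) T = (SUP u\<in>{u \<in> vecs V. nrm V u \<le> 1}. nrm W (T u))"
  by (simp add: bounded_ops_def)

lemma nrm_bounded_ops_nonneg:
  assumes "T \<in> vecs (bounded_ops V W)"
  shows "0 \<le> nrm (bounded_ops V W) T"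
  unfolding nrm_bounded_ops_def
  by (rule cSUP_upper2[OF bdd_above_unit_ball_image[OF assms], where x = 0]) (use assms in auto)

lemma nrm_apply_le:
  assumes T: "T \<in> vecs (bounded_ops V W)" and u: "u \<in> vecs V"
  shows "nrm W (T u) \<le> nrm (bounded_ops V W) T * nrm V u"
proof (cases "u = 0")
  case False
  then have pos: "nrm V u > 0" using dom.nrm_nonneg[OF u] dom.nrm_eq_0[OF u] by linarith
  let ?c = "complex_of_real (1 / nrm V u)"
  have "nrm W (T (scl V ?c u)) \<le> nrm (bounded_ops V W) T"
    unfolding nrm_bounded_ops_def
    using u pos by (intro cSUP_upper bdd_above_unit_ball_image[OF T])
      (simp add: dom.scl_in_vecs dom.nrm_scl norm_divide)
  moreover have "nrm W (T (scl V ?c u)) = nrm W (T u) / nrm V u"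
    using pos u T by (simp add: bounded_ops_scl[OF T u] cod.nrm_scl bounded_ops_in[OF T] norm_divide)
  ultimately have "nrm W (T u) / nrm V u \<le> nrm (bounded_ops V W) T" by simp
  then show ?thesis using pos by (simp only: pos_divide_le_eq)
qed (use T in auto)

lemma nrm_bounded_ops_le:
  assumes "0 \<le> C" "\<And>u. u \<in> vecs V \<Longrightarrow> nrm W (T u) \<le> C * nrm V u"
  shows "nrm (bounded_ops V W) T \<le> C"
  unfolding nrm_bounded_ops_def
proof (rule cSUP_least)
  show "{u \<in> vecs V. nrm V u \<le> 1} \<noteq> {}" by (auto intro!: exI[of _ 0])
  fix u assume "u \<in> {u \<in> vecs V. nrm V u \<le> 1}"
  then have "u \<in> vecs V" "C * nrm V u \<le> C * 1"
    using assms(1) by (auto simp del: mult_1_right intro!: mult_left_mono)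
  with assms(2)[of u] show "nrm W (T u) \<le> C" by simp
qed

lemma bounded_ops_add_in:
  assumes "S \<in> vecs (bounded_ops V W)" "T \<in> vecs (bounded_ops V W)"
  shows "S + T \<in> vecs (bounded_ops V W)"
proof (rule bounded_opsI)
  fix u assume u: "u \<in> vecs V"
  have "nrm W (S u + T u) \<le> nrm W (S u) + nrm W (T u)"
    using u assms by (simp add: cod.nrm_triangle bounded_ops_in)
  also have "\<dots> \<le> nrm (bounded_ops V W) S * nrm V u + nrm (bounded_ops V W) T * nrm V u"
    using u assms by (intro add_mono nrm_apply_le)
  finally show "nrm W ((S + T) u) \<le> (nrm (bounded_ops V W) S + nrm (bounded_ops V W) T) * nrm V u"
    by (simp add: distrib_right)
qed (use assms in \<open>auto simp: bounded_ops_iff cod.add_in_vecs cod.scale_right_distrib\<close>)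

lemma bounded_ops_scl_in:
  assumes "T \<in> vecs (bounded_ops V W)"
  shows "(\<lambda>u. scl W c (T u)) \<in> vecs (bounded_ops V W)"
proof (rule bounded_opsI)
  fix u assume u: "u \<in> vecs V"
  show "nrm W (scl W c (T u)) \<le> (cmod c * nrm (bounded_ops V W) T) * nrm V u"
    using u assms nrm_apply_le[OF assms u]
    by (simp add: cod.nrm_scl bounded_ops_in mult.assoc mult_left_mono)
qed (use assms in \<open>auto simp: bounded_ops_iff cod.scl_in_vecs cod.scale_right_distrib cod.scale_left_commute\<close>)

sublocale bounded_ops: complex_normed_space "bounded_ops V W"
proof
  have zero: "0 \<in> vecs (bounded_ops V W)" 
    by (rule bounded_opsI[where C = 0]) auto
  interpret vector_space "scl (bounded_ops V W)"
    by standard (auto simp: fun_eq_iff cod.scale_right_distrib cod.scale_left_distrib)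
  show "\<And>a x y. scl (bounded_ops V W) a (x + y) = scl (bounded_ops V W) a x + scl (bounded_ops V W) a y"
    "\<And>a b x. scl (bounded_ops V W) (a + b) x = scl (bounded_ops V W) a x + scl (bounded_ops V W) b x"
    "\<And>a b x. scl (bounded_ops V W) a (scl (bounded_ops V W) b x) = scl (bounded_ops V W) (a * b) x"
    "\<And>x. scl (bounded_ops V W) 1 x = x"
    by (rule scale_right_distrib scale_left_distrib scale_scale scale_one)+
  show "module.subspace (scl (bounded_ops V W)) (vecs (bounded_ops V W))"
    using zero by (intro subspaceI) (auto intro: bounded_ops_add_in bounded_ops_scl_in)
  fix S T assume S: "S \<in> vecs (bounded_ops V W)"
  show "0 \<le> nrm (bounded_ops V W) S" by (rule nrm_bounded_ops_nonneg[OF S])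
  show "nrm (bounded_ops V W) S = 0 \<longleftrightarrow> S = 0"
  proof
    assume "nrm (bounded_ops V W) S = 0"
    have "S u = 0" for u
    proof (cases "u \<in> vecs V")
      case True
      then have "nrm W (S u) \<le> 0" using nrm_apply_le[OF S] \<open>nrm (bounded_ops V W) S = 0\<close> by force
      then show ?thesis
        using cod.nrm_nonneg[OF bounded_ops_in[OF S True]] cod.nrm_eq_0[OF bounded_ops_in[OF S True]]
        by linarith
    qed (rule bounded_ops_outside[OF S])
    then show "S = 0" by (simp add: fun_eq_iff)
  next
    assume "S = 0"
    then have "nrm (bounded_ops V W) S \<le> 0" by (intro nrm_bounded_ops_le) auto
    with nrm_bounded_ops_nonneg[OF S] show "nrm (bounded_ops V W) S = 0" by simp
  qed
  show "nrm (bounded_ops V W) (scl (bounded_ops V W) c S) = cmod c * nrm (bounded_ops V W) S" for c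
  proof (cases "c = 0")
    case True
    have "nrm (bounded_ops V W) (scl (bounded_ops V W) c S) \<le> 0"
      using True by (intro nrm_bounded_ops_le) auto
    with nrm_bounded_ops_nonneg[OF bounded_ops_scl_in[OF S, of c]] True show ?thesis by simp
  next
    case False
    \<comment> \<open>Only this inequality is direct. Applied to the multiple of \<open>S\<close> by
      \<open>c\<close> and to the scalar \<open>inverse c\<close> it gives the reverse one.\<close>
    have le: "nrm (bounded_ops V W) (\<lambda>u. scl W c (T u)) \<le> cmod c * nrm (bounded_ops V W) T"
      if T: "T \<in> vecs (bounded_ops V W)" for c T
      using nrm_apply_le[OF T] nrm_bounded_ops_nonneg[OF T]
      by (intro nrm_bounded_ops_le)
        (auto simp: cod.nrm_scl bounded_ops_in[OF T] mult.assoc mult_left_mono)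
    have "nrm (bounded_ops V W) S \<le> cmod (inverse c) * nrm (bounded_ops V W) (\<lambda>u. scl W c (S u))"
      using le[OF bounded_ops_scl_in[OF S, of c], of "inverse c"] False by simp
    from mult_left_mono[OF this, of "cmod c"]
    have "cmod c * nrm (bounded_ops V W) S \<le> nrm (bounded_ops V W) (\<lambda>u. scl W c (S u))"
      using False by (simp add: norm_inverse flip: mult.assoc)
    with le[OF S, of c] show ?thesis by simp
  qed
  assume T: "T \<in> vecs (bounded_ops V W)"
  show "nrm (bounded_ops V W) (S + T) \<le> nrm (bounded_ops V W) S + nrm (bounded_ops V W) T"
  proof (rule nrm_bounded_ops_le)
    fix u assume u: "u \<in> vecs V"
    have "nrm W (S u + T u) \<le> nrm W (S u) + nrm W (T u)"
      using u S T by (simp add: cod.nrm_triangle bounded_ops_in)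
    also have "\<dots> \<le> nrm (bounded_ops V W) S * nrm V u + nrm (bounded_ops V W) T * nrm V u"
      using u S T by (intro add_mono nrm_apply_le)
    finally show "nrm W ((S + T) u) \<le> (nrm (bounded_ops V W) S + nrm (bounded_ops V W) T) * nrm V u"
      by (simp add: distrib_right)
  qed (simp add: nrm_bounded_ops_nonneg S T)
qed

end

lemma complex_banach_space_bounded_ops:
  fixes V :: "'a::ab_group_add cspace" and W :: "'b::ab_group_add cspace"
  assumes "complex_normed_space V" "complex_banach_space W"
  shows "complex_banach_space (bounded_ops V W)"
proof -
  interpret dom: complex_normed_space V by fact
  interpret cod: complex_banach_space W by fact
  interpret normed_space_pair V W ..
  show ?thesis
  proof
    fix s :: "nat \<Rightarrow> 'a \<Rightarrow> 'b" assume s: "\<And>n. s n \<in> vecs (bounded_ops V W)"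
      and cauchy: "\<And>e. e > 0 \<Longrightarrow> \<exists>N. \<forall>m\<ge>N. \<forall>n\<ge>N. nrm (bounded_ops V W) (s m - s n) < e"
    have mem: "s m - s n \<in> vecs (bounded_ops V W)" for m n
      by (intro bounded_ops.diff_in_vecs s)
    have pt: "nrm W (s m u - s n u) \<le> e * nrm V u"
      if "u \<in> vecs V" "nrm (bounded_ops V W) (s m - s n) \<le> e" for m n u e
      using nrm_apply_le[OF mem that(1), of m n] mult_right_mono[OF that(2) dom.nrm_nonneg[OF that(1)]]
      by simp
    have "\<exists>w\<in>vecs W. (\<lambda>n. nrm W (s n u - w)) \<longlonglongrightarrow> 0" if u: "u \<in> vecs V" for u
    proof (rule cod.complete)
      show "s n u \<in> vecs W" for n by (rule bounded_ops_in[OF s u])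
      fix e :: real assume e: "e > 0"
      have pos: "nrm V u + 1 > 0" using dom.nrm_nonneg[OF u] by simp
      obtain N where N: "\<forall>m\<ge>N. \<forall>n\<ge>N. nrm (bounded_ops V W) (s m - s n) < e / (nrm V u + 1)"
        using cauchy[of "e / (nrm V u + 1)"] e pos by auto
      have "nrm W (s m u - s n u) < e" if "m \<ge> N" "n \<ge> N" for m n
      proof -
        have "nrm W (s m u - s n u) \<le> e / (nrm V u + 1) * nrm V u"
          using N that by (intro pt[OF u]) (simp add: less_imp_le)
        also have "\<dots> < e" using e pos by (simp add: field_simps)
        finally show ?thesis .
      qed
      then show "\<exists>N. \<forall>m\<ge>N. \<forall>n\<ge>N. nrm W (s m u - s n u) < e" by blast
    qed
    then obtain L where L: "\<And>u. u \<in> vecs V \<Longrightarrow> L u \<in> vecs W"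
        "\<And>u. u \<in> vecs V \<Longrightarrow> (\<lambda>n. nrm W (s n u - L u)) \<longlonglongrightarrow> 0" by metis
    define T where "T u = (if u \<in> vecs V then L u else 0)" for u
    have T: "T u \<in> vecs W" "(\<lambda>n. nrm W (s n u - T u)) \<longlonglongrightarrow> 0" if "u \<in> vecs V" for u
      using L that by (simp_all add: T_def)
    \<comment> \<open>One index \<open>N\<close> serves all \<open>u\<close>, since the limit in the
      other index is taken at fixed \<open>u\<close>. This uniformity gives both the boundedness of
      \<open>T\<close> and the convergence in operator norm.\<close>
    have close: "\<exists>N. \<forall>n\<ge>N. \<forall>u\<in>vecs V. nrm W (T u - s n u) \<le> e * nrm V u" if "e > 0" for e
    proof -
      obtain N where N: "\<forall>m\<ge>N. \<forall>n\<ge>N. nrm (bounded_ops V W) (s m - s n) < e"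
        using cauchy[OF \<open>e > 0\<close>] by auto
      have "nrm W (T u - s n u) \<le> e * nrm V u" if "n \<ge> N" "u \<in> vecs V" for n u
        using N that by (intro cod.nrm_limit_le[OF T(2), where N = N] bounded_ops_in[OF s] T pt)
          (auto simp: less_imp_le)
      then show ?thesis by blast
    qed
    have "T \<in> vecs (bounded_ops V W)"
    proof -
      obtain n where n: "\<And>u. u \<in> vecs V \<Longrightarrow> nrm W (T u - s n u) \<le> 1 * nrm V u"
        using close[of 1] by auto
      show ?thesis
      proof (rule bounded_opsI)
        fix u assume u: "u \<in> vecs V"
        show "T u \<in> vecs W" by (rule T(1)[OF u])
        have "nrm W ((T u - s n u) + s n u) \<le> nrm W (T u - s n u) + nrm W (s n u)"
          using u by (intro cod.nrm_triangle cod.diff_in_vecs T bounded_ops_in[OF s])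
        also have "\<dots> \<le> 1 * nrm V u + nrm (bounded_ops V W) (s n) * nrm V u"
          using u by (intro add_mono n nrm_apply_le s)
        finally show "nrm W (T u) \<le> (1 + nrm (bounded_ops V W) (s n)) * nrm V u"
          by (simp add: algebra_simps)
        show "T (scl V c u) = scl W c (T u)" for c
        proof (rule cod.nrm_limit_unique[where s = "\<lambda>n. s n (scl V c u)"])
          have "(\<lambda>n. cmod c * nrm W (s n u - T u)) \<longlonglongrightarrow> cmod c * 0"
            by (intro tendsto_mult_left T u)
          then show "(\<lambda>n. nrm W (s n (scl V c u) - scl W c (T u))) \<longlonglongrightarrow> 0"
            using u by (simp add: bounded_ops_scl[OF s] bounded_ops_in[OF s] T cod.diff_in_vecs cod.nrm_scl
                flip: cod.scale_right_diff_distrib)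
        qed (use u in \<open>auto intro!: T bounded_ops_in[OF s] dom.scl_in_vecs cod.scl_in_vecs\<close>)
        fix v assume v: "v \<in> vecs V"
        show "T (u + v) = T u + T v"
        proof (rule cod.nrm_limit_unique[where s = "\<lambda>n. s n (u + v)"])
          show "(\<lambda>n. nrm W (s n (u + v) - (T u + T v))) \<longlonglongrightarrow> 0"
          proof (rule tendsto_sandwich)
            show "\<forall>\<^sub>F n in sequentially. 0 \<le> nrm W (s n (u + v) - (T u + T v))"
              using u v by (intro always_eventually allI cod.nrm_nonneg)
                (auto intro!: T bounded_ops_in[OF s] dom.add_in_vecs cod.add_in_vecs cod.diff_in_vecs)
            have "nrm W (s n (u + v) - (T u + T v)) \<le> nrm W (s n u - T u) + nrm W (s n v - T v)" for n
            proof -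
              have "nrm W ((s n u - T u) + (s n v - T v)) \<le> nrm W (s n u - T u) + nrm W (s n v - T v)"
                using u v by (intro cod.nrm_triangle cod.diff_in_vecs T bounded_ops_in[OF s])
              then show ?thesis by (simp add: bounded_ops_add[OF s u v] algebra_simps)
            qed
            then show "\<forall>\<^sub>F n in sequentially. nrm W (s n (u + v) - (T u + T v))
                \<le> nrm W (s n u - T u) + nrm W (s n v - T v)" by simp
            show "(\<lambda>n. nrm W (s n u - T u) + nrm W (s n v - T v)) \<longlonglongrightarrow> 0"
              using tendsto_add[OF T(2)[OF u] T(2)[OF v]] by simp
          qed simp
        qed (use u v in \<open>auto intro!: T bounded_ops_in[OF s] dom.add_in_vecs cod.add_in_vecs\<close>)
      qed (simp add: T_def)
    qed
    moreover have "(\<lambda>n. nrm (bounded_ops V W) (s n - T)) \<longlonglongrightarrow> 0"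
    proof (rule LIMSEQ_I)
      fix e :: real assume "e > 0"
      then obtain N where N: "\<And>n u. n \<ge> N \<Longrightarrow> u \<in> vecs V \<Longrightarrow> nrm W (T u - s n u) \<le> e / 2 * nrm V u"
        using close[of "e / 2"] by auto
      have "norm (nrm (bounded_ops V W) (s n - T) - 0) < e" if "n \<ge> N" for n
      proof -
        have "nrm (bounded_ops V W) (T - s n) \<le> e / 2"
          using N[OF that] \<open>e > 0\<close> by (intro nrm_bounded_ops_le) auto
        then have "nrm (bounded_ops V W) (s n - T) < e"
          using bounded_ops.nrm_minus_commute[OF s \<open>T \<in> _\<close>] \<open>e > 0\<close> by simp
        then show ?thesis
          using bounded_ops.nrm_nonneg[OF bounded_ops.diff_in_vecs[OF s \<open>T \<in> _\<close>]] by simp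
      qed
      then show "\<exists>N. \<forall>n\<ge>N. norm (nrm (bounded_ops V W) (s n - T) - 0) < e" by blast
    qed
    ultimately show "\<exists>T\<in>vecs (bounded_ops V W). (\<lambda>n. nrm (bounded_ops V W) (s n - T)) \<longlonglongrightarrow> 0" by blast
  qed
qed

section \<open>Composition, and its extension to closures\<close>

text \<open>Products, module actions and pairings of the context are all compositions, so this one
  statement, once restricted to closures, covers the eight maps involved.\<close>

lemma contractive_bilinear_comp:
  assumes "complex_normed_space U" "complex_normed_space V" "complex_normed_space W"
  shows "contractive_bilinear (bounded_ops V W) (bounded_ops U V) (bounded_ops U W) (\<circ>)"
proof -
  interpret U: complex_normed_space U by fact
  interpret V: complex_normed_space V by fact
  interpret W: complex_normed_space W by fact
  interpret UV: normed_space_pair U V ..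
  interpret VW: normed_space_pair V W ..
  interpret UW: normed_space_pair U W ..
  have bound: "nrm W (S (T u)) \<le> nrm (bounded_ops V W) S * nrm (bounded_ops U V) T * nrm U u"
    if "S \<in> vecs (bounded_ops V W)" "T \<in> vecs (bounded_ops U V)" "u \<in> vecs U" for S T u
  proof -
    have "nrm W (S (T u)) \<le> nrm (bounded_ops V W) S * nrm V (T u)"
      using that by (simp add: VW.nrm_apply_le bounded_ops_in)
    also have "\<dots> \<le> nrm (bounded_ops V W) S * (nrm (bounded_ops U V) T * nrm U u)"
      using that by (intro mult_left_mono UV.nrm_apply_le VW.nrm_bounded_ops_nonneg)
    finally show ?thesis by (simp add: mult.assoc)
  qed
  have mem: "S \<circ> T \<in> vecs (bounded_ops U W)"
    if "S \<in> vecs (bounded_ops V W)" "T \<in> vecs (bounded_ops U V)" for S T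
    using that by (intro bounded_opsI[where C = "nrm (bounded_ops V W) S * nrm (bounded_ops U V) T"])
      (simp_all add: bound bounded_ops_in bounded_ops_add bounded_ops_scl bounded_ops_outside)
  have nrm: "nrm (bounded_ops U W) (S \<circ> T) \<le> nrm (bounded_ops V W) S * nrm (bounded_ops U V) T"
    if "S \<in> vecs (bounded_ops V W)" "T \<in> vecs (bounded_ops U V)" for S T
    using that by (intro UW.nrm_bounded_ops_le)
      (auto simp: bound VW.nrm_bounded_ops_nonneg UV.nrm_bounded_ops_nonneg)
  \<comment> \<open>In the right factor additivity needs linearity of \<open>S\<close>, with
    \<open>S 0 = 0\<close> outside the domain; in the left factor it is the pointwise definition of
    the sum.\<close>
  have add: "S \<circ> (T + T') = (S \<circ> T) + (S \<circ> T')"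
    if "S \<in> vecs (bounded_ops V W)" "T \<in> vecs (bounded_ops U V)" "T' \<in> vecs (bounded_ops U V)" for S T T'
  proof
    fix u show "(S \<circ> (T + T')) u = ((S \<circ> T) + (S \<circ> T')) u"
      using that by (cases "u \<in> vecs U")
        (auto simp: bounded_ops_add[OF that(1)] bounded_ops_in bounded_ops_outside)
  qed
  have scl: "S \<circ> scl (bounded_ops U V) c T = scl (bounded_ops U W) c (S \<circ> T)"
    if "S \<in> vecs (bounded_ops V W)" "T \<in> vecs (bounded_ops U V)" for S T c
  proof
    fix u show "(S \<circ> scl (bounded_ops U V) c T) u = scl (bounded_ops U W) c (S \<circ> T) u"
      using that by (cases "u \<in> vecs U")
        (auto simp: bounded_ops_scl[OF that(1)] bounded_ops_in bounded_ops_outside)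
  qed
  show ?thesis
    unfolding contractive_bilinear_def
    by (intro conjI ballI allI mem nrm add scl) (auto simp: fun_eq_iff)
qed

text \<open>The common form of \<open>UB\<close>, \<open>Bu\<close>, \<open>Eg_space\<close> and
  \<open>El_space\<close>; it lets the Morita structure be treated for arbitrary spaces of
  operators.\<close>

definition op_closure ::
  "'a::ab_group_add cspace \<Rightarrow> 'b::ab_group_add cspace \<Rightarrow> ('a \<Rightarrow> 'b) set \<Rightarrow> ('a \<Rightarrow> 'b) cspace" where
  "op_closure V W S = (bounded_ops V W)\<lparr>vecs := norm_closure (bounded_ops V W) S\<rparr>"

lemma complex_banach_space_op_closure:
  assumes "complex_normed_space V" "complex_banach_space W" "lin_subspace (bounded_ops V W) S"
  shows "complex_banach_space (op_closure V W S)"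
  unfolding op_closure_def
  by (intro complex_banach_space_closure complex_banach_space_bounded_ops assms)

lemma contractive_bilinear_restrict:
  assumes "contractive_bilinear V W U m" and sub: "S \<subseteq> vecs V" "T \<subseteq> vecs W"
    and "\<And>v w. v \<in> S \<Longrightarrow> w \<in> T \<Longrightarrow> m v w \<in> R"
  shows "contractive_bilinear (V\<lparr>vecs := S\<rparr>) (W\<lparr>vecs := T\<rparr>) (U\<lparr>vecs := R\<rparr>) m"
  using assms(1,4) subsetD[OF sub(1)] subsetD[OF sub(2)] by (simp add: contractive_bilinear_def)

text \<open>For approximants \<open>s\<close> of \<open>a\<close> and \<open>t\<close> of
  \<open>b\<close> the error splits as \<open>a (b - t) + (a - s) t\<close>, and
  \<open>s \<circ> t\<close> is in \<open>S3\<close>.\<close>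

lemma contractive_bilinear_comp_closure:
  assumes "complex_normed_space U" "complex_normed_space V" "complex_normed_space W"
    and S: "lin_subspace (bounded_ops V W) S1" "lin_subspace (bounded_ops U V) S2"
      "lin_subspace (bounded_ops U W) S3"
    and comp: "\<forall>a\<in>S1. \<forall>b\<in>S2. a \<circ> b \<in> S3"
  shows "contractive_bilinear (op_closure V W S1) (op_closure U V S2) (op_closure U W S3) (\<circ>)"
proof -
  interpret U: complex_normed_space U by fact
  interpret V: complex_normed_space V by fact
  interpret W: complex_normed_space W by fact
  interpret UV: normed_space_pair U V ..
  interpret VW: normed_space_pair V W ..
  interpret UW: normed_space_pair U W ..
  note bil = contractive_bilinear_comp[OF assms(1-3)]
  have mem: "a \<circ> b \<in> vecs (bounded_ops U W)"
    and nrm: "nrm (bounded_ops U W) (a \<circ> b) \<le> nrm (bounded_ops V W) a * nrm (bounded_ops U V) b"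
    if "a \<in> vecs (bounded_ops V W)" "b \<in> vecs (bounded_ops U V)" for a b
    using bil that by (simp_all add: contractive_bilinear_def)
  have "a \<circ> b \<in> norm_closure (bounded_ops U W) S3"
    if a: "a \<in> norm_closure (bounded_ops V W) S1" and b: "b \<in> norm_closure (bounded_ops U V) S2" for a b
  proof (rule UW.bounded_ops.norm_closureI)
    have ab: "a \<in> vecs (bounded_ops V W)" "b \<in> vecs (bounded_ops U V)"
      using a b VW.bounded_ops.norm_closure_subset UV.bounded_ops.norm_closure_subset by auto
    then show "a \<circ> b \<in> vecs (bounded_ops U W)" by (rule mem)
    fix e :: real assume e: "e > 0"
    \<comment> \<open>\<open>M\<close> bounds \<open>a\<close> and also every approximant of
      \<open>b\<close> at distance at most 1.\<close>
    define M where "M = nrm (bounded_ops V W) a + nrm (bounded_ops U V) b + 1"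
    have M: "M > 0" "nrm (bounded_ops V W) a \<le> M" "nrm (bounded_ops U V) b + 1 \<le> M"
      using VW.bounded_ops.nrm_nonneg[OF ab(1)] UV.bounded_ops.nrm_nonneg[OF ab(2)] by (auto simp: M_def)
    \<comment> \<open>The bound 1 keeps the norm of \<open>t\<close> below \<open>M\<close>; the
      bound \<open>e / (2 * M)\<close> makes the two error terms add up to at most
      \<open>e\<close>.\<close>
    define d where "d = min 1 (e / (2 * M))"
    have d: "d > 0" "d \<le> 1" "d \<le> e / (2 * M)" using e M by (auto simp: d_def)
    obtain s where s: "s \<in> S1" "nrm (bounded_ops V W) (a - s) < d"
      using VW.bounded_ops.norm_closureE[OF a d(1)] .
    obtain t where t: "t \<in> S2" "nrm (bounded_ops U V) (b - t) < d"
      using UV.bounded_ops.norm_closureE[OF b d(1)] .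
    have st: "s \<in> vecs (bounded_ops V W)" "t \<in> vecs (bounded_ops U V)"
      using s t S by (auto simp: lin_subspace_def)
    have st': "a - s \<in> vecs (bounded_ops V W)" "b - t \<in> vecs (bounded_ops U V)"
      using ab st by (auto intro: VW.bounded_ops.diff_in_vecs UV.bounded_ops.diff_in_vecs)
    have tM: "nrm (bounded_ops U V) t \<le> M"
    proof -
      have "nrm (bounded_ops U V) (b - (b - t)) \<le> nrm (bounded_ops U V) b + nrm (bounded_ops U V) (b - t)"
        using ab st' by (intro UV.bounded_ops.nrm_diff_le)
      then show ?thesis using t(2) d M by simp
    qed
    have "(a \<circ> b) - (s \<circ> t) = (a \<circ> (b - t)) + ((a - s) \<circ> t)"
    proof
      fix u show "((a \<circ> b) - (s \<circ> t)) u = ((a \<circ> (b - t)) + ((a - s) \<circ> t)) u"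
        using ab st VW.bounded_ops_zero[OF ab(1)] VW.bounded_ops_zero[OF st(1)]
        by (cases "u \<in> vecs U")
          (simp_all add: VW.bounded_ops_diff[OF ab(1)] bounded_ops_in bounded_ops_outside)
    qed
    then have "nrm (bounded_ops U W) ((a \<circ> b) - (s \<circ> t))
        \<le> nrm (bounded_ops U W) (a \<circ> (b - t)) + nrm (bounded_ops U W) ((a - s) \<circ> t)"
      using ab st st' by (simp add: UW.bounded_ops.nrm_triangle mem)
    also have "\<dots> \<le> nrm (bounded_ops V W) a * nrm (bounded_ops U V) (b - t)
        + nrm (bounded_ops V W) (a - s) * nrm (bounded_ops U V) t"
      using ab st st' by (intro add_mono nrm)
    also have "\<dots> \<le> M * nrm (bounded_ops U V) (b - t) + nrm (bounded_ops V W) (a - s) * M"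
      using M tM st' by (intro add_mono mult_right_mono mult_left_mono UV.bounded_ops.nrm_nonneg
          VW.bounded_ops.nrm_nonneg) auto
    also have "\<dots> < M * d + d * M"
      using M s t by (intro add_strict_mono mult_strict_left_mono mult_strict_right_mono)
    also have "\<dots> \<le> e" using d(3) M by (simp add: field_simps)
    finally show "\<exists>r\<in>S3. nrm (bounded_ops U W) ((a \<circ> b) - r) < e"
      using comp s(1) t(1) by blast
  qed
  then show ?thesis
    unfolding op_closure_def
    by (intro contractive_bilinear_restrict bil VW.bounded_ops.norm_closure_subset
        UV.bounded_ops.norm_closure_subset)
qed

text \<open>The retraction \<open>P J = 1\<close> makes nondegeneracy and fullness over
  \<open>B\<close> exact, without approximation. Nothing similar holds on the side of
  \<open>A\<close>, where \<open>J P\<close> is only an idempotent; fullness there is the separate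
  assumption \<open>full\<close> on the dense level.\<close>

lemma compatible_dense_subcontext_of_operators:
  fixes V :: "'v::ab_group_add cspace" and W :: "'w::ab_group_add cspace"
  assumes V: "complex_banach_space V" and W: "complex_banach_space W"
    and A0: "lin_subspace (bounded_ops W W) A0" and B0: "lin_subspace (bounded_ops V V) B0"
    and L0: "lin_subspace (bounded_ops W V) L0" and G0: "lin_subspace (bounded_ops V W) G0"
    and AA: "\<And>a a'. a \<in> A0 \<Longrightarrow> a' \<in> A0 \<Longrightarrow> a \<circ> a' \<in> A0"
    and BB: "\<And>b b'. b \<in> B0 \<Longrightarrow> b' \<in> B0 \<Longrightarrow> b \<circ> b' \<in> B0"
    and BL: "\<And>b x. b \<in> B0 \<Longrightarrow> x \<in> L0 \<Longrightarrow> b \<circ> x \<in> L0"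
    and LA: "\<And>x a. x \<in> L0 \<Longrightarrow> a \<in> A0 \<Longrightarrow> x \<circ> a \<in> L0"
    and AG: "\<And>a y. a \<in> A0 \<Longrightarrow> y \<in> G0 \<Longrightarrow> a \<circ> y \<in> G0"
    and GB: "\<And>y b. y \<in> G0 \<Longrightarrow> b \<in> B0 \<Longrightarrow> y \<circ> b \<in> G0"
    and LG: "\<And>x y. x \<in> L0 \<Longrightarrow> y \<in> G0 \<Longrightarrow> x \<circ> y \<in> B0"
    and GL: "\<And>y x. y \<in> G0 \<Longrightarrow> x \<in> L0 \<Longrightarrow> y \<circ> x \<in> A0"
    and J: "J \<in> G0" and P: "P \<in> L0" and PJ: "\<And>v. v \<in> vecs V \<Longrightarrow> P (J v) = v"
    and full: "A0 \<subseteq> lin_span (bounded_ops W W) {y \<circ> x | x y. x \<in> L0 \<and> y \<in> G0}"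
  shows "compatible_dense_subcontext (op_closure W W A0) (\<circ>) (op_closure V V B0) (\<circ>) (op_closure W V L0) (\<circ>) (\<circ>)
    (op_closure V W G0) (\<circ>) (\<circ>) (\<circ>) (\<circ>) A0 B0 L0 G0"
proof -
  interpret V: complex_banach_space V by fact
  interpret W: complex_banach_space W by fact
  note VW_ns = V.complex_normed_space_axioms W.complex_normed_space_axioms
  interpret VV: normed_space_pair V V ..
  interpret WW: normed_space_pair W W ..
  interpret VW: normed_space_pair V W ..
  interpret WV: normed_space_pair W V ..
  interpret A: complex_banach_space "op_closure W W A0"
    by (intro complex_banach_space_op_closure VW_ns W A0)
  interpret B: complex_banach_space "op_closure V V B0"
    by (intro complex_banach_space_op_closure VW_ns V B0)
  interpret L: complex_banach_space "op_closure W V L0"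
    by (intro complex_banach_space_op_closure VW_ns V L0)
  interpret G: complex_banach_space "op_closure V W G0"
    by (intro complex_banach_space_op_closure VW_ns W G0)
  have comps: "\<forall>a\<in>A0. \<forall>a'\<in>A0. a \<circ> a' \<in> A0" "\<forall>b\<in>B0. \<forall>b'\<in>B0. b \<circ> b' \<in> B0"
    "\<forall>b\<in>B0. \<forall>x\<in>L0. b \<circ> x \<in> L0" "\<forall>x\<in>L0. \<forall>a\<in>A0. x \<circ> a \<in> L0"
    "\<forall>a\<in>A0. \<forall>y\<in>G0. a \<circ> y \<in> G0" "\<forall>y\<in>G0. \<forall>b\<in>B0. y \<circ> b \<in> G0"
    "\<forall>x\<in>L0. \<forall>y\<in>G0. x \<circ> y \<in> B0" "\<forall>y\<in>G0. \<forall>x\<in>L0. y \<circ> x \<in> A0"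
    by (simp_all add: AA BB BL LA AG GB LG GL)
  note bil = contractive_bilinear_comp_closure[OF VW_ns(2,2,2) A0 A0 A0 comps(1)]
    contractive_bilinear_comp_closure[OF VW_ns(1,1,1) B0 B0 B0 comps(2)]
    contractive_bilinear_comp_closure[OF VW_ns(2,1,1) B0 L0 L0 comps(3)]
    contractive_bilinear_comp_closure[OF VW_ns(2,2,1) L0 A0 L0 comps(4)]
    contractive_bilinear_comp_closure[OF VW_ns(1,2,2) A0 G0 G0 comps(5)]
    contractive_bilinear_comp_closure[OF VW_ns(1,1,2) G0 B0 G0 comps(6)]
    contractive_bilinear_comp_closure[OF VW_ns(1,2,1) L0 G0 B0 comps(7)]
    contractive_bilinear_comp_closure[OF VW_ns(2,1,2) G0 L0 A0 comps(8)]
  have mem: "\<And>a y. a \<in> vecs (op_closure W W A0) \<Longrightarrow> y \<in> vecs (op_closure V W G0) \<Longrightarrow> a \<circ> y \<in> vecs (op_closure V W G0)"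
    "\<And>b x. b \<in> vecs (op_closure V V B0) \<Longrightarrow> x \<in> vecs (op_closure W V L0) \<Longrightarrow> b \<circ> x \<in> vecs (op_closure W V L0)"
    "\<And>x a. x \<in> vecs (op_closure W V L0) \<Longrightarrow> a \<in> vecs (op_closure W W A0) \<Longrightarrow> x \<circ> a \<in> vecs (op_closure W V L0)"
    "\<And>y b. y \<in> vecs (op_closure V W G0) \<Longrightarrow> b \<in> vecs (op_closure V V B0) \<Longrightarrow> y \<circ> b \<in> vecs (op_closure V W G0)"
    "\<And>x y. x \<in> vecs (op_closure W V L0) \<Longrightarrow> y \<in> vecs (op_closure V W G0) \<Longrightarrow> x \<circ> y \<in> vecs (op_closure V V B0)"
    "\<And>y x. y \<in> vecs (op_closure V W G0) \<Longrightarrow> x \<in> vecs (op_closure W V L0) \<Longrightarrow> y \<circ> x \<in> vecs (op_closure W W A0)"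
    using bil by (simp_all add: contractive_bilinear_def)
  have sub: "A0 \<subseteq> vecs (bounded_ops W W)" "B0 \<subseteq> vecs (bounded_ops V V)"
    "L0 \<subseteq> vecs (bounded_ops W V)" "G0 \<subseteq> vecs (bounded_ops V W)"
    using A0 B0 L0 G0 by (auto simp: lin_subspace_def)
  have sub_cl: "A0 \<subseteq> vecs (op_closure W W A0)" "B0 \<subseteq> vecs (op_closure V V B0)" "L0 \<subseteq> vecs (op_closure W V L0)" "G0 \<subseteq> vecs (op_closure V W G0)"
    using WW.bounded_ops.subset_norm_closure[OF sub(1)] VV.bounded_ops.subset_norm_closure[OF sub(2)]
      WV.bounded_ops.subset_norm_closure[OF sub(3)] VW.bounded_ops.subset_norm_closure[OF sub(4)]
    by (simp_all add: op_closure_def)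
  have cl_sub: "vecs (op_closure W W A0) \<subseteq> vecs (bounded_ops W W)" "vecs (op_closure V V B0) \<subseteq> vecs (bounded_ops V V)"
    "vecs (op_closure W V L0) \<subseteq> vecs (bounded_ops W V)" "vecs (op_closure V W G0) \<subseteq> vecs (bounded_ops V W)"
    by (simp_all add: op_closure_def norm_closure_def)
  have J': "J \<in> vecs (op_closure V W G0)" and P': "P \<in> vecs (op_closure W V L0)" using J P sub_cl by auto
  have L_unit: "P \<circ> (J \<circ> x) = x" if "x \<in> vecs (op_closure W V L0)" for x
  proof
    fix u show "(P \<circ> (J \<circ> x)) u = x u"
      using that cl_sub(3) PJ bounded_ops_in[of x W V u] bounded_ops_outside[of x W V u]
      by (cases "u \<in> vecs W") auto
  qed
  have B_unit: "(b \<circ> P) \<circ> J = b" if "b \<in> vecs (op_closure V V B0)" for b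
  proof
    fix v
    have "J \<in> vecs (bounded_ops V W)" "P \<in> vecs (bounded_ops W V)" using J P sub by auto
    then show "((b \<circ> P) \<circ> J) v = b v"
      using that cl_sub(2) PJ bounded_ops_outside[of b V V v] bounded_ops_outside[of J V W v]
        VV.bounded_ops_zero[of b] WV.bounded_ops_zero[of P]
      by (cases "v \<in> vecs V") auto
  qed
  have G_unit: "(y \<circ> P) \<circ> J = y" if "y \<in> vecs (op_closure V W G0)" for y
  proof
    fix v
    have "J \<in> vecs (bounded_ops V W)" "P \<in> vecs (bounded_ops W V)" using J P sub by auto
    then show "((y \<circ> P) \<circ> J) v = y v"
      using that cl_sub(4) PJ bounded_ops_outside[of y V W v] bounded_ops_outside[of J V W v]
        VW.bounded_ops_zero[of y] WV.bounded_ops_zero[of P]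
      by (cases "v \<in> vecs V") auto
  qed
  \<comment> \<open>For the four nondegeneracy claims and the pairing into \<open>B\<close>, each
    element is itself one product.\<close>
  have denseI: "dense_in E (lin_span E X)"
    if "complex_banach_space E" "X \<subseteq> vecs E" "\<And>e. e \<in> vecs E \<Longrightarrow> e \<in> X"
    for E :: "('e::type \<Rightarrow> 'f::ab_group_add) cspace" and X
  proof -
    interpret E: complex_banach_space E by fact
    have "dense_in E (vecs E)"
      using E.subset_norm_closure[of "vecs E"] E.norm_closure_subset by (auto simp: dense_in_def)
    moreover have "vecs E \<subseteq> lin_span E X"
      using that(3) E.span_base by (auto simp: lin_span_def)
    ultimately show ?thesis by (intro E.dense_in_lin_span[OF that(2)])
  qed
  show ?thesis
  proof
    have "dense_in (op_closure W W A0) A0" "dense_in (op_closure V V B0) B0" "dense_in (op_closure W V L0) L0" "dense_in (op_closure V W G0) G0"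
      unfolding op_closure_def using sub
      by (simp_all add: WW.bounded_ops.dense_in_closure VV.bounded_ops.dense_in_closure
          WV.bounded_ops.dense_in_closure VW.bounded_ops.dense_in_closure)
    then show "dense_in (op_closure W W A0) A0" "dense_in (op_closure V V B0) B0" "dense_in (op_closure W V L0) L0"
      "dense_in (op_closure V W G0) G0" by auto
    show "subalgebra (op_closure W W A0) (\<circ>) A0" "subalgebra (op_closure V V B0) (\<circ>) B0"
      "lin_subspace (op_closure W V L0) L0" "lin_subspace (op_closure V W G0) G0"
      using A0 B0 L0 G0 sub_cl AA BB by (auto simp: subalgebra_def lin_subspace_def op_closure_def)
    \<comment> \<open>Spans depend only on the scalar multiplication, which is untouched by the
      change of carrier.\<close>
    have scl_eq: "scl (op_closure W W A0) = scl (bounded_ops W W)" by (simp add: op_closure_def)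
    have "lin_span (bounded_ops W W) {y \<circ> x |x y. x \<in> L0 \<and> y \<in> G0} \<subseteq>
        lin_span (op_closure W W A0) {y \<circ> x |x y. x \<in> vecs (op_closure W V L0) \<and> y \<in> vecs (op_closure V W G0)}"
      unfolding lin_span_def scl_eq by (rule WW.bounded_ops.span_mono) (use sub_cl in blast)
    with \<open>dense_in (op_closure W W A0) A0\<close> show "dense_in (op_closure W W A0) (lin_span (op_closure W W A0)
        {y \<circ> x |x y. x \<in> vecs (op_closure W V L0) \<and> y \<in> vecs (op_closure V W G0)})"
      using mem(6) by (intro A.dense_in_lin_span[OF _ \<open>dense_in (op_closure W W A0) A0\<close>]
          subset_trans[OF full]) auto
    show "dense_in (op_closure V V B0) (lin_span (op_closure V V B0)
        {x \<circ> y |x y. x \<in> vecs (op_closure W V L0) \<and> y \<in> vecs (op_closure V W G0)})"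
      using mem J' P' B_unit by (intro denseI B.complex_banach_space_axioms) (auto, metis)
    show "dense_in (op_closure W V L0) (lin_span (op_closure W V L0) {b \<circ> e |b e. b \<in> vecs (op_closure V V B0) \<and> e \<in> vecs (op_closure W V L0)})"
    proof (intro denseI L.complex_banach_space_axioms)
      fix e assume "e \<in> vecs (op_closure W V L0)"
      \<comment> \<open>Bracketed this way the identity factors through \<open>P \<circ> J\<close>
        in \<open>B\<close>; bracketed as \<open>P \<circ> (J \<circ> e)\<close> it factors through
        \<open>J \<circ> e\<close> in \<open>A\<close>, which settles the other action.\<close>
      then have "e = (P \<circ> J) \<circ> e" using L_unit[of e] by (simp add: comp_assoc)
      with \<open>e \<in> _\<close> mem(5)[OF P' J']
      show "e \<in> {b \<circ> e |b e. b \<in> vecs (op_closure V V B0) \<and> e \<in> vecs (op_closure W V L0)}" by blast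
    qed (use mem in auto)
    show "dense_in (op_closure W V L0) (lin_span (op_closure W V L0) {e \<circ> b |e b. e \<in> vecs (op_closure W V L0) \<and> b \<in> vecs (op_closure W W A0)})"
    proof (intro denseI L.complex_banach_space_axioms)
      fix e assume "e \<in> vecs (op_closure W V L0)"
      with L_unit[of e] mem(6)[OF J', of e] P'
      show "e \<in> {e \<circ> b |e b. e \<in> vecs (op_closure W V L0) \<and> b \<in> vecs (op_closure W W A0)}" by (simp, metis)
    qed (use mem in auto)
    show "dense_in (op_closure V W G0) (lin_span (op_closure V W G0) {a \<circ> e |a e. a \<in> vecs (op_closure W W A0) \<and> e \<in> vecs (op_closure V W G0)})"
    proof (intro denseI G.complex_banach_space_axioms)
      fix e assume "e \<in> vecs (op_closure V W G0)"
      with G_unit[of e] mem(6)[OF _ P', of e] J'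
      show "e \<in> {a \<circ> e |a e. a \<in> vecs (op_closure W W A0) \<and> e \<in> vecs (op_closure V W G0)}" by (simp, metis)
    qed (use mem in auto)
    show "dense_in (op_closure V W G0) (lin_span (op_closure V W G0) {e \<circ> b |e b. e \<in> vecs (op_closure V W G0) \<and> b \<in> vecs (op_closure V V B0)})"
    proof (intro denseI G.complex_banach_space_axioms)
      fix e assume "e \<in> vecs (op_closure V W G0)"
      then have "e = e \<circ> (P \<circ> J)" using G_unit[of e] by (simp add: comp_assoc)
      with \<open>e \<in> _\<close> mem(5)[OF P' J']
      show "e \<in> {e \<circ> b |e b. e \<in> vecs (op_closure V W G0) \<and> b \<in> vecs (op_closure V V B0)}" by blast
    qed (use mem in auto)
  qed (use bil AA BB BL LA AG GB LG GL in \<open>simp_all add: comp_assoc\<close>)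
qed

section \<open>Direct sums of normed spaces\<close>

text \<open>Convexity of the power function up to the boundary point 0, where it reduces to
  \<open>t powr p <= t\<close> for \<open>t\<close> between 0 and 1.\<close>

lemma convex_powr_le:
  fixes p :: real
  assumes p: "1 \<le> p" and "0 \<le> a" "0 \<le> b" "0 \<le> s" "0 \<le> t" "s + t = 1"
  shows "(s * a + t * b) powr p \<le> s * a powr p + t * b powr p"
proof -
  have le: "(t * b) powr p \<le> t * b powr p" if "0 \<le> t" "t \<le> 1" "0 \<le> b" for t b :: real
  proof -
    have "t powr p \<le> t" using powr_mono'[of 1 p t] that p by auto
    then show ?thesis using that by (simp add: powr_mult mult_right_mono)
  qed
  show ?thesis
  proof (cases "a = 0 \<or> b = 0")
    case True
    then show ?thesis using le[of t b] le[of s a] assms by auto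
  next
    case False
    then show ?thesis
      using convex_onD[OF powr_convex[OF p], of t a b] assms
      by (simp add: algebra_simps flip: eq_diff_eq)
  qed
qed

text \<open>Minkowski's inequality, with bounds \<open>A\<close> and \<open>B\<close> in place of
  the norms so that no roots appear. Convexity is applied to \<open>a i / A\<close> and
  \<open>b i / B\<close> with weights \<open>A / (A + B)\<close> and \<open>B / (A + B)\<close>; if
  a bound is 0, the corresponding family vanishes.\<close>

lemma sum_powr_add_le:
  fixes p :: real
  assumes p: "1 \<le> p" and K: "finite K"
    and nonneg: "\<And>i. i \<in> K \<Longrightarrow> 0 \<le> a i" "\<And>i. i \<in> K \<Longrightarrow> 0 \<le> b i" "0 \<le> A" "0 \<le> B"
    and A: "(\<Sum>i\<in>K. a i powr p) \<le> A powr p" and B: "(\<Sum>i\<in>K. b i powr p) \<le> B powr p"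
  shows "(\<Sum>i\<in>K. (a i + b i) powr p) \<le> (A + B) powr p"
proof -
  have zero: "c i = 0" if "(\<Sum>i\<in>K. c i powr p) \<le> 0 powr p" "i \<in> K" for c :: "_ \<Rightarrow> real" and i
  proof -
    have "(\<Sum>i\<in>K. c i powr p) = 0" using that(1) p by (intro antisym sum_nonneg) auto
    then show ?thesis using that(2) K by (simp add: sum_nonneg_eq_0_iff)
  qed
  show ?thesis
  proof (cases "A = 0 \<or> B = 0")
    case True
    then show ?thesis using zero[of a] zero[of b] A B by (auto cong: sum.cong)
  next
    case False
    then have pos: "A > 0" "B > 0" using nonneg by auto
    let ?s = "A / (A + B)" and ?t = "B / (A + B)"
    have st: "?s + ?t = 1" using pos by (simp flip: add_divide_distrib)
    have cancel: "(A + B) * (?s * x + ?t * y) = A * x + B * y" for x y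
      using pos by (simp add: distrib_left)
    have "(a i + b i) powr p \<le> (A + B) powr p * (?s * (a i powr p / A powr p) + ?t * (b i powr p / B powr p))"
      if "i \<in> K" for i
    proof -
      have "(a i + b i) powr p = ((A + B) * (?s * (a i / A) + ?t * (b i / B))) powr p"
        unfolding cancel using pos by simp
      also have "\<dots> = (A + B) powr p * (?s * (a i / A) + ?t * (b i / B)) powr p"
        by (rule powr_mult)
      also have "\<dots> \<le> (A + B) powr p * (?s * (a i / A) powr p + ?t * (b i / B) powr p)"
        using pos nonneg that st by (intro mult_left_mono convex_powr_le p) auto
      finally show ?thesis using pos nonneg that by (simp add: powr_divide)
    qed
    then have "(\<Sum>i\<in>K. (a i + b i) powr p)
        \<le> (\<Sum>i\<in>K. (A + B) powr p * (?s * (a i powr p / A powr p) + ?t * (b i powr p / B powr p)))"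
      by (rule sum_mono)
    also have "\<dots> = (A + B) powr p * (?s * ((\<Sum>i\<in>K. a i powr p) / A powr p) + ?t * ((\<Sum>i\<in>K. b i powr p) / B powr p))"
      by (simp only: sum.distrib sum_distrib_left[symmetric] sum_divide_distrib[symmetric])
    also have "\<dots> \<le> (A + B) powr p * (?s * 1 + ?t * 1)"
      using pos A B by (intro mult_left_mono add_mono) auto
    finally show ?thesis using st by simp
  qed
qed

section \<open>Truncations and the norm of a direct sum\<close>

definition restr :: "'i set \<Rightarrow> ('i \<Rightarrow> 'a::zero) \<Rightarrow> 'i \<Rightarrow> 'a" where
  "restr K u = (\<lambda>i. if i \<in> K then u i else 0)"

text \<open>Used at two levels: for vectors supported at one point of \<open>X\<close>, and as
  \<open>single n 1\<close> for the basis vectors of a sequence space.\<close>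

definition single :: "'i \<Rightarrow> 'a::zero \<Rightarrow> 'i \<Rightarrow> 'a" where
  "single j v = (\<lambda>i. if i = j then v else 0)"

lemma sum_fun_apply: "(\<Sum>i\<in>I. f i) x = (\<Sum>i\<in>I. f i x)"
  by (induction I rule: infinite_finite_induct) auto

lemma restr_eq_sum_single:
  fixes u :: "'i \<Rightarrow> 'a::ab_group_add"
  assumes "finite K" shows "restr K u = (\<Sum>i\<in>K. single i (u i))"
proof
  fix j
  show "restr K u j = (\<Sum>i\<in>K. single i (u i)) j"
    using assms by (simp add: sum_fun_apply single_def restr_def sum.delta')
qed

locale lp_direct_sum = complex_normed_space F for F :: "'a::ab_group_add cspace" +
  fixes p :: real
  assumes p: "1 \<le> p"
begin

lemma scl_lp_sum [simp]: "scl (lp_sum p F) c u = (\<lambda>i. scl F c (u i))"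
  by (simp add: lp_sum_def)

text \<open>The terms are nonnegative, so a single bound on finite partial sums yields membership
  and the norm estimate together. Most later estimates in direct sums pass through this
  criterion.\<close>

lemma lp_sum_memI:
  fixes u :: "'i \<Rightarrow> 'a"
  assumes u: "\<And>i. u i \<in> vecs F" and c: "0 \<le> c"
    and le: "\<And>K. finite K \<Longrightarrow> (\<Sum>i\<in>K. nrm F (u i) powr p) \<le> c powr p"
  shows "u \<in> vecs (lp_sum p F)" "nrm (lp_sum p F) u \<le> c"
proof -
  have sm: "(\<lambda>i. nrm F (u i) powr p) summable_on UNIV"
    by (rule nonneg_bdd_above_summable_on) (auto intro!: bdd_aboveI[of _ "c powr p"] le)
  then show "u \<in> vecs (lp_sum p F)" using u by (simp add: lp_sum_def)
  have "(\<Sum>\<^sub>\<infinity>i. nrm F (u i) powr p) powr (1 / p) \<le> (c powr p) powr (1 / p)"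
    using p sm le by (intro powr_mono2 infsum_le_finite_sums infsum_nonneg) auto
  then show "nrm (lp_sum p F) u \<le> c" using p c by (simp add: lp_sum_def powr_powr)
qed

lemma lp_sum_in: "u \<in> vecs (lp_sum p F) \<Longrightarrow> u i \<in> vecs F"
  by (simp add: lp_sum_def)

lemma lp_sum_nrm_nonneg: "0 \<le> nrm (lp_sum p F) u"
  by (simp add: lp_sum_def)

lemma lp_sum_nrm_powr: "nrm (lp_sum p F) u powr p = (\<Sum>\<^sub>\<infinity>i. nrm F (u i) powr p)"
proof -
  have "0 \<le> (\<Sum>\<^sub>\<infinity>i. nrm F (u i) powr p)" by (rule infsum_nonneg) auto
  then show ?thesis using p by (simp add: lp_sum_def powr_powr)
qed

lemma lp_sum_partial_le:
  assumes "u \<in> vecs (lp_sum p F)" "finite K"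
  shows "(\<Sum>i\<in>K. nrm F (u i) powr p) \<le> nrm (lp_sum p F) u powr p"
  unfolding lp_sum_nrm_powr using assms by (intro finite_sum_le_infsum) (auto simp: lp_sum_def)

lemma lp_sum_entry_le:
  assumes u: "u \<in> vecs (lp_sum p F)"
  shows "nrm F (u i) \<le> nrm (lp_sum p F) u"
proof -
  have "nrm F (u i) powr p \<le> nrm (lp_sum p F) u powr p"
    using lp_sum_partial_le[OF u, of "{i}"] by simp
  then show ?thesis
    using p powr_less_mono2[of p "nrm (lp_sum p F) u" "nrm F (u i)"] lp_sum_nrm_nonneg[of u]
    by (meson less_le_trans linorder_not_less zero_less_one)
qed

lemma lp_sum_add:
  fixes u v :: "'i \<Rightarrow> 'a"
  assumes u: "u \<in> vecs (lp_sum p F)" and v: "v \<in> vecs (lp_sum p F)"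
  shows "u + v \<in> vecs (lp_sum p F)"
    and "nrm (lp_sum p F) (u + v) \<le> nrm (lp_sum p F) u + nrm (lp_sum p F) v"
proof -
  have le: "(\<Sum>i\<in>K. nrm F ((u + v) i) powr p) \<le> (nrm (lp_sum p F) u + nrm (lp_sum p F) v) powr p"
    if K: "finite K" for K
  proof -
    have "(\<Sum>i\<in>K. nrm F ((u + v) i) powr p) \<le> (\<Sum>i\<in>K. (nrm F (u i) + nrm F (v i)) powr p)"
      using p u v by (intro sum_mono powr_mono2)
        (simp_all add: nrm_triangle lp_sum_in nrm_nonneg add_in_vecs)
    also have "\<dots> \<le> (nrm (lp_sum p F) u + nrm (lp_sum p F) v) powr p"
      using u v K p by (intro sum_powr_add_le lp_sum_partial_le)
        (simp_all add: nrm_nonneg lp_sum_in lp_sum_nrm_nonneg)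
    finally show ?thesis .
  qed
  have mem: "(u + v) i \<in> vecs F" for i using u v by (simp add: add_in_vecs lp_sum_in)
  show "u + v \<in> vecs (lp_sum p F)"
    "nrm (lp_sum p F) (u + v) \<le> nrm (lp_sum p F) u + nrm (lp_sum p F) v"
    by (rule lp_sum_memI[OF mem _ le]; simp add: lp_sum_nrm_nonneg)+
qed

lemma lp_sum_scl:
  fixes u :: "'i \<Rightarrow> 'a"
  assumes u: "u \<in> vecs (lp_sum p F)"
  shows "(\<lambda>i. scl F c (u i)) \<in> vecs (lp_sum p F)"
    and "nrm (lp_sum p F) (\<lambda>i. scl F c (u i)) = cmod c * nrm (lp_sum p F) u"
proof -
  have eq: "nrm F (scl F c (u i)) powr p = cmod c powr p * nrm F (u i) powr p" for i
    using u by (simp add: nrm_scl lp_sum_in powr_mult nrm_nonneg)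
  show "(\<lambda>i. scl F c (u i)) \<in> vecs (lp_sum p F)"
    using u by (simp add: lp_sum_def eq scl_in_vecs summable_on_cmult_right)
  have "nrm (lp_sum p F) (\<lambda>i. scl F c (u i)) = (cmod c powr p * (\<Sum>\<^sub>\<infinity>i. nrm F (u i) powr p)) powr (1 / p)"
    by (simp add: lp_sum_def eq infsum_cmult_right')
  also have "\<dots> = (cmod c powr p) powr (1 / p) * (\<Sum>\<^sub>\<infinity>i. nrm F (u i) powr p) powr (1 / p)"
    by (rule powr_mult)
  also have "\<dots> = cmod c * nrm (lp_sum p F) u"
    using p by (simp add: lp_sum_def powr_powr)
  finally show "nrm (lp_sum p F) (\<lambda>i. scl F c (u i)) = cmod c * nrm (lp_sum p F) u" .
qed

lemma complex_normed_space_lp_sum: "complex_normed_space (lp_sum p F :: ('i \<Rightarrow> 'a) cspace)"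
proof
  let ?L = "lp_sum p F :: ('i \<Rightarrow> 'a) cspace"
  interpret L: vector_space "scl ?L"
    by standard (auto simp: fun_eq_iff scale_right_distrib scale_left_distrib)
  show "\<And>a x y. scl ?L a (x + y) = scl ?L a x + scl ?L a y"
    "\<And>a b x. scl ?L (a + b) x = scl ?L a x + scl ?L b x"
    "\<And>a b x. scl ?L a (scl ?L b x) = scl ?L (a * b) x"
    "\<And>x. scl ?L 1 x = x"
    by (rule L.scale_right_distrib L.scale_left_distrib L.scale_scale L.scale_one)+
  have zero: "(0 :: 'i \<Rightarrow> 'a) \<in> vecs ?L" "nrm ?L 0 \<le> 0"
    using lp_sum_memI[of "0 :: 'i \<Rightarrow> 'a" 0] by simp_all
  show "module.subspace (scl ?L) (vecs ?L)"
    using zero by (intro L.subspaceI) (auto intro: lp_sum_add lp_sum_scl)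
  fix u v :: "'i \<Rightarrow> 'a" assume u: "u \<in> vecs ?L"
  show "0 \<le> nrm ?L u" by (rule lp_sum_nrm_nonneg)
  show "nrm ?L u = 0 \<longleftrightarrow> u = 0"
  proof
    assume 0: "nrm ?L u = 0"
    have "u i = 0" for i
      using lp_sum_entry_le[OF u, of i] nrm_nonneg[OF lp_sum_in[OF u], of i] nrm_eq_0[OF lp_sum_in[OF u], of i] 0
      by simp
    then show "u = 0" by (simp add: fun_eq_iff)
  qed (use zero lp_sum_nrm_nonneg[of "0 :: 'i \<Rightarrow> 'a"] in auto)
  show "nrm ?L (scl ?L c u) = cmod c * nrm ?L u" for c
    using lp_sum_scl(2)[OF u] by simp
  assume "v \<in> vecs ?L"
  then show "nrm ?L (u + v) \<le> nrm ?L u + nrm ?L v" by (rule lp_sum_add(2)[OF u])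
qed

sublocale lp_sum: complex_normed_space "lp_sum p F"
  by (rule complex_normed_space_lp_sum)

lemma restr_in:
  assumes u: "u \<in> vecs (lp_sum p F)" shows "restr K u \<in> vecs (lp_sum p F)"
proof (rule lp_sum_memI[where c = "nrm (lp_sum p F) u"])
  fix L :: "'b set" assume "finite L"
  then have "(\<Sum>i\<in>L. nrm F (restr K u i) powr p) \<le> (\<Sum>i\<in>L. nrm F (u i) powr p)"
    using p by (intro sum_mono) (auto simp: restr_def)
  also have "\<dots> \<le> nrm (lp_sum p F) u powr p" by (rule lp_sum_partial_le[OF u \<open>finite L\<close>])
  finally show "(\<Sum>i\<in>L. nrm F (restr K u i) powr p) \<le> nrm (lp_sum p F) u powr p" .
qed (use u in \<open>auto simp: restr_def lp_sum_in lp_sum_nrm_nonneg\<close>)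

text \<open>Tails of the convergent sum are small; here finiteness of the exponent is essential.
  Uniformity over all larger \<open>K'\<close> lets a ball be adjoined to \<open>K\<close> and also
  gives convergence along the net of finite sets.\<close>

lemma restr_approx:
  assumes u: "u \<in> vecs (lp_sum p F)" and e: "e > 0"
  shows "\<exists>K. finite K \<and> (\<forall>K'. K \<subseteq> K' \<longrightarrow> nrm (lp_sum p F) (u - restr K' u) \<le> e)"
proof -
  let ?S = "\<Sum>\<^sub>\<infinity>i. nrm F (u i) powr p"
  have sm: "(\<lambda>i. nrm F (u i) powr p) summable_on UNIV" using u by (simp add: lp_sum_def)
  have "e powr p > 0" using e by simp
  then have "\<forall>\<^sub>F K in finite_subsets_at_top UNIV. ?S - e powr p < (\<Sum>i\<in>K. nrm F (u i) powr p)"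
    using order_tendstoD(1)[OF infsum_tendsto[OF sm], of "?S - e powr p"] by simp
  then obtain K where K: "finite K" "?S - e powr p < (\<Sum>i\<in>K. nrm F (u i) powr p)"
    by (auto simp: eventually_finite_subsets_at_top)
  have "nrm (lp_sum p F) (u - restr K' u) \<le> e" if "K \<subseteq> K'" for K'
  proof (rule lp_sum_memI(2))
    show "(u - restr K' u) i \<in> vecs F" for i using u by (simp add: restr_def lp_sum_in)
    fix L :: "'b set" assume L: "finite L"
    have "(\<Sum>i\<in>L. nrm F ((u - restr K' u) i) powr p) = (\<Sum>i\<in>L. if i \<in> K' then 0 else nrm F (u i) powr p)"
      using p by (intro sum.cong) (auto simp: restr_def)
    also have "\<dots> \<le> (\<Sum>i\<in>L. if i \<in> K then 0 else nrm F (u i) powr p)"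
      using that by (intro sum_mono) auto
    also have "\<dots> = (\<Sum>i\<in>L - K. nrm F (u i) powr p)"
      using L by (intro sum.mono_neutral_cong_right) auto
    also have "\<dots> = (\<Sum>i\<in>(L - K) \<union> K. nrm F (u i) powr p) - (\<Sum>i\<in>K. nrm F (u i) powr p)"
      using L K by (subst sum.union_disjoint) auto
    also have "(\<Sum>i\<in>(L - K) \<union> K. nrm F (u i) powr p) \<le> ?S"
      using L K sm by (intro finite_sum_le_infsum) auto
    finally show "(\<Sum>i\<in>L. nrm F ((u - restr K' u) i) powr p) \<le> e powr p" using K by simp
  qed (use e in simp)
  with K show ?thesis by blast
qed

lemma
  assumes v: "v \<in> vecs F"
  shows single_in: "single j v \<in> vecs (lp_sum p F)"
    and nrm_single_le: "nrm (lp_sum p F) (single j v) \<le> nrm F v"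
proof -
  have le: "(\<Sum>i\<in>K. nrm F (single j v i) powr p) \<le> nrm F v powr p" if "finite K" for K
  proof -
    have "(\<Sum>i\<in>K. nrm F (single j v i) powr p) = (\<Sum>i\<in>K. if i = j then nrm F v powr p else 0)"
      using p by (intro sum.cong) (auto simp: single_def)
    also have "\<dots> \<le> nrm F v powr p" using that by (simp add: sum.delta)
    finally show ?thesis .
  qed
  have mem: "single j v i \<in> vecs F" for i using v by (simp add: single_def)
  show "single j v \<in> vecs (lp_sum p F)" "nrm (lp_sum p F) (single j v) \<le> nrm F v"
    by (rule lp_sum_memI[OF mem _ le]; simp add: nrm_nonneg v)+
qed

lemma single_not_in:
  assumes "v \<notin> vecs F" shows "single j v \<notin> vecs (lp_sum p F)"
  using lp_sum_in[of "single j v" j] assms by (auto simp: single_def)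

end

section \<open>Completeness of direct sums\<close>

lemma complex_banach_space_lp_sum:
  assumes "complex_banach_space F" "1 \<le> p"
  shows "complex_banach_space (lp_sum p F)"
proof -
  interpret F: complex_banach_space F by fact
  interpret lp_direct_sum F p by unfold_locales fact
  show ?thesis
  proof
    fix s :: "nat \<Rightarrow> 'b \<Rightarrow> 'a"
    assume s: "\<And>n. s n \<in> vecs (lp_sum p F)"
      and cauchy: "\<And>e. e > 0 \<Longrightarrow> \<exists>N. \<forall>m\<ge>N. \<forall>n\<ge>N. nrm (lp_sum p F) (s m - s n) < e"
    have mem: "s m - s n \<in> vecs (lp_sum p F)" for m n by (intro lp_sum.diff_in_vecs s)
    have "\<exists>w\<in>vecs F. (\<lambda>n. nrm F (s n i - w)) \<longlonglongrightarrow> 0" for i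
    proof (rule F.complete)
      show "s n i \<in> vecs F" for n by (rule lp_sum_in[OF s])
      fix e :: real assume "e > 0"
      then obtain N where "\<forall>m\<ge>N. \<forall>n\<ge>N. nrm (lp_sum p F) (s m - s n) < e" using cauchy by blast
      moreover have "nrm F (s m i - s n i) \<le> nrm (lp_sum p F) (s m - s n)" for m n
        using lp_sum_entry_le[OF mem[of m n], of i] by simp
      ultimately show "\<exists>N. \<forall>m\<ge>N. \<forall>n\<ge>N. nrm F (s m i - s n i) < e"
        by (meson le_less_trans)
    qed
    then obtain u where u: "\<And>i. u i \<in> vecs F" "\<And>i. (\<lambda>n. nrm F (s n i - u i)) \<longlonglongrightarrow> 0" by metis
    have diff: "(s n - u) i \<in> vecs F" for n i using u lp_sum_in[OF s] by (simp add: F.diff_in_vecs)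
    \<comment> \<open>The Cauchy estimate passes to the limit on each finite set \<open>K\<close>,
      with \<open>N\<close> independent of \<open>K\<close>. Membership is obtained for
      \<open>s n - u\<close>, and that of \<open>u\<close> follows by subtraction.\<close>
    have close: "\<exists>N. \<forall>n\<ge>N. s n - u \<in> vecs (lp_sum p F) \<and> nrm (lp_sum p F) (s n - u) \<le> e" if "e > 0" for e
    proof -
      obtain N where N: "\<forall>m\<ge>N. \<forall>n\<ge>N. nrm (lp_sum p F) (s m - s n) < e" using cauchy \<open>e > 0\<close> by blast
      have le: "(\<Sum>i\<in>K. nrm F ((s n - u) i) powr p) \<le> e powr p" if n: "n \<ge> N" and K: "finite K" for n K
      proof (rule LIMSEQ_le_const2)
        have "(\<lambda>m. nrm F (s n i - s m i)) \<longlonglongrightarrow> nrm F (s n i - u i)" for i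
        proof (rule LIMSEQ_I)
          fix r :: real assume "r > 0"
          then obtain M where M: "\<And>m. m \<ge> M \<Longrightarrow> nrm F (s m i - u i) < r"
            using order_tendstoD(2)[OF u(2)[of i]] by (auto simp: eventually_sequentially)
          have "norm (nrm F (s n i - s m i) - nrm F (s n i - u i)) < r" if "m \<ge> M" for m
            using F.nrm_diff_triangle[of "s n i" "s m i" "u i"] F.nrm_diff_triangle[of "s n i" "u i" "s m i"]
              F.nrm_minus_commute[of "s m i" "u i"] M[OF that] u(1) lp_sum_in[OF s]
            by (simp add: abs_less_iff)
          then show "\<exists>M. \<forall>m\<ge>M. norm (nrm F (s n i - s m i) - nrm F (s n i - u i)) < r" by blast
        qed
        then show "(\<lambda>m. \<Sum>i\<in>K. nrm F (s n i - s m i) powr p) \<longlonglongrightarrow> (\<Sum>i\<in>K. nrm F ((s n - u) i) powr p)"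
          using p lp_sum_in[OF s]
          by (auto intro!: tendsto_sum tendsto_powr' simp: F.nrm_nonneg F.diff_in_vecs)
        have "(\<Sum>i\<in>K. nrm F (s n i - s m i) powr p) \<le> e powr p" if "m \<ge> N" for m
        proof -
          have "(\<Sum>i\<in>K. nrm F (s n i - s m i) powr p) \<le> nrm (lp_sum p F) (s n - s m) powr p"
            using lp_sum_partial_le[OF mem K, of n m] by simp
          also have "\<dots> \<le> e powr p"
            using N n that p by (intro powr_mono2) (auto simp: lp_sum_nrm_nonneg less_imp_le)
          finally show ?thesis .
        qed
        then show "\<exists>M. \<forall>m\<ge>M. (\<Sum>i\<in>K. nrm F (s n i - s m i) powr p) \<le> e powr p" by blast
      qed
      have "s n - u \<in> vecs (lp_sum p F) \<and> nrm (lp_sum p F) (s n - u) \<le> e" if "n \<ge> N" for n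
        using lp_sum_memI[OF diff less_imp_le[OF \<open>e > 0\<close>] le[OF that]] by (simp del: minus_apply)
      then show ?thesis by blast
    qed
    obtain n where "s n - u \<in> vecs (lp_sum p F)" using close[of 1] by auto
    then have "s n - (s n - u) \<in> vecs (lp_sum p F)" by (rule lp_sum.diff_in_vecs[OF s])
    then have "u \<in> vecs (lp_sum p F)" by simp
    moreover have "(\<lambda>n. nrm (lp_sum p F) (s n - u)) \<longlonglongrightarrow> 0"
    proof (rule LIMSEQ_I)
      fix e :: real assume "e > 0"
      then obtain N where N: "\<forall>n\<ge>N. nrm (lp_sum p F) (s n - u) \<le> e / 2"
        using close[of "e / 2"] by auto
      have "norm (nrm (lp_sum p F) (s n - u) - 0) < e" if "n \<ge> N" for n
        using N that \<open>e > 0\<close> lp_sum_nrm_nonneg[of "s n - u"] by fastforce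
      then show "\<exists>N. \<forall>n\<ge>N. norm (nrm (lp_sum p F) (s n - u) - 0) < e" by blast
    qed
    ultimately show "\<exists>u\<in>vecs (lp_sum p F). (\<lambda>n. nrm (lp_sum p F) (s n - u)) \<longlonglongrightarrow> 0" by blast
  qed
qed

lemma complex_banach_space_scalars: "complex_banach_space scalars"
proof -
  interpret vector_space "scl scalars"
    by standard (auto simp: scalars_def algebra_simps)
  show ?thesis
  proof
    show "subspace (vecs scalars)" by (simp add: scalars_def)
    fix s :: "nat \<Rightarrow> complex"
    assume "\<And>e. e > 0 \<Longrightarrow> \<exists>N. \<forall>m\<ge>N. \<forall>n\<ge>N. nrm scalars (s m - s n) < e"
    then have "Cauchy s" by (intro CauchyI) (auto simp: scalars_def)
    then obtain c where "s \<longlonglongrightarrow> c" using Cauchy_convergent convergent_def by blast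
    then show "\<exists>c\<in>vecs scalars. (\<lambda>n. nrm scalars (s n - c)) \<longlonglongrightarrow> 0"
      by (auto simp: scalars_def LIM_zero_iff tendsto_norm_zero_iff intro!: exI[of _ c])
  qed (auto simp: scalars_def norm_mult norm_triangle_ineq)
qed

section \<open>Operators of finite propagation\<close>

text \<open>The sum is at most \<open>N\<close> times its largest term, whose power is one of the
  terms on the right.\<close>

lemma sum_powr_le_card:
  fixes p :: real
  assumes p: "1 \<le> p" and B: "finite B" "card B \<le> N" and nonneg: "\<And>y. y \<in> B \<Longrightarrow> 0 \<le> a y"
  shows "(\<Sum>y\<in>B. a y) powr p \<le> real N powr p * (\<Sum>y\<in>B. a y powr p)"
proof (cases "B = {}")
  case False
  then have "Max (a ` B) \<in> a ` B" using B by (intro Max_in) auto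
  then obtain z where z: "z \<in> B" "Max (a ` B) = a z" by auto
  then have max: "a y \<le> a z" if "y \<in> B" for y using Max_ge[of "a ` B" "a y"] B that by auto
  have "(\<Sum>y\<in>B. a y) \<le> real (card B) * a z" using max by (intro sum_bounded_above)
  also have "\<dots> \<le> real N * a z" using B nonneg z by (intro mult_right_mono) auto
  finally have "(\<Sum>y\<in>B. a y) powr p \<le> (real N * a z) powr p"
    using p nonneg by (intro powr_mono2 sum_nonneg) auto
  also have "\<dots> = real N powr p * a z powr p" by (rule powr_mult)
  also have "a z powr p \<le> (\<Sum>y\<in>B. a y powr p)" using B z by (intro member_le_sum) auto
  finally show ?thesis by (simp add: mult_left_mono)
qed (use p in auto)

lemma finite_propagation_iff:
  "finite_propagation m \<longleftrightarrow> (\<exists>r\<ge>0. \<forall>x y. r < dist x y \<longrightarrow> m x y = 0)"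
proof
  assume "finite_propagation m"
  then obtain r where r: "\<And>x y. m x y \<noteq> 0 \<Longrightarrow> dist x y \<le> r"
    by (auto simp: finite_propagation_def bdd_above_def)
  have "m x y = 0" if "max r 0 < dist x y" for x y
    using r[of x y] that by (cases "m x y = 0") auto
  then show "\<exists>r\<ge>0. \<forall>x y. r < dist x y \<longrightarrow> m x y = 0"
    by (intro exI[of _ "max r 0"]) auto
qed (auto simp: finite_propagation_def bdd_above_def not_less[symmetric])

text \<open>The analogue of \<open>op_entry\<close> for arbitrary coefficient spaces; scalars or
  sequences on either side then give the four kinds of operators in one theory.\<close>

definition entry :: "(('x \<Rightarrow> 'a) \<Rightarrow> 'x \<Rightarrow> 'b) \<Rightarrow> 'x \<Rightarrow> 'x \<Rightarrow> 'a::zero \<Rightarrow> 'b" where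
  "entry T x y = (\<lambda>v. T (single y v) x)"

definition fp_ops ::
  "real \<Rightarrow> 'a::ab_group_add cspace \<Rightarrow> 'b::ab_group_add cspace \<Rightarrow> (('x::metric_space \<Rightarrow> 'a) \<Rightarrow> 'x \<Rightarrow> 'b) set" where
  "fp_ops p F G = {T \<in> vecs (bounded_ops (lp_sum p F) (lp_sum p G)). finite_propagation (entry T)}"

locale lp_operators = F: lp_direct_sum F p + G: lp_direct_sum G p
  for F :: "'a::ab_group_add cspace" and G :: "'b::ab_group_add cspace" and p +
  fixes X :: "'x::metric_space itself"
  assumes geometry: "bounded_geometry X"
begin

abbreviation "LF \<equiv> lp_sum p F :: ('x \<Rightarrow> 'a) cspace"
abbreviation "LG \<equiv> lp_sum p G :: ('x \<Rightarrow> 'b) cspace"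
abbreviation "FP \<equiv> fp_ops p F G :: (('x \<Rightarrow> 'a) \<Rightarrow> 'x \<Rightarrow> 'b) set"

sublocale entries: normed_space_pair F G ..

sublocale normed_space_pair LF LG
  by (intro normed_space_pair.intro F.complex_normed_space_lp_sum G.complex_normed_space_lp_sum)

lemma finite_cball: "finite (cball (x :: 'x) r)"
  using geometry unfolding bounded_geometry_def by (cases "r \<ge> 0") auto

text \<open>The normalisation \<open>N >= 1\<close> serves the estimate
  \<open>N <= N powr p\<close>.\<close>

lemma card_cball_bound: obtains N where "N \<ge> 1" "\<And>x :: 'x. card (cball x r) \<le> N"
proof (cases "r \<ge> 0")
  case True
  then obtain N where "\<And>x :: 'x. card (cball x r) \<le> N"
    using geometry unfolding bounded_geometry_def by blast
  then have "\<And>x :: 'x. card (cball x r) \<le> max N 1" by (simp add: le_max_iff_disj)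
  with that[of "max N 1"] show ?thesis by simp
qed (use that[of 1] in simp)

lemma entry_bound:
  assumes T: "T \<in> vecs (bounded_ops LF LG)" and v: "v \<in> vecs F"
  shows "nrm G (entry T x y v) \<le> nrm (bounded_ops LF LG) T * nrm F v"
proof -
  have "nrm G (entry T x y v) \<le> nrm LG (T (single y v))"
    unfolding entry_def by (intro G.lp_sum_entry_le bounded_ops_in[OF T] F.single_in v)
  also have "\<dots> \<le> nrm (bounded_ops LF LG) T * nrm LF (single y v)"
    by (intro nrm_apply_le T F.single_in v)
  also have "\<dots> \<le> nrm (bounded_ops LF LG) T * nrm F v"
    by (intro mult_left_mono F.nrm_single_le v nrm_bounded_ops_nonneg T)
  finally show ?thesis .
qed

lemma entry_bounded_op:
  assumes T: "T \<in> vecs (bounded_ops LF LG)"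
  shows "entry T x y \<in> vecs (bounded_ops F G)"
proof (rule bounded_opsI)
  fix v assume v: "v \<in> vecs F"
  note T_in = bounded_ops_in[OF T F.single_in[OF v]]
  show "entry T x y v \<in> vecs G"
    unfolding entry_def by (rule G.lp_sum_in[OF T_in])
  show "nrm G (entry T x y v) \<le> nrm (bounded_ops LF LG) T * nrm F v"
    by (rule entry_bound[OF T v])
  have "single y (scl F c v) = scl LF c (single y v)" for c
    by (auto simp: single_def)
  then show "entry T x y (scl F c v) = scl G c (entry T x y v)" for c
    by (simp add: entry_def bounded_ops_scl[OF T F.single_in[OF v]] del: F.scl_lp_sum)
  fix w assume w: "w \<in> vecs F"
  have "single y (v + w) = single y v + single y w"
    by (auto simp: single_def)
  then show "entry T x y (v + w) = entry T x y v + entry T x y w"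
    by (simp add: entry_def bounded_ops_add[OF T F.single_in[OF v] F.single_in[OF w]])
qed (simp add: entry_def bounded_ops_outside[OF T] F.single_not_in)

lemma nrm_entry_le:
  assumes T: "T \<in> vecs (bounded_ops LF LG)"
  shows "nrm (bounded_ops F G) (entry T x y) \<le> nrm (bounded_ops LF LG) T"
  by (intro entries.nrm_bounded_ops_le entry_bound T nrm_bounded_ops_nonneg)

text \<open>For finitely supported vectors this is linearity. In general \<open>u\<close> is
  truncated to a finite set containing the ball: the truncated value is then exactly the right side,
  and continuity of \<open>T\<close> controls the rest.\<close>

lemma apply_eq_sum_entries:
  assumes T: "T \<in> vecs (bounded_ops LF LG)" and u: "u \<in> vecs LF"
    and band: "\<And>y. r < dist x y \<Longrightarrow> entry T x y = 0"
  shows "T u x = (\<Sum>y\<in>cball x r. entry T x y (u y))"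
proof -
  let ?s = "\<Sum>y\<in>cball x r. entry T x y (u y)"
  let ?n = "nrm (bounded_ops LF LG) T"
  have n: "?n \<ge> 0" by (rule nrm_bounded_ops_nonneg[OF T])
  have s_in: "?s \<in> vecs G"
    by (intro G.sum_in_vecs bounded_ops_in[OF entry_bounded_op[OF T]] F.lp_sum_in[OF u])
  have Tu_in: "T u x \<in> vecs G" by (intro G.lp_sum_in bounded_ops_in[OF T] u)
  have "nrm G (T u x - ?s) \<le> e" if "e > 0" for e
  proof -
    have "e / (?n + 1) > 0" using that n by simp
    then obtain K where K: "finite K" "\<And>K'. K \<subseteq> K' \<Longrightarrow> nrm LF (u - restr K' u) \<le> e / (?n + 1)"
      using F.restr_approx[OF u] by meson
    let ?K = "K \<union> cball x r"
    have finK: "finite ?K" using K finite_cball by simp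
    have "T (restr ?K u) = (\<Sum>y\<in>?K. T (single y (u y)))"
      unfolding restr_eq_sum_single[OF finK]
      by (intro bounded_ops_sum[OF T] F.single_in F.lp_sum_in[OF u])
    then have "T (restr ?K u) x = (\<Sum>y\<in>?K. entry T x y (u y))"
      using finK by (simp add: entry_def sum_fun_apply)
    also have "\<dots> = ?s"
      using finK by (intro sum.mono_neutral_right) (auto simp: band not_le)
    finally have "T u x - ?s = T (u - restr ?K u) x"
      by (simp add: bounded_ops_diff[OF T u F.restr_in[OF u]])
    moreover have diff_in: "u - restr ?K u \<in> vecs LF" by (intro F.lp_sum.diff_in_vecs u F.restr_in)
    ultimately have "nrm G (T u x - ?s) \<le> nrm LG (T (u - restr ?K u))"
      by (simp only:) (intro G.lp_sum_entry_le bounded_ops_in[OF T])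
    also have "\<dots> \<le> ?n * nrm LF (u - restr ?K u)" by (rule nrm_apply_le[OF T diff_in])
    also have "\<dots> \<le> ?n * (e / (?n + 1))" using K(2)[of ?K] n by (intro mult_left_mono) auto
    also have "\<dots> \<le> e" using n that by (simp add: field_simps)
    finally show ?thesis .
  qed
  then have "nrm G (T u x - ?s) \<le> 0" by (rule field_le_epsilon[where y = 0, simplified])
  then have "T u x - ?s = 0"
    using G.nrm_nonneg G.nrm_eq_0 G.diff_in_vecs[OF Tu_in s_in] by (meson antisym)
  then show ?thesis by simp
qed

section \<open>Matrices of finite propagation as operators\<close>

lemma matrix_op_eq_sum:
  assumes "u \<in> vecs LF" "\<And>y. r < dist x y \<Longrightarrow> m x y = 0"
  shows "matrix_op LF m u x = (\<Sum>y\<in>cball x r. m x y (u y))"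
proof -
  have "{y. m x y \<noteq> 0} \<subseteq> cball x r" using assms(2) by (auto simp: not_le[symmetric])
  then show ?thesis
    using assms(1) finite_cball unfolding matrix_op_def
    by (simp, intro sum.mono_neutral_left) auto
qed

text \<open>Entries of operators vanish outside the carrier, whereas the matrix functions in the
  definitions are given by unrestricted formulas. So the two are compared on \<open>vecs F\<close>
  only, and the band is transferred by a hypothesis of its own.\<close>

lemma matrix_op_entries:
  assumes T: "T \<in> FP" and m: "\<And>x y v. v \<in> vecs F \<Longrightarrow> m x y v = entry T x y v"
    and m0: "\<And>x y. entry T x y = 0 \<Longrightarrow> m x y = 0"
  shows "T = matrix_op LF m"
proof
  fix u
  have T': "T \<in> vecs (bounded_ops LF LG)" using T by (simp add: fp_ops_def)
  obtain r where r: "\<And>x y. r < dist x y \<Longrightarrow> entry T x y = 0"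
    using T by (auto simp: fp_ops_def finite_propagation_iff)
  show "T u = matrix_op LF m u"
  proof (cases "u \<in> vecs LF")
    case True
    show ?thesis
    proof
      fix x
      have "T u x = (\<Sum>y\<in>cball x r. m x y (u y))"
        using apply_eq_sum_entries[OF T' True r] by (simp add: m[OF F.lp_sum_in[OF True]])
      then show "T u x = matrix_op LF m u x"
        using matrix_op_eq_sum[OF True, of r x m] m0 r by simp
    qed
  next
    case False
    then show ?thesis by (simp add: matrix_op_def bounded_ops_outside[OF T'])
  qed
qed

text \<open>A counting form of Schur's test: every row sum runs over at most \<open>N\<close>
  points, and every point \<open>y\<close> lies in at most \<open>N\<close> of the balls. Rows
  contribute the factor \<open>N powr p\<close>, columns the factor \<open>N\<close>, which is
  rounded up to \<open>N powr p\<close>; this gives the constant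
  \<open>\<bar>C\<bar> * N * N\<close>.\<close>

lemma matrix_op_in_fp_ops:
  assumes m_in: "\<And>x y v. v \<in> vecs F \<Longrightarrow> m x y v \<in> vecs G"
    and m_add: "\<And>x y v w. v \<in> vecs F \<Longrightarrow> w \<in> vecs F \<Longrightarrow> m x y (v + w) = m x y v + m x y w"
    and m_scl: "\<And>x y c v. v \<in> vecs F \<Longrightarrow> m x y (scl F c v) = scl G c (m x y v)"
    and m_bound: "\<And>x y v. v \<in> vecs F \<Longrightarrow> nrm G (m x y v) \<le> C * nrm F v"
    and band: "\<And>x y. r < dist x y \<Longrightarrow> m x y = 0"
  shows "matrix_op LF m \<in> FP"
proof -
  let ?T = "matrix_op LF m"
  obtain N where N: "N \<ge> 1" "\<And>x :: 'x. card (cball x r) \<le> N"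
    using card_cball_bound[of r] by blast
  have T_eq: "?T u x = (\<Sum>y\<in>cball x r. m x y (u y))" if "u \<in> vecs LF" for u x
    using that band by (rule matrix_op_eq_sum)
  have T_in: "?T u x \<in> vecs G" if "u \<in> vecs LF" for u x
    unfolding T_eq[OF that] using that by (intro G.sum_in_vecs m_in F.lp_sum_in)
  have bound: "(\<Sum>x\<in>K. nrm G (?T u x) powr p) \<le> (\<bar>C\<bar> * N * N * nrm LF u) powr p"
    if u: "u \<in> vecs LF" and K: "finite K" for u K
  proof -
    let ?g = "\<lambda>y. nrm F (u y) powr p"
    have "nrm G (?T u x) powr p \<le> \<bar>C\<bar> powr p * real N powr p * (\<Sum>y\<in>cball x r. ?g y)" for x
    proof -
      have "nrm G (?T u x) \<le> (\<Sum>y\<in>cball x r. nrm G (m x y (u y)))"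
        unfolding T_eq[OF u] using u by (intro G.nrm_sum_le m_in F.lp_sum_in)
      also have "\<dots> \<le> (\<Sum>y\<in>cball x r. \<bar>C\<bar> * nrm F (u y))"
        using m_bound[OF F.lp_sum_in[OF u]] F.nrm_nonneg[OF F.lp_sum_in[OF u]]
        by (intro sum_mono) (meson abs_ge_self mult_right_mono order_trans)
      finally have "nrm G (?T u x) powr p \<le> (\<bar>C\<bar> * (\<Sum>y\<in>cball x r. nrm F (u y))) powr p"
        using F.p G.nrm_nonneg[OF T_in[OF u]]
        by (intro powr_mono2) (auto simp: sum_distrib_left)
      also have "\<dots> = \<bar>C\<bar> powr p * (\<Sum>y\<in>cball x r. nrm F (u y)) powr p" by (rule powr_mult)
      also have "\<dots> \<le> \<bar>C\<bar> powr p * (real N powr p * (\<Sum>y\<in>cball x r. ?g y))"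
        using N finite_cball F.nrm_nonneg[OF F.lp_sum_in[OF u]]
        by (intro mult_left_mono sum_powr_le_card F.p) auto
      finally show ?thesis by (simp add: mult.assoc)
    qed
    then have "(\<Sum>x\<in>K. nrm G (?T u x) powr p)
        \<le> (\<Sum>x\<in>K. \<bar>C\<bar> powr p * real N powr p * (\<Sum>y\<in>cball x r. ?g y))"
      by (rule sum_mono)
    also have "\<dots> = \<bar>C\<bar> powr p * real N powr p * (\<Sum>x\<in>K. \<Sum>y\<in>cball x r. ?g y)"
      by (simp add: sum_distrib_left)
    also have "(\<Sum>x\<in>K. \<Sum>y\<in>cball x r. ?g y) \<le> real N * nrm LF u powr p"
    proof -
      let ?L = "\<Union>x\<in>K. cball x r"
      have L: "finite ?L" using K finite_cball by simp
      have "(\<Sum>x\<in>K. \<Sum>y\<in>cball x r. ?g y) = (\<Sum>x\<in>K. \<Sum>y\<in>{y \<in> ?L. dist x y \<le> r}. ?g y)"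
        by (intro sum.cong refl) auto
      \<comment> \<open>After the exchange of sums each \<open>y\<close> is counted once for every
        \<open>x\<close> of \<open>K\<close> within distance \<open>r\<close>, and these
        \<open>x\<close> lie in the ball about \<open>y\<close>.\<close>
      also have "\<dots> = (\<Sum>y\<in>?L. \<Sum>x\<in>{x \<in> K. dist x y \<le> r}. ?g y)"
        by (rule sum.swap_restrict[OF K L])
      also have "\<dots> \<le> (\<Sum>y\<in>?L. real N * ?g y)"
      proof (rule sum_mono)
        fix y
        have "card {x \<in> K. dist x y \<le> r} \<le> card (cball y r)"
          using finite_cball by (intro card_mono) (auto simp: dist_commute)
        then have "card {x \<in> K. dist x y \<le> r} \<le> N" using N(2)[of y] by linarith
        then show "(\<Sum>x\<in>{x \<in> K. dist x y \<le> r}. ?g y) \<le> real N * ?g y"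
          by (simp add: mult_right_mono)
      qed
      also have "\<dots> = real N * (\<Sum>y\<in>?L. ?g y)" by (simp add: sum_distrib_left)
      also have "\<dots> \<le> real N * nrm LF u powr p"
        by (intro mult_left_mono F.lp_sum_partial_le[OF u L]) simp
      finally show ?thesis .
    qed
    also have "real N * nrm LF u powr p \<le> real N powr p * nrm LF u powr p"
      using N F.p powr_mono[of 1 p "real N"] by (intro mult_right_mono) auto
    finally show ?thesis by (simp add: powr_mult mult_left_mono mult.assoc)
  qed
  have T: "?T \<in> vecs (bounded_ops LF LG)"
  proof (rule bounded_opsI)
    fix u assume u: "u \<in> vecs LF"
    have nonneg: "0 \<le> \<bar>C\<bar> * real N * real N * nrm LF u" by (simp add: F.lp_sum_nrm_nonneg)
    show "?T u \<in> vecs LG" by (rule G.lp_sum_memI(1)[OF T_in[OF u] nonneg bound[OF u]])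
    show "nrm LG (?T u) \<le> (\<bar>C\<bar> * real N * real N) * nrm LF u"
      by (rule G.lp_sum_memI(2)[OF T_in[OF u] nonneg bound[OF u]])
    show "?T (scl LF c u) = scl LG c (?T u)" for c
      using T_eq[OF u] T_eq[OF F.lp_sum.scl_in_vecs[OF u, of c]] m_scl[OF F.lp_sum_in[OF u]]
      by (simp add: fun_eq_iff G.scale_sum_right)
    fix v assume v: "v \<in> vecs LF"
    show "?T (u + v) = ?T u + ?T v"
      using T_eq[OF u] T_eq[OF v] T_eq[OF F.lp_sum.add_in_vecs[OF u v]]
        m_add[OF F.lp_sum_in[OF u] F.lp_sum_in[OF v]]
      by (simp add: fun_eq_iff sum.distrib)
  qed (simp add: matrix_op_def)
  \<comment> \<open>The vector \<open>single y v\<close> is supported at \<open>y\<close>, which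
    lies outside the ball about \<open>x\<close>. The maximum supplies the nonnegative radius in
    \<open>finite_propagation_iff\<close>.\<close>
  have "entry ?T x y = 0" if "max r 0 < dist x y" for x y
  proof
    fix v show "entry ?T x y v = 0 v"
    proof (cases "v \<in> vecs F")
      case True
      have m0: "m x z 0 = 0" for z using m_scl[of 0 x z 0] by simp
      have "?T (single y v) x = (\<Sum>z\<in>cball x r. m x z (single y v z))"
        by (rule T_eq[OF F.single_in[OF True]])
      also have "\<dots> = 0"
        using that by (intro sum.neutral) (auto simp: single_def m0)
      finally show ?thesis by (simp add: entry_def)
    qed (simp add: entry_def bounded_ops_outside[OF T] F.single_not_in)
  qed
  then have "finite_propagation (entry ?T)"
    unfolding finite_propagation_iff by (intro exI[of _ "max r 0"]) auto
  with T show ?thesis by (simp add: fp_ops_def)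
qed

lemma lin_subspace_fp_ops: "lin_subspace (bounded_ops LF LG) FP"
  unfolding lin_subspace_def
proof (intro conjI bounded_ops.subspaceI)
  show "FP \<subseteq> vecs (bounded_ops LF LG)" by (auto simp: fp_ops_def)
  have "entry (0 :: ('x \<Rightarrow> 'a) \<Rightarrow> 'x \<Rightarrow> 'b) = 0" by (simp add: fun_eq_iff entry_def)
  then show "0 \<in> FP" using bounded_ops.zero_in_vecs
    by (simp add: fp_ops_def finite_propagation_def)
  fix S T assume S: "S \<in> FP" 
  obtain r where r: "\<And>x y. r < dist x y \<Longrightarrow> entry S x y = 0" "r \<ge> 0"
    using S by (auto simp: fp_ops_def finite_propagation_iff)
  show "scl (bounded_ops LF LG) c S \<in> FP" for c
  proof -
    have "entry (scl (bounded_ops LF LG) c S) x y = (\<lambda>v. scl G c (entry S x y v))" for x y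
      by (simp add: fun_eq_iff entry_def)
    then have "finite_propagation (entry (scl (bounded_ops LF LG) c S))"
      unfolding finite_propagation_iff using r by (auto simp: zero_fun_def fun_eq_iff)
    moreover have "scl (bounded_ops LF LG) c S \<in> vecs (bounded_ops LF LG)"
      using S by (intro bounded_ops.scl_in_vecs) (simp add: fp_ops_def)
    ultimately show ?thesis by (simp add: fp_ops_def)
  qed
  assume T: "T \<in> FP"
  obtain s where s: "\<And>x y. s < dist x y \<Longrightarrow> entry T x y = 0"
    using T by (auto simp: fp_ops_def finite_propagation_iff)
  have "entry (S + T) x y = entry S x y + entry T x y" for x y
    by (simp add: fun_eq_iff entry_def)
  then have "finite_propagation (entry (S + T))"
    unfolding finite_propagation_iff using r s by (intro exI[of _ "max r s"]) auto
  then show "S + T \<in> FP"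
    using S T by (simp add: fp_ops_def bounded_ops.add_in_vecs)
qed

end

section \<open>Products of operators of finite propagation\<close>

text \<open>The matrix product formula, obtained by expanding \<open>S\<close> in its row
  \<open>x\<close> at the vector \<open>T (single y v)\<close>.\<close>

lemma entry_comp:
  fixes F :: "'a::ab_group_add cspace" and G :: "'b::ab_group_add cspace" and H :: "'c::ab_group_add cspace"
    and T :: "('x::metric_space \<Rightarrow> 'a) \<Rightarrow> 'x \<Rightarrow> 'b"
  assumes "lp_operators F G p TYPE('x)" "lp_operators G H p TYPE('x)"
    and T: "T \<in> fp_ops p F G" and S: "S \<in> fp_ops p G H" and v: "v \<in> vecs F"
    and band: "\<And>y. r < dist x y \<Longrightarrow> entry S x y = 0"
  shows "entry (S \<circ> T) x y v = (\<Sum>z\<in>cball x r. entry S x z (entry T z y v))"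
proof -
  interpret FG: lp_operators F G p "TYPE('x)" by fact
  interpret GH: lp_operators G H p "TYPE('x)" by fact
  have "T \<in> vecs (bounded_ops (lp_sum p F) (lp_sum p G))" using T by (simp add: fp_ops_def)
  then have T_in: "T (single y v) \<in> vecs (lp_sum p G)" by (rule bounded_ops_in[OF _ FG.F.single_in[OF v]])
  have "S \<in> vecs (bounded_ops (lp_sum p G) (lp_sum p H))" using S by (simp add: fp_ops_def)
  from GH.apply_eq_sum_entries[OF this T_in band] show ?thesis by (simp add: entry_def)
qed

lemma bounded_ops_comp:
  assumes "complex_normed_space U" "complex_normed_space V" "complex_normed_space W"
    and "S \<in> vecs (bounded_ops V W)" "T \<in> vecs (bounded_ops U V)"
  shows "S \<circ> T \<in> vecs (bounded_ops U W)"
  using contractive_bilinear_comp[OF assms(1-3)] assms(4,5) by (simp add: contractive_bilinear_def)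

text \<open>Propagations add: if \<open>x\<close> and \<open>y\<close> are further apart than
  \<open>r + s\<close>, each \<open>z\<close> in the ball of radius \<open>r\<close> about
  \<open>x\<close> is further than \<open>s\<close> from \<open>y\<close>.\<close>

lemma fp_ops_comp:
  fixes F :: "'a::ab_group_add cspace" and G :: "'b::ab_group_add cspace" and H :: "'c::ab_group_add cspace"
    and T :: "('x::metric_space \<Rightarrow> 'a) \<Rightarrow> 'x \<Rightarrow> 'b"
  assumes FG: "lp_operators F G p TYPE('x)" and GH: "lp_operators G H p TYPE('x)"
    and S: "S \<in> fp_ops p G H" and T: "T \<in> fp_ops p F G"
  shows "S \<circ> T \<in> fp_ops p F H"
proof -
  interpret FG: lp_operators F G p "TYPE('x)" by fact
  interpret GH: lp_operators G H p "TYPE('x)" by fact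
  have ST: "S \<in> vecs (bounded_ops (lp_sum p G) (lp_sum p H))" "T \<in> vecs (bounded_ops (lp_sum p F) (lp_sum p G))"
    using S T by (simp_all add: fp_ops_def)
  have comp: "S \<circ> T \<in> vecs (bounded_ops (lp_sum p F) (lp_sum p H))"
    by (rule bounded_ops_comp[OF FG.F.complex_normed_space_lp_sum FG.G.complex_normed_space_lp_sum
        GH.G.complex_normed_space_lp_sum ST])
  obtain r where r: "\<And>x y. r < dist x y \<Longrightarrow> entry S x y = 0" "r \<ge> 0"
    using S by (auto simp: fp_ops_def finite_propagation_iff)
  obtain s where s: "\<And>x y. s < dist x y \<Longrightarrow> entry T x y = 0" "s \<ge> 0"
    using T by (auto simp: fp_ops_def finite_propagation_iff)
  have "entry (S \<circ> T) x y = 0" if "r + s < dist x y" for x y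
  proof
    fix v show "entry (S \<circ> T) x y v = 0 v"
    proof (cases "v \<in> vecs F")
      case True
      have "entry S x z (entry T z y v) = 0" if "z \<in> cball x r" for z
      proof -
        have "s < dist z y"
          using that \<open>r + s < dist x y\<close> dist_triangle[of x y z] by simp
        then show ?thesis
          using s GH.entries.bounded_ops_zero[OF GH.entry_bounded_op[OF ST(1)]] by simp
      qed
      then show ?thesis using entry_comp[OF FG GH T S True r(1)] by simp
    qed (simp add: entry_def bounded_ops_outside[OF ST(2)] FG.F.single_not_in GH.bounded_ops_zero[OF ST(1)])
  qed
  then have "finite_propagation (entry (S \<circ> T))"
    unfolding finite_propagation_iff using r s by (intro exI[of _ "r + s"]) auto
  with comp show ?thesis by (simp add: fp_ops_def)
qed

section \<open>Operators of bounded rank\<close>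

text \<open>A rank bound in terms of spanning sets; these can simply be united for sums and
  products, with no case distinction on finiteness.\<close>

definition rank_le :: "'a cspace \<Rightarrow> 'b::ab_group_add cspace \<Rightarrow> nat \<Rightarrow> ('a \<Rightarrow> 'b) \<Rightarrow> bool" where
  "rank_le V W n T \<longleftrightarrow> (\<exists>B. finite B \<and> card B \<le> n \<and> T ` vecs V \<subseteq> lin_span W B)"

context complex_normed_space
begin

lemma rank_le_basis:
  assumes "rank_le U V n T"
  obtains B where "finite B" "card B \<le> n" "B \<subseteq> T ` vecs U" "independent B" "T ` vecs U \<subseteq> span B"
    "card B = dim (T ` vecs U)"
proof -
  obtain S where S: "finite S" "card S \<le> n" "T ` vecs U \<subseteq> span S"
    using assms by (auto simp: rank_le_def lin_span_def)
  obtain B where B: "B \<subseteq> T ` vecs U" "independent B" "T ` vecs U \<subseteq> span B" "card B = dim (T ` vecs U)"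
    by (rule basis_exists)
  have "finite B \<and> card B \<le> card S"
    using S B by (intro independent_span_bound) auto
  with that B S show thesis by auto
qed

lemma op_rank_le_iff: "op_rank U V T \<le> enat n \<longleftrightarrow> rank_le U V n T"
proof
  assume "op_rank U V T \<le> enat n"
  then obtain S where S: "finite S" "T ` vecs U \<subseteq> span S" "dim (T ` vecs U) \<le> n"
    by (auto simp: op_rank_def lin_span_def split: if_splits)
  \<comment> \<open>The set \<open>S\<close> may be larger than the dimension; it only ensures
    finiteness, and is replaced by a basis of the image.\<close>
  have "rank_le U V (card S) T" using S by (auto simp: rank_le_def lin_span_def)
  then obtain B where "finite B" "T ` vecs U \<subseteq> span B" "card B = dim (T ` vecs U)"
    by (rule rank_le_basis)
  with S show "rank_le U V n T" by (auto simp: rank_le_def lin_span_def)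
next
  assume "rank_le U V n T"
  then obtain B where B: "finite B" "card B \<le> n" "T ` vecs U \<subseteq> span B"
    by (auto simp: rank_le_def lin_span_def)
  then have "dim (T ` vecs U) \<le> n" using dim_le_card[of "T ` vecs U" B] by simp
  with B show "op_rank U V T \<le> enat n" by (auto simp: op_rank_def lin_span_def)
qed

lemma rank_le_add:
  assumes "rank_le U V m S" "rank_le U V n T"
  shows "rank_le U V (m + n) (S + T)"
proof -
  obtain A B where A: "finite A" "card A \<le> m" "S ` vecs U \<subseteq> span A"
    and B: "finite B" "card B \<le> n" "T ` vecs U \<subseteq> span B"
    using assms by (auto simp: rank_le_def lin_span_def)
  have "card (A \<union> B) \<le> m + n" using card_Un_le[of A B] A B by linarith
  moreover have "span A \<subseteq> span (A \<union> B)" "span B \<subseteq> span (A \<union> B)" by (auto intro!: span_mono)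
  then have "(S + T) ` vecs U \<subseteq> span (A \<union> B)" using A B by (auto intro!: span_add)
  ultimately show ?thesis using A B by (auto simp: rank_le_def lin_span_def)
qed

lemma rank_le_scl:
  assumes "rank_le U V n T" shows "rank_le U V n (\<lambda>u. scl V c (T u))"
  using assms by (fastforce simp: rank_le_def lin_span_def intro!: span_scale)

lemma rank_le_0: "rank_le U V 0 0"
  by (auto simp: rank_le_def lin_span_def)

end

definition bounded_rank_entries ::
  "'a::zero cspace \<Rightarrow> 'b::ab_group_add cspace \<Rightarrow> (('x \<Rightarrow> 'a) \<Rightarrow> 'x \<Rightarrow> 'b) \<Rightarrow> bool" where
  "bounded_rank_entries F G T \<longleftrightarrow> (\<exists>n. \<forall>x y. rank_le F G n (entry T x y))"

text \<open>An entry of the product has its range in the sum of the ranges of at most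
  \<open>N\<close> entries of the left factor, so \<open>n\<close> becomes \<open>N * n\<close>.
  Bounding the left factor is enough for the pairing into \<open>A\<close>, where that factor is an
  element of \<open>Eg_alg\<close>.\<close>

lemma bounded_rank_entries_comp:
  fixes F :: "'a::ab_group_add cspace" and G :: "'b::ab_group_add cspace" and H :: "'c::ab_group_add cspace"
    and T :: "('x::metric_space \<Rightarrow> 'a) \<Rightarrow> 'x \<Rightarrow> 'b"
  assumes FG: "lp_operators F G p TYPE('x)" and GH: "lp_operators G H p TYPE('x)"
    and S: "S \<in> fp_ops p G H" and T: "T \<in> fp_ops p F G" and rank: "bounded_rank_entries G H S"
  shows "bounded_rank_entries F H (S \<circ> T)"
proof -
  interpret FG: lp_operators F G p "TYPE('x)" by fact
  interpret GH: lp_operators G H p "TYPE('x)" by fact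
  obtain r where r: "\<And>x y. r < dist x y \<Longrightarrow> entry S x y = 0"
    using S by (auto simp: fp_ops_def finite_propagation_iff)
  obtain N where N: "\<And>x :: 'x. card (cball x r) \<le> N" using FG.card_cball_bound[of r] by blast
  obtain n where "\<And>x y. rank_le G H n (entry S x y)" using rank by (auto simp: bounded_rank_entries_def)
  then have "\<forall>x y. \<exists>B. finite B \<and> card B \<le> n \<and> entry S x y ` vecs G \<subseteq> lin_span H B"
    by (auto simp: rank_le_def)
  then obtain B where B: "\<And>x y. finite (B x y)" "\<And>x y. card (B x y) \<le> n"
    "\<And>x y. entry S x y ` vecs G \<subseteq> lin_span H (B x y)" by metis
  have "rank_le F H (N * n) (entry (S \<circ> T) x y)" for x y
    unfolding rank_le_def
  proof (intro exI conjI subsetI)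
    let ?B = "\<Union>z\<in>cball x r. B x z"
    show "finite ?B" using B FG.finite_cball by auto
    have "card ?B \<le> (\<Sum>z\<in>cball x r. card (B x z))" by (rule card_UN_le[OF FG.finite_cball])
    also have "\<dots> \<le> card (cball x r) * n" using B by (intro sum_bounded_above[of _ _ n, simplified])
    also have "\<dots> \<le> N * n" using N by simp
    finally show "card ?B \<le> N * n" .
    fix w assume "w \<in> entry (S \<circ> T) x y ` vecs F"
    then obtain v where v: "v \<in> vecs F" "w = entry (S \<circ> T) x y v" by auto
    have w: "w = (\<Sum>z\<in>cball x r. entry S x z (entry T z y v))"
      unfolding v(2) by (rule entry_comp[OF FG GH T S v(1) r])
    show "w \<in> lin_span H ?B"
      unfolding w lin_span_def
    proof (rule GH.G.span_sum)
      fix z assume z: "z \<in> cball x r"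
      have "entry T z y v \<in> vecs G"
        using T v by (simp add: fp_ops_def bounded_ops_in[OF FG.entry_bounded_op])
      then have "entry S x z (entry T z y v) \<in> GH.G.span (B x z)"
        using B(3)[of x z] by (auto simp: lin_span_def)
      moreover have "GH.G.span (B x z) \<subseteq> GH.G.span ?B" using z by (intro GH.G.span_mono) auto
      ultimately show "entry S x z (entry T z y v) \<in> GH.G.span ?B" by blast
    qed
  qed
  then show ?thesis by (auto simp: bounded_rank_entries_def)
qed

section \<open>Functionals on the sequence spaces\<close>

lemma vecs_scalars [simp]: "vecs scalars = UNIV"
  and scl_scalars [simp]: "scl scalars = (*)"
  and nrm_scalars [simp]: "nrm scalars = cmod"
  by (simp_all add: scalars_def)

lemma lp_direct_sum_scalars: "1 \<le> p \<Longrightarrow> lp_direct_sum scalars p"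
  by (intro lp_direct_sum.intro lp_direct_sum_axioms.intro complex_banach_space.axioms(1)
      complex_banach_space_scalars)

lemma complex_banach_space_lp: "1 \<le> p \<Longrightarrow> complex_banach_space (lp p)"
  unfolding lp_def by (intro complex_banach_space_lp_sum complex_banach_space_scalars)

lemma lp_direct_sum_lp: "1 \<le> p \<Longrightarrow> lp_direct_sum (lp p) p"
  by (intro lp_direct_sum.intro lp_direct_sum_axioms.intro complex_banach_space.axioms(1)
      complex_banach_space_lp)

section \<open>Young-type inequalities and the pairing with sequences\<close>

text \<open>Replacing both \<open>a\<close> and \<open>t\<close> by their maximum turns the product
  into a single power, which is one of the two summands.\<close>

lemma powr_diff_1_mult_le:
  fixes a t :: real
  assumes "1 \<le> p" "0 \<le> a" "0 \<le> t"
  shows "a powr (p - 1) * t \<le> a powr p + t powr p"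
proof -
  have eq: "s powr (p - 1) * s = s powr p" if "0 \<le> s" for s :: real
    using that powr_mult_base[of s "p - 1"] by (simp add: mult.commute)
  have "a powr (p - 1) * t \<le> max a t powr (p - 1) * max a t"
    using assms by (intro mult_mono powr_mono2) auto
  also have "\<dots> = max a t powr p" using assms by (intro eq) auto
  also have "\<dots> \<le> a powr p + t powr p" by (auto simp: max_def)
  finally show ?thesis .
qed

text \<open>The preceding inequality with \<open>a\<close> replaced by
  \<open>a powr (1 / (p - 1))\<close>.\<close>

lemma young_le:
  fixes a t :: real
  assumes "1 < p" "0 \<le> a" "0 \<le> t"
  shows "a * t \<le> a powr (p / (p - 1)) + t powr p"
proof -
  have "(a powr (1 / (p - 1))) powr (p - 1) * t \<le> (a powr (1 / (p - 1))) powr p + t powr p"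
    using assms by (intro powr_diff_1_mult_le) auto
  then show ?thesis using assms by (simp add: powr_powr)
qed

text \<open>The hypothesis on \<open>f\<close> covers \<open>p = 1\<close>, with \<open>h = 0\<close> and \<open>c\<close> a bound of \<open>f\<close>, and \<open>p > 1\<close>, with \<open>c = 1\<close>
  and \<open>h = \<bar>f\<bar>\<^sup>q\<close> by a form of Young's inequality. It suffices to bound the sum for \<open>v\<close> of norm \<open>1\<close>.\<close>

lemma pairing_bound:
  fixes f v :: "nat \<Rightarrow> complex"
  assumes p: "1 \<le> p" and young: "\<forall>n. \<forall>t\<ge>0. cmod (f n) * t \<le> h n + c * t powr p"
    and h: "h summable_on UNIV" "infsum h UNIV \<le> H" and c: "0 \<le> c" and v: "v \<in> vecs (lp p)"
  shows "(\<lambda>n. f n * v n) summable_on UNIV"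
    and "cmod (\<Sum>\<^sub>\<infinity>n. f n * v n) \<le> (H + c) * nrm (lp p) v"
proof -
  interpret lp_direct_sum scalars p by (rule lp_direct_sum_scalars[OF p])
  have abs: "(\<lambda>n. cmod (f n * v n)) summable_on UNIV"
    and le: "cmod (\<Sum>\<^sub>\<infinity>n. f n * v n) \<le> H + c * nrm (lp p) v powr p"
    if v: "v \<in> vecs (lp p)" for v
  proof -
    have sm: "(\<lambda>n. cmod (v n) powr p) summable_on UNIV" using v by (simp add: lp_def lp_sum_def)
    have smh: "(\<lambda>n. h n + c * cmod (v n) powr p) summable_on UNIV"
      by (intro summable_on_add h summable_on_cmult_right sm)
    have bd: "cmod (f n * v n) \<le> h n + c * cmod (v n) powr p" for n
      using young by (simp add: norm_mult)
    show abs: "(\<lambda>n. cmod (f n * v n)) summable_on UNIV"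
      by (rule summable_on_comparison_test[OF smh]) (use bd in auto)
    have "cmod (\<Sum>\<^sub>\<infinity>n. f n * v n) \<le> (\<Sum>\<^sub>\<infinity>n. cmod (f n * v n))"
      by (rule norm_infsum_bound[OF abs])
    also have "\<dots> \<le> (\<Sum>\<^sub>\<infinity>n. h n + c * cmod (v n) powr p)"
      by (rule infsum_mono[OF abs smh bd])
    also have "\<dots> = infsum h UNIV + c * (\<Sum>\<^sub>\<infinity>n. cmod (v n) powr p)"
      using h sm by (simp add: infsum_add summable_on_cmult_right infsum_cmult_right')
    also have "(\<Sum>\<^sub>\<infinity>n. cmod (v n) powr p) = nrm (lp p) v powr p"
      using lp_sum_nrm_powr[of v] by (simp add: lp_def)
    finally show "cmod (\<Sum>\<^sub>\<infinity>n. f n * v n) \<le> H + c * nrm (lp p) v powr p" using h(2) by simp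
  qed
  show "(\<lambda>n. f n * v n) summable_on UNIV" by (rule abs_summable_summable[OF abs[OF v]])
  have v': "v \<in> vecs (lp_sum p scalars)" using v by (simp add: lp_def)
  let ?b = "nrm (lp p) v"
  show "cmod (\<Sum>\<^sub>\<infinity>n. f n * v n) \<le> (H + c) * ?b"
  proof (cases "v = 0")
    case False
    then have b: "?b > 0"
      using lp_sum.nrm_eq_0[OF v'] lp_sum.nrm_nonneg[OF v'] by (simp add: lp_def)
    define w where "w n = complex_of_real (1 / ?b) * v n" for n
    have w: "w \<in> vecs (lp p)" "nrm (lp p) w = 1"
      using lp_sum_scl[OF v', of "complex_of_real (1 / ?b)"] b
      by (simp_all add: w_def[abs_def] lp_def norm_divide)
    have "(\<Sum>\<^sub>\<infinity>n. f n * v n) = (\<Sum>\<^sub>\<infinity>n. complex_of_real ?b * (f n * w n))"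
      using b by (intro infsum_cong) (simp add: w_def)
    also have "\<dots> = complex_of_real ?b * (\<Sum>\<^sub>\<infinity>n. f n * w n)" by (rule infsum_cmult_right')
    finally have "cmod (\<Sum>\<^sub>\<infinity>n. f n * v n) = ?b * cmod (\<Sum>\<^sub>\<infinity>n. f n * w n)"
      using b by (simp add: norm_mult)
    also have "\<dots> \<le> ?b * (H + c)" using le[OF w(1)] w(2) b by (intro mult_left_mono) auto
    finally show ?thesis by (simp add: mult.commute)
  qed (simp add: lp_def)
qed

lemma pairing_bounded_op:
  fixes f :: "nat \<Rightarrow> complex"
  assumes p: "1 \<le> p" and young: "\<forall>n. \<forall>t\<ge>0. cmod (f n) * t \<le> h n + c * t powr p"
    and h: "h summable_on UNIV" "infsum h UNIV \<le> H" and c: "0 \<le> c"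
  defines "\<psi> \<equiv> \<lambda>v. if v \<in> vecs (lp p) then \<Sum>\<^sub>\<infinity>n. f n * v n else 0"
  shows "\<psi> \<in> vecs (bounded_ops (lp p) scalars)" "nrm (bounded_ops (lp p) scalars) \<psi> \<le> H + c"
proof -
  interpret lp_direct_sum scalars p by (rule lp_direct_sum_scalars[OF p])
  note bound = pairing_bound[OF assms(1-5)]
  interpret L: complex_banach_space "lp p :: (nat \<Rightarrow> complex) cspace" by (rule complex_banach_space_lp[OF p])
  interpret normed_space_pair "lp p :: (nat \<Rightarrow> complex) cspace" scalars ..
  \<comment> \<open>The Young hypothesis at \<open>t = 0\<close>.\<close>
  have "h n \<ge> 0" for n using young[rule_format, of 0 n] p by simp
  then have H: "H \<ge> 0" using infsum_nonneg[of UNIV h] h by simp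
  show "\<psi> \<in> vecs (bounded_ops (lp p) scalars)"
  proof (rule bounded_opsI)
    fix u v :: "nat \<Rightarrow> complex" assume u: "u \<in> vecs (lp p)"
    show "nrm scalars (\<psi> u) \<le> (H + c) * nrm (lp p) u" using bound(2)[OF u] u by (simp add: \<psi>_def)
    have "(\<Sum>\<^sub>\<infinity>n. f n * (a * u n)) = a * (\<Sum>\<^sub>\<infinity>n. f n * u n)" for a
      by (subst infsum_cmult_right'[symmetric]) (simp add: mult_ac)
    then show "\<psi> (scl (lp p) a u) = scl scalars a (\<psi> u)" for a
      using u L.scl_in_vecs[OF u, of a] by (simp add: \<psi>_def lp_def)
    assume v: "v \<in> vecs (lp p)"
    show "\<psi> (u + v) = \<psi> u + \<psi> v"
      using infsum_add[OF bound(1)[OF u] bound(1)[OF v]] u v L.add_in_vecs[OF u v]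
      by (simp add: \<psi>_def algebra_simps)
  qed (simp_all add: \<psi>_def)
  show "nrm (bounded_ops (lp p) scalars) \<psi> \<le> H + c"
    using H c bound(2) by (intro nrm_bounded_ops_le) (auto simp: \<psi>_def)
qed

text \<open>\<open>K\<close> is chosen before \<open>f\<close> because it has to serve all entries
  of a matrix at once.\<close>

lemma lq_pairing:
  assumes p: "1 \<le> p"
  shows "\<exists>K. \<forall>f\<in>vecs (lq p). nrm (lq p) f \<le> C \<longrightarrow>
    (\<lambda>v. if v \<in> vecs (lp p) then \<Sum>\<^sub>\<infinity>n. f n * v n else 0) \<in> vecs (bounded_ops (lp p) scalars) \<and>
    nrm (bounded_ops (lp p) scalars) (\<lambda>v. if v \<in> vecs (lp p) then \<Sum>\<^sub>\<infinity>n. f n * v n else 0) \<le> K"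
proof (cases "p = 1")
  case True
  have young: "\<forall>n. \<forall>t\<ge>0. cmod (f n) * t \<le> 0 + \<bar>C\<bar> * t powr p"
    if f: "f \<in> vecs (lq p)" "nrm (lq p) f \<le> C" for f
  proof (intro allI impI)
    fix n and t :: real assume t: "0 \<le> t"
    have "bdd_above (range (\<lambda>n. cmod (f n)))"
      using f(1) True by (auto simp: lq_def linf_def bounded_iff bdd_above_def)
    then have "cmod (f n) \<le> nrm (lq p) f"
      using True cSUP_upper[of n UNIV "\<lambda>n. cmod (f n)"] by (simp add: lq_def linf_def)
    then show "cmod (f n) * t \<le> 0 + \<bar>C\<bar> * t powr p"
      using f(2) t True by (auto intro!: mult_right_mono)
  qed
  show ?thesis
    using pairing_bounded_op[OF p young, where H = 0] by (intro exI[of _ "0 + \<bar>C\<bar>"]) auto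
next
  case False
  then have p1: "1 < p" using p by simp
  then have q: "1 \<le> p / (p - 1)" by simp
  interpret Q: lp_direct_sum scalars "p / (p - 1)" by (rule lp_direct_sum_scalars[OF q])
  let ?h = "\<lambda>f n. cmod (f n :: complex) powr (p / (p - 1))"
  have young: "\<forall>n. \<forall>t\<ge>0. cmod (f n) * t \<le> ?h f n + 1 * t powr p" for f
    using young_le[OF p1 norm_ge_zero, of _ "f _"] by auto
  have "?h f summable_on UNIV" "infsum (?h f) UNIV \<le> \<bar>C\<bar> powr (p / (p - 1))"
    if f: "f \<in> vecs (lq p)" "nrm (lq p) f \<le> C" for f
  proof -
    have f': "f \<in> vecs (lp_sum (p / (p - 1)) scalars)" "nrm (lp_sum (p / (p - 1)) scalars) f \<le> C"
      using f False by (simp_all add: lq_def lp_def)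
    then show "?h f summable_on UNIV" by (simp add: lp_sum_def)
    have "nrm (lp_sum (p / (p - 1)) scalars) f powr (p / (p - 1)) \<le> \<bar>C\<bar> powr (p / (p - 1))"
      using q f'(2) by (intro powr_mono2 Q.lp_sum_nrm_nonneg) auto
    then show "infsum (?h f) UNIV \<le> \<bar>C\<bar> powr (p / (p - 1))"
      unfolding Q.lp_sum_nrm_powr by simp
  qed
  then show ?thesis
    using pairing_bounded_op[OF p young] by (intro exI[of _ "\<bar>C\<bar> powr (p / (p - 1)) + 1"]) auto
qed

section \<open>Functionals and their coefficient sequences\<close>

text \<open>The partial sum over \<open>K'\<close> is the value of the functional at the truncation
  of \<open>v\<close> to \<open>K'\<close>, and truncations converge to \<open>v\<close> along the
  net of finite sets.\<close>

lemma functional_has_sum: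
  assumes p: "1 \<le> p" and \<phi>: "\<phi> \<in> vecs (bounded_ops (lp p) scalars)" and v: "v \<in> vecs (lp p)"
  shows "((\<lambda>n. \<phi> (single n 1) * v n) has_sum \<phi> v) UNIV"
proof -
  interpret lp_direct_sum scalars p by (rule lp_direct_sum_scalars[OF p])
  interpret L: complex_banach_space "lp p :: ('a \<Rightarrow> complex) cspace" by (rule complex_banach_space_lp[OF p])
  interpret normed_space_pair "lp p :: ('a \<Rightarrow> complex) cspace" scalars ..
  note lp_unfold = lp_def[of p, symmetric]
  have single: "\<phi> (single n c) = \<phi> (single n 1) * c" for n c
  proof -
    have "single n c = scl (lp p) c (single n 1)" by (auto simp: single_def lp_def)
    then show ?thesis
      using bounded_ops_scl[OF \<phi>, of "single n 1" c] single_in[of 1 n] by (simp add: lp_unfold)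
  qed
  let ?n = "nrm (bounded_ops (lp p) scalars) \<phi>"
  have n: "?n \<ge> 0" by (rule nrm_bounded_ops_nonneg[OF \<phi>])
  show ?thesis
    unfolding has_sum_def
  proof (rule tendstoI)
    fix e :: real assume e: "e > 0"
    then have "e / (?n + 1) > 0" using n by simp
    then obtain K where K: "finite K" "\<And>K'. K \<subseteq> K' \<Longrightarrow> nrm (lp p) (v - restr K' v) \<le> e / (?n + 1)"
      using restr_approx[OF v[unfolded lp_def] \<open>e / (?n + 1) > 0\<close>] unfolding lp_unfold by blast
    have "dist (\<Sum>n\<in>K'. \<phi> (single n 1) * v n) (\<phi> v) < e" if K': "K \<subseteq> K'" "finite K'" for K'
    proof -
      have restr: "restr K' v \<in> vecs (lp p)" using restr_in[of v K'] v by (simp add: lp_unfold)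
      have "\<phi> (restr K' v) = (\<Sum>n\<in>K'. \<phi> (single n (v n)))"
        unfolding restr_eq_sum_single[OF K'(2)]
        using single_in by (intro bounded_ops_sum[OF \<phi>]) (simp add: lp_unfold)
      then have "dist (\<Sum>n\<in>K'. \<phi> (single n 1) * v n) (\<phi> v) = cmod (\<phi> (v - restr K' v))"
        using bounded_ops_diff[OF \<phi> v restr] by (subst dist_commute) (simp add: single[of _ "v _"] dist_norm)
      also have "\<dots> \<le> ?n * nrm (lp p) (v - restr K' v)"
        using nrm_apply_le[OF \<phi>, of "v - restr K' v"] L.diff_in_vecs[OF v restr] by simp
      also have "\<dots> \<le> ?n * (e / (?n + 1))" using K(2)[OF K'(1)] n by (rule mult_left_mono)
      also have "\<dots> < e" using n e by (simp add: field_simps)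
      finally show ?thesis .
    qed
    with K show "\<forall>\<^sub>F K in finite_subsets_at_top UNIV. dist (\<Sum>n\<in>K. \<phi> (single n 1) * v n) (\<phi> v) < e"
      by (auto simp: eventually_finite_subsets_at_top)
  qed
qed

text \<open>Conjugate phases turn a pairing into a sum of absolute values, both for the extremal
  vector in \<open>functional_in_lq\<close> and for the functional in
  \<open>norming_functional\<close>.\<close>

lemma mult_cnj_sgn: "z * cnj (sgn z) = complex_of_real (cmod z)"
  using complex_norm_square[of z]
  by (cases "z = 0") (simp_all add: sgn_eq power2_eq_square field_simps)

text \<open>For \<open>p = 1\<close> the basis vectors test the supremum norm. For
  \<open>p > 1\<close> the functional is tested on the extremal vector of Hoelder's inequality, cut
  off to a finite set \<open>K\<close> so that it certainly lies in the space; the bound does not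
  depend on \<open>K\<close>.\<close>

lemma functional_in_lq:
  fixes \<phi> :: "(nat \<Rightarrow> complex) \<Rightarrow> complex"
  assumes p: "1 \<le> p" and \<phi>: "\<phi> \<in> vecs (bounded_ops (lp p) scalars)"
  shows "(\<lambda>n. \<phi> (single n 1)) \<in> vecs (lq p)"
    and "nrm (lq p) (\<lambda>n. \<phi> (single n 1)) \<le> nrm (bounded_ops (lp p) scalars) \<phi>"
proof -
  interpret lp_direct_sum scalars p by (rule lp_direct_sum_scalars[OF p])
  interpret L: complex_banach_space "lp p :: (nat \<Rightarrow> complex) cspace" by (rule complex_banach_space_lp[OF p])
  interpret normed_space_pair "lp p :: (nat \<Rightarrow> complex) cspace" scalars ..
  note lp_unfold = lp_def[of p, symmetric]
  let ?f = "\<lambda>n. \<phi> (single n 1)" and ?C = "nrm (bounded_ops (lp p) scalars) \<phi>"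
  have C: "?C \<ge> 0" by (rule nrm_bounded_ops_nonneg[OF \<phi>])
  have "?f \<in> vecs (lq p) \<and> nrm (lq p) ?f \<le> ?C"
  proof (cases "p = 1")
    case True
    have "cmod (?f n) \<le> ?C" for n
    proof -
      have 1: "single n (1 :: complex) \<in> vecs (lp p)" "nrm (lp p) (single n (1 :: complex)) \<le> 1"
        using single_in[of 1 n] nrm_single_le[of 1 n] by (simp_all add: lp_unfold)
      have "cmod (?f n) \<le> ?C * nrm (lp p) (single n (1 :: complex))"
        using nrm_apply_le[OF \<phi> 1(1)] by simp
      also have "\<dots> \<le> ?C * 1" using 1(2) C by (rule mult_left_mono)
      finally show ?thesis by simp
    qed
    then show ?thesis using True
      by (auto simp: lq_def linf_def bounded_iff intro!: cSUP_least)
  next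
    case False
    define q where "q = p / (p - 1)"
    have q: "1 \<le> q" "(q - 1) * p = q" "1 - 1 / p = 1 / q"
      using False p by (auto simp: q_def field_simps)
    interpret Q: lp_direct_sum scalars q by (rule lp_direct_sum_scalars[OF q(1)])
    have "(\<Sum>n\<in>K. cmod (?f n) powr q) \<le> ?C powr q" if K: "finite K" for K
    proof -
      let ?A = "\<Sum>n\<in>K. cmod (?f n) powr q"
      have A: "?A \<ge> 0" by (intro sum_nonneg) auto
      \<comment> \<open>Chosen so that \<open>?f n * w n\<close> and the \<open>p\<close>-th power
        of \<open>cmod (w n)\<close> both amount to the \<open>q\<close>-th power of
        \<open>cmod (?f n)\<close>, using \<open>(q - 1) * p = q\<close>.\<close>
      define w where "w n = cnj (sgn (?f n)) * complex_of_real (cmod (?f n) powr (q - 1))" for n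
      have fw: "?f n * w n = complex_of_real (cmod (?f n) powr q)" for n
        using powr_mult_base[of "cmod (?f n)" "q - 1"] unfolding w_def
        by (simp add: mult.assoc[symmetric] mult_cnj_sgn flip: of_real_mult)
      have nw: "cmod (w n) powr p \<le> cmod (?f n) powr q" for n
        using q(2) by (simp add: w_def norm_mult norm_sgn powr_powr)
      have v: "restr K w \<in> vecs (lp p)" "nrm (lp p) (restr K w) \<le> ?A powr (1 / p)"
      proof -
        have "(\<Sum>n\<in>M. cmod (restr K w n) powr p) \<le> (?A powr (1 / p)) powr p" if M: "finite M" for M
        proof -
          have "(\<Sum>n\<in>M. cmod (restr K w n) powr p) \<le> (\<Sum>n\<in>M. if n \<in> K then cmod (?f n) powr q else 0)"
            using nw p by (intro sum_mono) (auto simp: restr_def)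
          also have "\<dots> = (\<Sum>n\<in>M \<inter> K. cmod (?f n) powr q)" using M by (simp add: sum.inter_restrict)
          also have "\<dots> \<le> ?A" using K by (intro sum_mono2) auto
          also have "\<dots> = (?A powr (1 / p)) powr p" using A p by (simp add: powr_powr)
          finally show ?thesis .
        qed
        then show "restr K w \<in> vecs (lp p)" "nrm (lp p) (restr K w) \<le> ?A powr (1 / p)"
          using lp_sum_memI[of "restr K w" "?A powr (1 / p)"] by (simp_all add: lp_unfold)
      qed
      have "\<phi> (restr K w) = (\<Sum>n\<in>K. ?f n * w n)"
      proof (rule has_sum_unique[OF functional_has_sum[OF p \<phi> v(1)]])
        show "((\<lambda>n. ?f n * restr K w n) has_sum (\<Sum>n\<in>K. ?f n * w n)) UNIV"
          by (rule has_sum_finite_neutralI[OF K]) (auto simp: restr_def)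
      qed
      then have "\<phi> (restr K w) = complex_of_real ?A" by (simp add: fw)
      then have "?A = cmod (\<phi> (restr K w))" using A by (simp only: norm_of_real abs_of_nonneg)
      also have "\<dots> \<le> ?C * nrm (lp p) (restr K w)" using nrm_apply_le[OF \<phi> v(1)] by simp
      also have "\<dots> \<le> ?C * ?A powr (1 / p)" using v(2) C by (rule mult_left_mono)
      finally have le: "?A \<le> ?C * ?A powr (1 / p)" .
      show ?thesis
      proof (cases "?A = 0")
        case False
        then have "?A > 0" using A by linarith
        \<comment> \<open>The estimate \<open>le\<close> divided by \<open>?A powr (1 / p)\<close>;
          the remaining exponent is \<open>1 / q\<close>.\<close>
        then have "?A powr (1 - 1 / p) \<le> ?C" using le by (simp add: powr_diff field_simps)
        then have "(?A powr (1 / q)) powr q \<le> ?C powr q"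
          using q by (intro powr_mono2) auto
        then show ?thesis using q(1) A by (simp add: powr_powr)
      qed simp
    qed
    then show ?thesis
      using Q.lp_sum_memI[of ?f ?C] C False by (simp add: lq_def q_def[symmetric] lp_def)
  qed
  then show "?f \<in> vecs (lq p)" "nrm (lq p) ?f \<le> ?C" by auto
qed

text \<open>The explicit duality map: for the unit vector \<open>z\<close> in the direction of
  \<open>w\<close>, the coefficients are the conjugate phases of \<open>z\<close> times the absolute
  values to the power \<open>p - 1\<close>, so that pairing with \<open>z\<close> gives 1.\<close>

lemma norming_functional:
  fixes w :: "nat \<Rightarrow> complex"
  assumes p: "1 \<le> p" and w: "w \<in> vecs (lp p)" "w \<noteq> 0"
  obtains \<psi> where "\<psi> \<in> vecs (bounded_ops (lp p) scalars)" "nrm (bounded_ops (lp p) scalars) \<psi> \<le> 2"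
    "\<psi> w = complex_of_real (nrm (lp p) w)"
proof -
  interpret lp_direct_sum scalars p by (rule lp_direct_sum_scalars[OF p])
  have w': "w \<in> vecs (lp_sum p scalars)" using w by (simp add: lp_def)
  let ?b = "nrm (lp p) w"
  have b: "?b > 0" using w(2) lp_sum.nrm_eq_0[OF w'] lp_sum.nrm_nonneg[OF w'] by (simp add: lp_def)
  define z where "z n = complex_of_real (1 / ?b) * w n" for n
  have z: "z \<in> vecs (lp p)" "nrm (lp p) z = 1"
    using lp_sum_scl[OF w', of "complex_of_real (1 / ?b)"] b
    by (simp_all add: z_def[abs_def] lp_def norm_divide)
  have wz: "w n = complex_of_real ?b * z n" for n using b by (simp add: z_def)
  let ?h = "\<lambda>n. cmod (z n) powr p"
  have h: "?h summable_on UNIV" "infsum ?h UNIV = 1"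
    using z lp_sum_nrm_powr[of z] by (simp_all add: lp_def, simp add: lp_sum_def)
  define f where "f n = cnj (sgn (z n)) * complex_of_real (cmod (z n) powr (p - 1))" for n
  have young: "\<forall>n. \<forall>t\<ge>0. cmod (f n) * t \<le> ?h n + 1 * t powr p"
  proof (intro allI impI)
    fix n and t :: real assume that: "0 \<le> t"
    have "cmod (f n) \<le> cmod (z n) powr (p - 1)" by (simp add: f_def norm_mult norm_sgn)
    then have "cmod (f n) * t \<le> cmod (z n) powr (p - 1) * t" using that by (rule mult_right_mono)
    also have "\<dots> \<le> ?h n + t powr p" using p that by (intro powr_diff_1_mult_le) auto
    finally show "cmod (f n) * t \<le> ?h n + 1 * t powr p" by simp
  qed
  have fz: "f n * z n = complex_of_real (?h n)" for n
    using powr_mult_base[of "cmod (z n)" "p - 1"] unfolding f_def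
    by (subst mult.commute) (simp add: mult.assoc[symmetric] mult_cnj_sgn flip: of_real_mult)
  let ?\<psi> = "\<lambda>v. if v \<in> vecs (lp p) then \<Sum>\<^sub>\<infinity>n. f n * v n else 0"
  \<comment> \<open>One summand is the sum of \<open>?h\<close>, the other the coefficient 1 of
    \<open>t powr p\<close> in the Young bound.\<close>
  have \<psi>: "?\<psi> \<in> vecs (bounded_ops (lp p) scalars)" "nrm (bounded_ops (lp p) scalars) ?\<psi> \<le> 1 + 1"
    using h by (intro pairing_bounded_op[OF p young, where H = 1]; simp)+
  have "?\<psi> w = (\<Sum>\<^sub>\<infinity>n. complex_of_real ?b * complex_of_real (?h n))"
    using w(1) by (simp, intro infsum_cong) (simp add: wz mult.left_commute fz)
  also have "\<dots> = complex_of_real ?b * complex_of_real (infsum ?h UNIV)"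
    by (simp only: infsum_cmult_right' infsumI[OF has_sum_of_real[OF has_sum_infsum[OF h(1)]]])
  finally have "?\<psi> w = complex_of_real ?b" using h by simp
  with \<psi> that show thesis by simp
qed

section \<open>Rank-one decomposition with uniform constants\<close>

text \<open>Vectors of norm at most 1 and functionals bounded through \<open>n\<close> and the norm
  of \<open>S\<close> alone: this is what lets the decompositions of all entries of an operator be
  assembled into matrices with uniformly bounded entries.\<close>

lemma finite_rank_decomposition:
  fixes V :: "'v::ab_group_add cspace" and S :: "'v \<Rightarrow> nat \<Rightarrow> complex"
  assumes p: "1 \<le> p" and V: "complex_normed_space V"
    and "S \<in> vecs (bounded_ops V (lp p))" "rank_le V (lp p) n S"
  shows "\<exists>e \<phi>. (\<forall>k<n. e k \<in> vecs (lp p) \<and> nrm (lp p) (e k) \<le> 1 \<and>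
      \<phi> k \<in> vecs (bounded_ops V scalars) \<and>
      nrm (bounded_ops V scalars) (\<phi> k) \<le> 3 ^ n * nrm (bounded_ops V (lp p)) S) \<and>
    (\<forall>v\<in>vecs V. S v = (\<Sum>k<n. scl (lp p) (\<phi> k v) (e k)))"
  using assms(3,4)
proof (induction n arbitrary: S)
  case 0
  interpret L: complex_banach_space "lp p :: (nat \<Rightarrow> complex) cspace" by (rule complex_banach_space_lp[OF p])
  have "S v = 0" if "v \<in> vecs V" for v
    using 0(2) that by (auto simp: rank_le_def lin_span_def)
  then show ?case by simp
next
  case (Suc n)
  interpret V: complex_normed_space V by fact
  interpret L: complex_banach_space "lp p :: (nat \<Rightarrow> complex) cspace" by (rule complex_banach_space_lp[OF p])
  interpret C: complex_banach_space scalars by (rule complex_banach_space_scalars)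
  interpret VL: normed_space_pair V "lp p :: (nat \<Rightarrow> complex) cspace" ..
  interpret VC: normed_space_pair V scalars ..
  interpret LC: normed_space_pair "lp p :: (nat \<Rightarrow> complex) cspace" scalars ..
  let ?nS = "nrm (bounded_ops V (lp p)) S"
  note S = Suc.prems(1)
  have nS: "?nS \<ge> 0" by (rule VL.nrm_bounded_ops_nonneg[OF S])
  show ?case
  proof (cases "\<forall>v\<in>vecs V. S v = 0")
    \<comment> \<open>The zero operator may occur before the rank bound is used up; the list is then
      padded with zeros to its prescribed length.\<close>
    case True
    have "0 \<in> vecs (bounded_ops V scalars)" "nrm (bounded_ops V scalars) 0 = 0"
      by (rule VC.bounded_ops.zero_in_vecs VC.bounded_ops.nrm_zero)+
    then show ?thesis using True nS
      by (intro exI[of _ "\<lambda>_. 0 :: nat \<Rightarrow> complex"] exI[of _ "\<lambda>_. 0 :: 'v \<Rightarrow> complex"])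
        (simp add: sum.neutral flip: zero_fun_def)
  next
    case False
    then obtain u where u: "u \<in> vecs V" "S u \<noteq> 0" by auto
    define w where "w = S u"
    have w: "w \<in> vecs (lp p)" "w \<noteq> 0" using bounded_ops_in[OF S u(1)] u(2) by (simp_all add: w_def)
    let ?b = "nrm (lp p) w"
    have b: "?b > 0" using L.nrm_nonneg[OF w(1)] L.nrm_eq_0[OF w(1)] w(2) by linarith
    obtain \<psi> where \<psi>: "\<psi> \<in> vecs (bounded_ops (lp p) scalars)" "nrm (bounded_ops (lp p) scalars) \<psi> \<le> 2"
        "\<psi> w = complex_of_real ?b"
      by (rule norming_functional[OF p w])
    define e0 where "e0 = scl (lp p) (1 / complex_of_real ?b) w"
    define \<phi>0 where "\<phi>0 = \<psi> \<circ> S"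
    have e0: "e0 \<in> vecs (lp p)" "nrm (lp p) e0 = 1"
      using b w by (simp_all add: e0_def L.scl_in_vecs L.nrm_scl norm_divide)
    have \<psi>e0: "\<psi> e0 = 1" using b by (simp add: e0_def bounded_ops_scl[OF \<psi>(1) w(1)] \<psi>(3))
    have \<phi>0: "\<phi>0 \<in> vecs (bounded_ops V scalars)"
      unfolding \<phi>0_def
      by (rule bounded_ops_comp[OF V L.complex_normed_space_axioms C.complex_normed_space_axioms \<psi>(1) S])
    have "nrm (bounded_ops V scalars) \<phi>0 \<le> nrm (bounded_ops (lp p) scalars) \<psi> * ?nS"
      using contractive_bilinear_comp[OF V L.complex_normed_space_axioms C.complex_normed_space_axioms] \<psi>(1) S
      by (simp add: contractive_bilinear_def \<phi>0_def)
    also have "\<dots> \<le> 2 * ?nS" using \<psi>(2) nS by (rule mult_right_mono)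
    finally have n\<phi>0: "nrm (bounded_ops V scalars) \<phi>0 \<le> 2 * ?nS" .
    \<comment> \<open>\<open>R\<close> is \<open>S\<close> followed by the projection
      \<open>z \<mapsto> \<psi> z e0\<close>, a projection because
      \<open>\<psi> e0 = 1\<close>.\<close>
    define R where "R = (\<lambda>v. scl (lp p) (\<phi>0 v) e0)"
    have R_le: "nrm (lp p) (R v) \<le> 2 * ?nS * nrm V v" if v: "v \<in> vecs V" for v
    proof -
      have "nrm (lp p) (R v) = nrm scalars (\<phi>0 v)" by (simp add: R_def L.nrm_scl[OF e0(1)] e0(2))
      also have "\<dots> \<le> nrm (bounded_ops V scalars) \<phi>0 * nrm V v" by (rule VC.nrm_apply_le[OF \<phi>0 v])
      also have "\<dots> \<le> 2 * ?nS * nrm V v" using n\<phi>0 V.nrm_nonneg[OF v] by (rule mult_right_mono)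
      finally show ?thesis .
    qed
    have R: "R \<in> vecs (bounded_ops V (lp p))"
      using R_le by (intro bounded_opsI[where C = "2 * ?nS"])
        (simp_all add: R_def L.scl_in_vecs e0 bounded_ops_outside[OF \<phi>0] bounded_ops_add[OF \<phi>0]
          bounded_ops_scl[OF \<phi>0] L.scale_left_distrib)
    have nR: "nrm (bounded_ops V (lp p)) R \<le> 2 * ?nS"
      using R_le nS by (intro VL.nrm_bounded_ops_le) auto
    define S' where "S' = S - R"
    have S': "S' \<in> vecs (bounded_ops V (lp p))" unfolding S'_def by (rule VL.bounded_ops.diff_in_vecs[OF S R])
    have "nrm (bounded_ops V (lp p)) S' \<le> ?nS + nrm (bounded_ops V (lp p)) R"
      unfolding S'_def by (rule VL.bounded_ops.nrm_diff_le[OF S R])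
    then have nS': "nrm (bounded_ops V (lp p)) S' \<le> 3 * ?nS" using nR by simp
    \<comment> \<open>The image of the remainder lies in the kernel of \<open>\<psi>\<close>, which
      misses \<open>w\<close>.\<close>
    have \<psi>S': "\<psi> (S' v) = 0" if v: "v \<in> vecs V" for v
      by (simp add: S'_def LC.bounded_ops_diff[OF \<psi>(1) bounded_ops_in[OF S v] bounded_ops_in[OF R v]])
        (simp add: R_def bounded_ops_scl[OF \<psi>(1) e0(1)] \<psi>e0, simp add: \<phi>0_def)
    have S'_image: "S' ` vecs V \<subseteq> S ` vecs V"
    proof
      fix z assume "z \<in> S' ` vecs V"
      then obtain v where v: "v \<in> vecs V" "z = S' v" by auto
      \<comment> \<open>The vector \<open>e0\<close> is a multiple of \<open>S u\<close>, so the
        subtracted term is itself a value of \<open>S\<close>.\<close>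
      have "z = S (v - scl V (\<phi>0 v / complex_of_real ?b) u)"
        using v u(1) by (simp add: S'_def R_def e0_def w_def VL.bounded_ops_diff[OF S] V.scl_in_vecs
            bounded_ops_scl[OF S])
      then show "z \<in> S ` vecs V" using v u(1) by (auto intro!: imageI V.diff_in_vecs V.scl_in_vecs)
    qed
    have rank: "rank_le V (lp p) n S'"
    proof -
      obtain B0 where B0: "finite B0" "card B0 \<le> Suc n" "S ` vecs V \<subseteq> L.span B0"
        using Suc.prems(2) by (auto simp: rank_le_def lin_span_def)
      obtain B where B: "B \<subseteq> S' ` vecs V" "L.independent B" "S' ` vecs V \<subseteq> L.span B"
        by (rule L.basis_exists)
      have "L.subspace {z \<in> vecs (lp p). \<psi> z = 0}"
        by (rule L.subspaceI)
          (auto simp: L.add_in_vecs L.scl_in_vecs bounded_ops_add[OF \<psi>(1)] bounded_ops_scl[OF \<psi>(1)]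
            LC.bounded_ops_zero[OF \<psi>(1)])
      moreover have "B \<subseteq> {z \<in> vecs (lp p). \<psi> z = 0}"
        using B(1) \<psi>S' bounded_ops_in[OF S'] by auto
      ultimately have "L.span B \<subseteq> {z \<in> vecs (lp p). \<psi> z = 0}" by (intro L.span_minimal)
      \<comment> \<open>Adjoining \<open>w\<close> to a basis of the image of \<open>S'\<close>
        keeps it independent inside the image of \<open>S\<close>; hence the rank drops by at least
        one.\<close>
      then have "w \<notin> L.span B" using \<psi>(3) b by auto
      then have indep: "L.independent (insert w B)" using B(2) by (rule L.independent_insertI)
      have "insert w B \<subseteq> S ` vecs V" using B(1) S'_image u(1) by (auto simp: w_def)
      then have fin: "finite (insert w B) \<and> card (insert w B) \<le> card B0"
        using B0 indep by (intro L.independent_span_bound) auto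
      moreover have "w \<notin> B" using \<open>w \<notin> L.span B\<close> L.span_base by blast
      ultimately have "card B \<le> n" using B0(2) by auto
      with fin B show ?thesis by (auto simp: rank_le_def lin_span_def)
    qed
    obtain e \<phi> where e: "\<And>k. k < n \<Longrightarrow> e k \<in> vecs (lp p) \<and> nrm (lp p) (e k) \<le> 1 \<and>
        \<phi> k \<in> vecs (bounded_ops V scalars) \<and>
        nrm (bounded_ops V scalars) (\<phi> k) \<le> 3 ^ n * nrm (bounded_ops V (lp p)) S'"
      and S'_eq: "\<And>v. v \<in> vecs V \<Longrightarrow> S' v = (\<Sum>k<n. scl (lp p) (\<phi> k v) (e k))"
      using Suc.IH[OF S' rank] by blast
    have "3 ^ n * nrm (bounded_ops V (lp p)) S' \<le> 3 ^ Suc n * ?nS" using nS' by simp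
    then have tail: "nrm (bounded_ops V scalars) (\<phi> k) \<le> 3 ^ Suc n * ?nS" if "k < n" for k
      using e[OF that] by linarith
    \<comment> \<open>The first functional has the bound \<open>2 * ?nS\<close>; it only has to fit
      under the common bound, while the tail uses \<open>3 ^ n * 3\<close>.\<close>
    have "(2 :: real) \<le> 3 ^ Suc n" unfolding power_Suc using one_le_power[of "3 :: real" n] by linarith
    then have "2 * ?nS \<le> 3 ^ Suc n * ?nS" using nS by (rule mult_right_mono)
    then have head: "nrm (bounded_ops V scalars) \<phi>0 \<le> 3 ^ Suc n * ?nS" using n\<phi>0 by linarith
    have "S v = (\<Sum>k<Suc n. scl (lp p) (case_nat \<phi>0 \<phi> k v) (case_nat e0 e k))" if v: "v \<in> vecs V" for v
    proof -
      have "S v = R v + S' v" by (simp add: S'_def)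
      also have "\<dots> = (\<Sum>k<Suc n. scl (lp p) (case_nat \<phi>0 \<phi> k v) (case_nat e0 e k))"
        unfolding sum.lessThan_Suc_shift using S'_eq[OF v] by (simp add: R_def)
      finally show ?thesis .
    qed
    then show ?thesis
      using e tail head e0 \<phi>0
      by (intro exI[of _ "case_nat e0 e"] exI[of _ "case_nat \<phi>0 \<phi>"]) (auto split: nat.split)
  qed
qed

section \<open>The uniform algebras and their bimodules\<close>

lemma lp_operators_intro:
  "bounded_geometry X \<Longrightarrow> lp_direct_sum F p \<Longrightarrow> lp_direct_sum G p \<Longrightarrow> lp_operators F G p X"
  by (simp add: lp_operators_def lp_operators_axioms_def)

context
  fixes p :: real
  assumes p: "1 \<le> p" and geometry: "bounded_geometry TYPE('x::metric_space)"
begin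

interpretation L: complex_banach_space "lp p :: (nat \<Rightarrow> complex) cspace"
  by (rule complex_banach_space_lp[OF p])
interpretation CC: lp_operators scalars scalars p "TYPE('x)"
  by (intro lp_operators_intro lp_direct_sum_scalars geometry p)
interpretation CL: lp_operators scalars "lp p :: (nat \<Rightarrow> complex) cspace" p "TYPE('x)"
  by (intro lp_operators_intro lp_direct_sum_scalars lp_direct_sum_lp geometry p)
interpretation LC: lp_operators "lp p :: (nat \<Rightarrow> complex) cspace" scalars p "TYPE('x)"
  by (intro lp_operators_intro lp_direct_sum_scalars lp_direct_sum_lp geometry p)
interpretation LL: lp_operators "lp p :: (nat \<Rightarrow> complex) cspace" "lp p :: (nat \<Rightarrow> complex) cspace" p "TYPE('x)"
  by (intro lp_operators_intro lp_direct_sum_lp geometry p)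

section \<open>The four algebraic spaces as operators of finite propagation\<close>

lemma Cu_alg_eq: "Cu_alg p = (fp_ops p scalars scalars :: (('x \<Rightarrow> complex) \<Rightarrow> 'x \<Rightarrow> complex) set)"
proof (intro equalityI subsetI)
  fix T :: "('x \<Rightarrow> complex) \<Rightarrow> 'x \<Rightarrow> complex" assume "T \<in> Cu_alg p"
  then obtain a C where T: "T = matrix_op (lp p) (\<lambda>x y c. a x y * c)" and a: "finite_propagation a"
    "\<And>x y. cmod (a x y) \<le> C"
    by (auto simp: Cu_alg_def uniformly_bounded_entries_def)
  obtain r where "\<And>x y. r < dist x y \<Longrightarrow> a x y = 0" using a by (auto simp: finite_propagation_iff)
  then show "T \<in> fp_ops p scalars scalars"
    unfolding T lp_def using a(2)
    by (intro CC.matrix_op_in_fp_ops[where C = C and r = r])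
      (auto simp: distrib_left mult.left_commute norm_mult mult_right_mono fun_eq_iff)
next
  fix T :: "('x \<Rightarrow> complex) \<Rightarrow> 'x \<Rightarrow> complex" assume T: "T \<in> fp_ops p scalars scalars"
  then have T': "T \<in> vecs (bounded_ops (lp_sum p scalars) (lp_sum p scalars))"
    and fp: "finite_propagation (entry T)" by (simp_all add: fp_ops_def)
  \<comment> \<open>A linear map on the scalars is determined by its value at 1.\<close>
  define a where "a x y = entry T x y 1" for x y
  have "T = matrix_op (lp_sum p scalars) (\<lambda>x y c. a x y * c)"
  proof (rule CC.matrix_op_entries[OF T])
    show "a x y * c = entry T x y c" for x y c
      using bounded_ops_scl[OF CC.entry_bounded_op[OF T'], of 1 x y c] by (simp add: a_def mult.commute)
  qed (simp add: a_def fun_eq_iff)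
  moreover have "finite_propagation a"
    using fp by (auto simp: finite_propagation_iff a_def)
  moreover have "cmod (a x y) \<le> nrm (bounded_ops (lp_sum p scalars) (lp_sum p scalars)) T" for x y
    using CC.entry_bound[OF T', of 1 x y] by (simp add: a_def)
  ultimately show "T \<in> Cu_alg p"
    unfolding Cu_alg_def lp_def uniformly_bounded_entries_def by auto
qed

lemma Eg_alg_eq: "Eg_alg p = (fp_ops p scalars (lp p) :: (('x \<Rightarrow> complex) \<Rightarrow> 'x \<Rightarrow> nat \<Rightarrow> complex) set)"
proof (intro equalityI subsetI)
  have scl: "(\<lambda>n. c * v n) = scl (lp p) c v" for c and v :: "nat \<Rightarrow> complex" by (simp add: lp_def lp_sum_def)
  {
    fix T :: "('x \<Rightarrow> complex) \<Rightarrow> 'x \<Rightarrow> nat \<Rightarrow> complex" assume "T \<in> Eg_alg p"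
    then obtain e C where T: "T = matrix_op (lp p) (\<lambda>x y c n. c * e x y n)" and e: "finite_propagation e"
      "\<And>x y. e x y \<in> vecs (lp p)" "\<And>x y. nrm (lp p) (e x y) \<le> C"
      by (auto simp: Eg_alg_def uniformly_bounded_entries_def)
    obtain r where "\<And>x y. r < dist x y \<Longrightarrow> e x y = 0" using e by (auto simp: finite_propagation_iff)
    then have r: "(\<lambda>c. scl (lp p) c (e x y)) = 0" if "r < dist x y" for x y
      using that by (intro ext) simp
    show "T \<in> fp_ops p scalars (lp p)"
      unfolding T scl lp_def[of p, where 'i = 'x] using e(2,3)
      by (intro CL.matrix_op_in_fp_ops[where C = C and r = r])
        (auto simp: L.scl_in_vecs L.scale_left_distrib L.nrm_scl mult_left_mono mult.commute[of C] r)
  }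
  fix T :: "('x \<Rightarrow> complex) \<Rightarrow> 'x \<Rightarrow> nat \<Rightarrow> complex" assume T: "T \<in> fp_ops p scalars (lp p)"
  then have T': "T \<in> vecs (bounded_ops (lp_sum p scalars) (lp_sum p (lp p)))"
    and fp: "finite_propagation (entry T)" by (simp_all add: fp_ops_def)
  define e where "e x y = entry T x y 1" for x y
  have "T = matrix_op (lp_sum p scalars) (\<lambda>x y c n. c * e x y n)"
    unfolding scl
  proof (rule CL.matrix_op_entries[OF T])
    show "scl (lp p) c (e x y) = entry T x y c" for x y c
      using bounded_ops_scl[OF CL.entry_bounded_op[OF T'], of 1 x y c] by (simp add: e_def)
    show "(\<lambda>c. scl (lp p) c (e x y)) = 0" if "entry T x y = 0" for x y
      using that by (intro ext) (simp add: e_def)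
  qed
  moreover have "finite_propagation e"
    using fp by (auto simp: finite_propagation_iff e_def)
  moreover have "nrm (lp p) (e x y) \<le> nrm (bounded_ops (lp_sum p scalars) (lp_sum p (lp p))) T" for x y
    using CL.entry_bound[OF T', of 1 x y] by (simp add: e_def)
  moreover have "e x y \<in> vecs (lp p)" for x y
    using bounded_ops_in[OF CL.entry_bounded_op[OF T'], of 1 x y] by (simp add: e_def)
  ultimately show "T \<in> Eg_alg p"
    unfolding Eg_alg_def lp_def[of p, where 'i = 'x] uniformly_bounded_entries_def by auto
qed

text \<open>The two inclusions are the two halves of the duality of sequence spaces: coefficient
  sequences define functionals with uniform bounds, and every functional is given by its values on
  basis vectors.\<close>

lemma El_alg_eq: "El_alg p = (fp_ops p (lp p) scalars :: (('x \<Rightarrow> nat \<Rightarrow> complex) \<Rightarrow> 'x \<Rightarrow> complex) set)"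
proof (intro equalityI subsetI)
  fix T :: "('x \<Rightarrow> nat \<Rightarrow> complex) \<Rightarrow> 'x \<Rightarrow> complex" assume "T \<in> El_alg p"
  then obtain f C where T: "T = matrix_op (lp_lp p) (\<lambda>x y v. \<Sum>\<^sub>\<infinity>n. f x y n * v n)"
    and f: "finite_propagation f" "\<And>x y. f x y \<in> vecs (lq p)" "\<And>x y. nrm (lq p) (f x y) \<le> C"
    by (auto simp: El_alg_def uniformly_bounded_entries_def)
  obtain r where r: "\<And>x y. r < dist x y \<Longrightarrow> f x y = 0" using f by (auto simp: finite_propagation_iff)
  \<comment> \<open>The pairing cut off outside the carrier is an element of
    \<open>bounded_ops\<close>; the matrix functions of \<open>El_alg\<close> agree with it on the
    carrier.\<close>
  define \<phi> where "\<phi> x y v = (if v \<in> vecs (lp p) then \<Sum>\<^sub>\<infinity>n. f x y n * v n else 0)" for x y v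
  obtain K where \<phi>: "\<And>x y. \<phi> x y \<in> vecs (bounded_ops (lp p) scalars)"
    and K: "\<And>x y. nrm (bounded_ops (lp p) scalars) (\<phi> x y) \<le> K"
    using lq_pairing[OF p, of C] f(2,3) unfolding \<phi>_def[abs_def] by blast
  have eq: "(\<Sum>\<^sub>\<infinity>n. f x y n * v n) = \<phi> x y v" if "v \<in> vecs (lp p)" for x y v
    using that by (simp add: \<phi>_def)
  show "T \<in> fp_ops p (lp p) scalars"
    unfolding T lp_lp_def
  proof (rule LC.matrix_op_in_fp_ops[where C = K and r = r])
    fix x y and u v :: "nat \<Rightarrow> complex" and c assume u: "u \<in> vecs (lp p)"
    show "(\<Sum>\<^sub>\<infinity>n. f x y n * scl (lp p) c u n) = scl scalars c (\<Sum>\<^sub>\<infinity>n. f x y n * u n)"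
      using bounded_ops_scl[OF \<phi> u] by (simp add: eq u L.scl_in_vecs)
    have "nrm scalars (\<phi> x y u) \<le> nrm (bounded_ops (lp p) scalars) (\<phi> x y) * nrm (lp p) u"
      by (rule LC.entries.nrm_apply_le[OF \<phi> u])
    also have "\<dots> \<le> K * nrm (lp p) u" using K L.nrm_nonneg[OF u] by (rule mult_right_mono)
    finally show "nrm scalars (\<Sum>\<^sub>\<infinity>n. f x y n * u n) \<le> K * nrm (lp p) u" by (simp add: eq u)
    assume v: "v \<in> vecs (lp p)"
    show "(\<Sum>\<^sub>\<infinity>n. f x y n * (u + v) n) = (\<Sum>\<^sub>\<infinity>n. f x y n * u n) + (\<Sum>\<^sub>\<infinity>n. f x y n * v n)"
      using bounded_ops_add[OF \<phi> u v] by (simp only: eq u v L.add_in_vecs)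
  qed (simp_all add: r fun_eq_iff)
next
  fix T :: "('x \<Rightarrow> nat \<Rightarrow> complex) \<Rightarrow> 'x \<Rightarrow> complex" assume T: "T \<in> fp_ops p (lp p) scalars"
  then have T': "T \<in> vecs (bounded_ops (lp_sum p (lp p)) (lp_sum p scalars))"
    and fp: "finite_propagation (entry T)" by (simp_all add: fp_ops_def)
  note entry = LC.entry_bounded_op[OF T']
  define f where "f x y n = entry T x y (single n 1)" for x y n
  have "T = matrix_op (lp_sum p (lp p)) (\<lambda>x y v. \<Sum>\<^sub>\<infinity>n. f x y n * v n)"
  proof (rule LC.matrix_op_entries[OF T])
    show "(\<Sum>\<^sub>\<infinity>n. f x y n * v n) = entry T x y v" if "v \<in> vecs (lp p)" for x y v
      unfolding f_def by (rule infsumI[OF functional_has_sum[OF p entry that]])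
  qed (simp add: f_def fun_eq_iff)
  moreover have "finite_propagation f"
    using fp by (auto simp: finite_propagation_iff f_def fun_eq_iff)
  moreover have "nrm (lq p) (f x y) \<le> nrm (bounded_ops (lp_sum p (lp p)) (lp_sum p scalars)) T" for x y
    using functional_in_lq(2)[OF p entry, of x y] LC.nrm_entry_le[OF T', of x y]
    unfolding f_def[abs_def] by linarith
  moreover have "f x y \<in> vecs (lq p)" for x y
    using functional_in_lq(1)[OF p entry, of x y] unfolding f_def[abs_def] .
  ultimately show "T \<in> El_alg p"
    unfolding El_alg_def lp_lp_def uniformly_bounded_entries_def by auto
qed

text \<open>For extended naturals, a supremum below infinity amounts to one finite bound for all
  entries.\<close>

lemma UC_alg_eq:
  "UC_alg p = {T \<in> fp_ops p (lp p) (lp p) :: (('x \<Rightarrow> nat \<Rightarrow> complex) \<Rightarrow> 'x \<Rightarrow> nat \<Rightarrow> complex) set.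
    bounded_rank_entries (lp p) (lp p) T}"
proof -
  have op_entry: "op_entry = (entry :: (('x \<Rightarrow> nat \<Rightarrow> complex) \<Rightarrow> 'x \<Rightarrow> nat \<Rightarrow> complex) \<Rightarrow> _)"
    by (simp add: fun_eq_iff op_entry_def entry_def single_def)
  have "(SUP (x, y). op_rank (lp p) (lp p) (entry T x y)) < \<infinity> \<longleftrightarrow> bounded_rank_entries (lp p) (lp p) T"
    for T :: "('x \<Rightarrow> nat \<Rightarrow> complex) \<Rightarrow> 'x \<Rightarrow> nat \<Rightarrow> complex"
  proof -
    have finite_iff: "s < \<infinity> \<longleftrightarrow> (\<exists>n. s \<le> enat n)" for s :: enat
      by (cases s) auto
    have "(SUP (x, y). op_rank (lp p) (lp p) (entry T x y)) < \<infinity> \<longleftrightarrow>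
        (\<exists>n. (SUP (x, y). op_rank (lp p) (lp p) (entry T x y)) \<le> enat n)"
      by (rule finite_iff)
    also have "\<dots> \<longleftrightarrow> (\<exists>n. \<forall>x y. op_rank (lp p) (lp p) (entry T x y) \<le> enat n)"
      by (simp add: SUP_le_iff)
    finally show ?thesis by (simp add: L.op_rank_le_iff bounded_rank_entries_def)
  qed
  then show ?thesis
    unfolding UC_alg_def fp_ops_def op_entry lp_lp_def by auto
qed

lemma lin_subspace_UC_alg:
  "lin_subspace (bounded_ops (lp_lp p) (lp_lp p)) (UC_alg p :: (('x \<Rightarrow> nat \<Rightarrow> complex) \<Rightarrow> 'x \<Rightarrow> nat \<Rightarrow> complex) set)"
proof -
  let ?A = "UC_alg p :: (('x \<Rightarrow> nat \<Rightarrow> complex) \<Rightarrow> 'x \<Rightarrow> nat \<Rightarrow> complex) set"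
  have fp: "LL.FP \<subseteq> vecs (bounded_ops LL.LF LL.LG)" "LL.bounded_ops.subspace LL.FP"
    using LL.lin_subspace_fp_ops by (simp_all add: lin_subspace_def)
  have "LL.bounded_ops.subspace ?A"
  proof (rule LL.bounded_ops.subspaceI)
    have "entry (0 :: ('x \<Rightarrow> nat \<Rightarrow> complex) \<Rightarrow> 'x \<Rightarrow> nat \<Rightarrow> complex) x y = 0" for x y
      by (simp add: fun_eq_iff entry_def)
    then show "0 \<in> ?A"
      using LL.bounded_ops.subspace_0[OF fp(2)] L.rank_le_0 by (auto simp: UC_alg_eq bounded_rank_entries_def)
    fix S T assume S: "S \<in> ?A"
    then obtain m where m: "\<And>x y. rank_le (lp p) (lp p) m (entry S x y)"
      by (auto simp: UC_alg_eq bounded_rank_entries_def)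
    have "entry (scl (bounded_ops LL.LF LL.LG) c S) x y = (\<lambda>v. scl (lp p) c (entry S x y v))" for c x y
      by (simp add: fun_eq_iff entry_def)
    then have "rank_le (lp p) (lp p) m (entry (scl (bounded_ops LL.LF LL.LG) c S) x y)" for c x y
      using L.rank_le_scl[OF m] by (simp only:)
    then have "bounded_rank_entries (lp p) (lp p) (scl (bounded_ops LL.LF LL.LG) c S)" for c
      unfolding bounded_rank_entries_def by blast
    then show "scl (bounded_ops LL.LF LL.LG) c S \<in> ?A" for c
      using S LL.bounded_ops.subspace_scale[OF fp(2)] unfolding UC_alg_eq by blast
    assume T: "T \<in> ?A"
    then obtain n where n: "\<And>x y. rank_le (lp p) (lp p) n (entry T x y)"
      by (auto simp: UC_alg_eq bounded_rank_entries_def)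
    have "entry (S + T) x y = entry S x y + entry T x y" for x y
      by (simp add: fun_eq_iff entry_def)
    then have "rank_le (lp p) (lp p) (m + n) (entry (S + T) x y)" for x y
      using L.rank_le_add[OF m n] by (simp only:)
    then have "bounded_rank_entries (lp p) (lp p) (S + T)"
      unfolding bounded_rank_entries_def by blast
    then show "S + T \<in> ?A"
      using S T LL.bounded_ops.subspace_add[OF fp(2)] unfolding UC_alg_eq by blast
  qed
  then show ?thesis using fp(1) by (auto simp: lin_subspace_def lp_lp_def UC_alg_eq)
qed

lemma matrix_op_diagonal:
  assumes "u \<in> vecs V"
  shows "matrix_op V (\<lambda>x y. if y = x then d x else 0) u x = d x (u x)"
proof -
  \<comment> \<open>Inclusion only: the set is empty when \<open>d x\<close> is the zero
    map.\<close>
  have "{y. (if y = x then d x else 0) \<noteq> 0} \<subseteq> {x}" by auto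
  then have "(\<Sum>y | (if y = x then d x else 0) \<noteq> 0. (if y = x then d x else 0) (u y)) =
      (\<Sum>y\<in>{x}. (if y = x then d x else 0) (u y))"
    by (intro sum.mono_neutral_left) auto
  with assms show ?thesis by (simp add: matrix_op_def)
qed

section \<open>Factorization of operators with entries of bounded rank\<close>

text \<open>For each slot \<open>i\<close> and rank index \<open>k\<close>, the diagonal left factor
  carries the vectors, and the right factor, with at most one nonzero entry per row, carries the
  functionals and the propagation. Uniform bounds for balls and ranks make the number of products
  finite.\<close>

lemma UC_alg_factorization:
  assumes "T \<in> UC_alg p"
  shows "T \<in> lin_span (bounded_ops (lp_lp p) (lp_lp p))
    {y \<circ> x | x y. x \<in> El_alg p \<and> y \<in> (Eg_alg p :: (('x \<Rightarrow> complex) \<Rightarrow> 'x \<Rightarrow> nat \<Rightarrow> complex) set)}"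
proof -
  have T: "T \<in> vecs (bounded_ops LL.LF LL.LG)" "finite_propagation (entry T)"
    "bounded_rank_entries (lp p) (lp p) T"
    using assms by (simp_all add: UC_alg_eq fp_ops_def)
  let ?nT = "nrm (bounded_ops LL.LF LL.LG) T"
  obtain r where r: "\<And>x y. r < dist x y \<Longrightarrow> entry T x y = 0"
    using T(2) by (auto simp: finite_propagation_iff)
  obtain N where N: "\<And>x :: 'x. card (cball x r) \<le> N" using LL.card_cball_bound[of r] by blast
  obtain n where n: "\<And>x y. rank_le (lp p) (lp p) n (entry T x y)"
    using T(3) by (auto simp: bounded_rank_entries_def)
  define D where "D x y e \<phi> \<longleftrightarrow> (\<forall>k<n. e k \<in> vecs (lp p) \<and> nrm (lp p) (e k) \<le> 1 \<and>
      \<phi> k \<in> vecs (bounded_ops (lp p) scalars) \<and> nrm (bounded_ops (lp p) scalars) (\<phi> k) \<le> 3 ^ n * ?nT) \<and>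
    (\<forall>v\<in>vecs (lp p). entry T x y v = (\<Sum>k<n. scl (lp p) (\<phi> k v) (e k)))" for x y e \<phi>
  have "\<exists>e \<phi>. D x y e \<phi>" for x y
  proof -
    \<comment> \<open>The norm of an entry is replaced by that of \<open>T\<close>, which no longer
      depends on \<open>x\<close> and \<open>y\<close>.\<close>
    have "3 ^ n * nrm (bounded_ops (lp p) (lp p)) (entry T x y) \<le> 3 ^ n * ?nT"
      by (intro mult_left_mono LL.nrm_entry_le T) simp
    with finite_rank_decomposition[OF p L.complex_normed_space_axioms LL.entry_bounded_op[OF T(1)] n, of x y]
    show ?thesis unfolding D_def by (meson order_trans)
  qed
  then obtain e \<phi> where "\<And>x y. D x y (e x y) (\<phi> x y)" by metis
  then have e: "\<And>x y k. k < n \<Longrightarrow> e x y k \<in> vecs (lp p)" "\<And>x y k. k < n \<Longrightarrow> nrm (lp p) (e x y k) \<le> 1"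
    and \<phi>: "\<And>x y k. k < n \<Longrightarrow> \<phi> x y k \<in> vecs (bounded_ops (lp p) scalars)"
      "\<And>x y k. k < n \<Longrightarrow> nrm (bounded_ops (lp p) scalars) (\<phi> x y k) \<le> 3 ^ n * ?nT"
    and entry: "\<And>x y v. v \<in> vecs (lp p) \<Longrightarrow> entry T x y v = (\<Sum>k<n. scl (lp p) (\<phi> x y k v) (e x y k))"
    unfolding D_def by blast+
  \<comment> \<open>The enumerations at different \<open>x\<close> are chosen independently; no
    compatibility between neighbouring balls is required.\<close>
  have "\<exists>t. bij_betw t {..<card (cball x r)} (cball x r)" for x :: 'x
    using ex_bij_betw_nat_finite[OF LL.finite_cball] by (simp add: atLeast0LessThan)
  then obtain t where t: "\<And>x :: 'x. bij_betw (t x) {..<card (cball x r)} (cball x r)" by metis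
  have t_in: "t x i \<in> cball x r" if "i < card (cball x r)" for x i
    using bij_betwE[OF t[of x]] that by blast
  \<comment> \<open>For slots beyond the ball \<open>t x i\<close> is arbitrary, but the vector
    chosen there still has norm at most 1; the cut-off is left to \<open>m\<close>.\<close>
  define G where "G i k = matrix_op CL.LF (\<lambda>x y. if y = x then (\<lambda>c. scl (lp p) c (e x (t x i) k)) else 0)" for i k
  define m where "m i k = (\<lambda>x y. if i < card (cball x r) \<and> y = t x i then \<phi> x y k else 0)" for i k
  have G: "G i k \<in> Eg_alg p" if k: "k < n" for i k
    unfolding Eg_alg_eq G_def
  proof (rule CL.matrix_op_in_fp_ops[where C = 1 and r = 0])
    fix x y :: 'x and c d :: complex
    show "nrm (lp p) ((if y = x then \<lambda>c. scl (lp p) c (e x (t x i) k) else 0) c) \<le> 1 * nrm scalars c"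
      using mult_left_mono[OF e(2)[OF k, of x "t x i"] norm_ge_zero[of c]] e(1)[OF k]
      by (simp add: L.nrm_scl)
  qed (use e(1)[OF k] in \<open>auto simp: L.scl_in_vecs L.scale_left_distrib\<close>)
  have L: "matrix_op LC.LF (m i k) \<in> El_alg p" if k: "k < n" for i k
    unfolding El_alg_eq
  proof (rule LC.matrix_op_in_fp_ops[where C = "3 ^ n * ?nT" and r = r])
    show "m i k x y = 0" if "r < dist x y" for x y using that t_in[of i x] by (auto simp: m_def)
    fix x y and v :: "nat \<Rightarrow> complex" assume v: "v \<in> vecs (lp p)"
    have "nrm scalars (\<phi> x y k v) \<le> nrm (bounded_ops (lp p) scalars) (\<phi> x y k) * nrm (lp p) v"
      by (rule LC.entries.nrm_apply_le[OF \<phi>(1)[OF k] v])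
    also have "\<dots> \<le> 3 ^ n * ?nT * nrm (lp p) v" using \<phi>(2)[OF k] L.nrm_nonneg[OF v] by (rule mult_right_mono)
    finally show "nrm scalars (m i k x y v) \<le> 3 ^ n * ?nT * nrm (lp p) v"
      using L.nrm_nonneg[OF v] LL.nrm_bounded_ops_nonneg[OF T(1)] by (auto simp: m_def)
  qed (simp_all add: m_def bounded_ops_add[OF \<phi>(1)[OF k]] bounded_ops_scl[OF \<phi>(1)[OF k]])
  have "T = (\<Sum>i<N. \<Sum>k<n. G i k \<circ> matrix_op LC.LF (m i k))"
  proof
    fix u
    show "T u = (\<Sum>i<N. \<Sum>k<n. G i k \<circ> matrix_op LC.LF (m i k)) u"
    proof (cases "u \<in> vecs LL.LF")
      case True
      show ?thesis
      proof
        fix x :: 'x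
        let ?B = "card (cball x r)"
        have u_in: "u y \<in> vecs (lp p)" for y by (rule CL.G.lp_sum_in[OF True])
        have Lu: "matrix_op LC.LF (m i k) u x = (if i < ?B then \<phi> x (t x i) k (u (t x i)) else 0)" for i k
        proof -
          have "matrix_op LC.LF (m i k) u x = (\<Sum>y\<in>cball x r. m i k x y (u y))"
            by (rule LC.matrix_op_eq_sum[OF True]) (use t_in[of i x] in \<open>auto simp: m_def\<close>)
          also have "\<dots> = (\<Sum>y\<in>cball x r. if t x i = y then if i < ?B then \<phi> x y k (u y) else 0 else 0)"
            by (intro sum.cong) (auto simp: m_def)
          also have "\<dots> = (if i < ?B then \<phi> x (t x i) k (u (t x i)) else 0)"
            using t_in[of i x] LL.finite_cball by (simp add: sum.delta')
          finally show ?thesis .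
        qed
        have GL: "(G i k \<circ> matrix_op LC.LF (m i k)) u x =
            (if i < ?B then scl (lp p) (\<phi> x (t x i) k (u (t x i))) (e x (t x i) k) else 0)" if "k < n" for i k
        proof -
          have "matrix_op LC.LF (m i k) \<in> vecs (bounded_ops LC.LF LC.LG)"
            using L[OF that, of i] by (simp add: El_alg_eq fp_ops_def)
          then have "matrix_op LC.LF (m i k) u \<in> vecs LC.LG" by (rule bounded_ops_in[OF _ True])
          then show ?thesis by (simp add: G_def matrix_op_diagonal Lu)
        qed
        have "T u x = (\<Sum>y\<in>cball x r. entry T x y (u y))"
          by (rule LL.apply_eq_sum_entries[OF T(1) True r])
        also have "\<dots> = (\<Sum>i<?B. entry T x (t x i) (u (t x i)))"
          by (rule sum.reindex_bij_betw[OF t, symmetric])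
        also have "\<dots> = (\<Sum>i<?B. \<Sum>k<n. (G i k \<circ> matrix_op LC.LF (m i k)) u x)"
          by (intro sum.cong) (simp_all add: entry[OF u_in] GL del: comp_apply)
        \<comment> \<open>Slots from the size of this ball up to the common bound \<open>N\<close>
          contribute 0.\<close>
        also have "\<dots> = (\<Sum>i<N. \<Sum>k<n. (G i k \<circ> matrix_op LC.LF (m i k)) u x)"
          using N[of x] by (intro sum.mono_neutral_left) (auto simp: GL simp del: comp_apply)
        finally show "T u x = (\<Sum>i<N. \<Sum>k<n. G i k \<circ> matrix_op LC.LF (m i k)) u x"
          by (simp add: sum_fun_apply)
      qed
    next
      case False
      have "G i k 0 = 0" if "k < n" for i k
      proof (rule CL.bounded_ops_zero)
        show "G i k \<in> vecs (bounded_ops CL.LF CL.LG)" using G[OF that, of i] by (simp add: Eg_alg_eq fp_ops_def)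
      qed
      moreover have "matrix_op LC.LF (m i k) u = 0" for i k
        using False by (simp add: matrix_op_def)
      ultimately show ?thesis
        using bounded_ops_outside[OF T(1) False] by (simp add: sum_fun_apply sum.neutral)
    qed
  qed
  also have "\<dots> \<in> lin_span (bounded_ops LL.LF LL.LG)
      {y \<circ> x | x y. x \<in> El_alg p \<and> y \<in> (Eg_alg p :: (('x \<Rightarrow> complex) \<Rightarrow> 'x \<Rightarrow> nat \<Rightarrow> complex) set)}"
    unfolding lin_span_def
    by (intro LL.bounded_ops.span_sum LL.bounded_ops.span_base) (use G L in blast)
  finally show ?thesis by (simp add: lp_lp_def)
qed

lemma compatible_dense_subcontext_uniform_algebras:
  "compatible_dense_subcontext
     (UB p :: (('x \<Rightarrow> nat \<Rightarrow> complex) \<Rightarrow> 'x \<Rightarrow> nat \<Rightarrow> complex) cspace) (\<circ>)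
     (Bu p :: (('x \<Rightarrow> complex) \<Rightarrow> 'x \<Rightarrow> complex) cspace) (\<circ>)
     (El_space p) (\<circ>) (\<circ>) (Eg_space p) (\<circ>) (\<circ>) (\<circ>) (\<circ>)
     (UC_alg p) (Cu_alg p) (El_alg p) (Eg_alg p)"
proof -
  note ops = CC.lp_operators_axioms CL.lp_operators_axioms LC.lp_operators_axioms LL.lp_operators_axioms
  \<comment> \<open>Diagonal matrices: every entry embeds the scalars along the basis vector with
    index 0, and \<open>P\<close> reads off that coordinate.\<close>
  define J where "J = matrix_op CL.LF (\<lambda>x y. if y = x then single (0 :: nat) else 0)"
  define P where "P = matrix_op LC.LF (\<lambda>x y. if y = x then (\<lambda>v :: nat \<Rightarrow> complex. v 0) else 0)"
  have J: "J \<in> Eg_alg p"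
    unfolding Eg_alg_eq J_def
  proof (rule CL.matrix_op_in_fp_ops[where C = 1 and r = 0])
    fix x y :: 'x and c d :: complex
    show "(if y = x then single (0 :: nat) else 0) c \<in> vecs (lp p)"
      using CC.F.single_in[of c "0 :: nat"] L.zero_in_vecs by (simp add: lp_def)
    show "nrm (lp p) ((if y = x then single (0 :: nat) else 0) c) \<le> 1 * nrm scalars c"
      using CC.F.nrm_single_le[of c "0 :: nat"] by (simp add: lp_def[symmetric])
  qed (auto simp: fun_eq_iff single_def lp_def)
  have P: "P \<in> El_alg p"
    unfolding El_alg_eq P_def
  proof (rule LC.matrix_op_in_fp_ops[where C = 1 and r = 0])
    fix x y :: 'x and v :: "nat \<Rightarrow> complex" assume "v \<in> vecs (lp p)"
    then show "nrm scalars ((if y = x then (\<lambda>v :: nat \<Rightarrow> complex. v 0) else 0) v) \<le> 1 * nrm (lp p) v"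
      using CC.F.lp_sum_entry_le[of v 0] L.nrm_nonneg by (simp add: lp_def)
  qed (auto simp: lp_def)
  have PJ: "P (J u) = u" if "u \<in> vecs CL.LF" for u
  proof -
    have "J u \<in> vecs CL.LG" using J bounded_ops_in[OF _ that] by (auto simp: Eg_alg_eq fp_ops_def)
    then have "P (J u) x = u x" for x
      unfolding P_def by (simp add: matrix_op_diagonal) (simp add: J_def matrix_op_diagonal[OF that] single_def)
    then show ?thesis by (simp add: fun_eq_iff)
  qed
  \<comment> \<open>Maps from the scalars have rank at most one; this puts the products of the
    pairing into \<open>A\<close> inside \<open>UC_alg\<close>.\<close>
  have rank_Eg: "bounded_rank_entries scalars (lp p) y" if y: "y \<in> Eg_alg p" for y :: "('x \<Rightarrow> complex) \<Rightarrow> 'x \<Rightarrow> nat \<Rightarrow> complex"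
  proof -
    have y': "y \<in> vecs (bounded_ops CL.LF CL.LG)" using y by (simp add: Eg_alg_eq fp_ops_def)
    have "entry y x z c \<in> L.span {entry y x z 1}" for x z c
      using bounded_ops_scl[OF CL.entry_bounded_op[OF y'], of 1 x z c] L.span_base[of "entry y x z 1" "{entry y x z 1}"]
      by (simp add: L.span_scale)
    then have "rank_le scalars (lp p) 1 (entry y x z)" for x z
      unfolding rank_le_def lin_span_def by (intro exI[of _ "{entry y x z 1}"]) auto
    then show ?thesis by (auto simp: bounded_rank_entries_def)
  qed
  have "compatible_dense_subcontext
      (op_closure LL.LF LL.LF (UC_alg p)) (\<circ>) (op_closure CC.LF CC.LF (Cu_alg p)) (\<circ>)
      (op_closure LC.LF CC.LF (El_alg p)) (\<circ>) (\<circ>) (op_closure CL.LF LL.LF (Eg_alg p)) (\<circ>) (\<circ>) (\<circ>) (\<circ>)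
      (UC_alg p) (Cu_alg p) (El_alg p) (Eg_alg p)"
  proof (rule compatible_dense_subcontext_of_operators[where J = J and P = P])
    show "complex_banach_space CC.LF" "complex_banach_space LL.LF"
      by (intro complex_banach_space_lp_sum complex_banach_space_scalars complex_banach_space_lp p)+
    show "lin_subspace (bounded_ops LL.LF LL.LF) (UC_alg p)"
      using lin_subspace_UC_alg by (simp add: lp_lp_def)
    show "lin_subspace (bounded_ops CC.LF CC.LF) (Cu_alg p)"
      "lin_subspace (bounded_ops LC.LF CC.LF) (El_alg p)" "lin_subspace (bounded_ops CL.LF LL.LF) (Eg_alg p)"
      unfolding Cu_alg_eq El_alg_eq Eg_alg_eq
      by (rule CC.lin_subspace_fp_ops LC.lin_subspace_fp_ops CL.lin_subspace_fp_ops)+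
    show "UC_alg p \<subseteq> lin_span (bounded_ops LL.LF LL.LF) {y \<circ> x | x y. x \<in> El_alg p \<and> y \<in>
        (Eg_alg p :: (('x \<Rightarrow> complex) \<Rightarrow> 'x \<Rightarrow> nat \<Rightarrow> complex) set)}"
      using UC_alg_factorization by (auto simp: lp_lp_def)
    show "y \<circ> x \<in> UC_alg p" if "y \<in> Eg_alg p" "x \<in> El_alg p"
      for y :: "('x \<Rightarrow> complex) \<Rightarrow> 'x \<Rightarrow> nat \<Rightarrow> complex" and x
      using that rank_Eg[OF that(1)] fp_ops_comp[OF ops(3,2), of y x] bounded_rank_entries_comp[OF ops(3,2), of y x]
      by (simp add: UC_alg_eq El_alg_eq Eg_alg_eq)
    show "a \<circ> a' \<in> UC_alg p" if "a \<in> UC_alg p" "a' \<in> UC_alg p"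
      for a a' :: "('x \<Rightarrow> nat \<Rightarrow> complex) \<Rightarrow> 'x \<Rightarrow> nat \<Rightarrow> complex"
      using that fp_ops_comp[OF ops(4,4), of a a'] bounded_rank_entries_comp[OF ops(4,4), of a a']
      by (simp add: UC_alg_eq)
    show "J \<in> Eg_alg p" "P \<in> El_alg p" by (rule J P)+
  qed (auto simp: PJ UC_alg_eq Cu_alg_eq El_alg_eq Eg_alg_eq simp del: comp_apply
      intro: fp_ops_comp[OF ops(1,1)] fp_ops_comp[OF ops(3,1)] fp_ops_comp[OF ops(4,3)]
        fp_ops_comp[OF ops(2,4)] fp_ops_comp[OF ops(1,2)] fp_ops_comp[OF ops(2,3)])
  then show ?thesis
    by (simp add: UB_def Bu_def El_space_def Eg_space_def op_closure_def lp_lp_def lp_def[where 'i = 'x])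
qed

end

theorem proposition7p1:
  fixes p :: real
  assumes "bounded_geometry TYPE('x::metric_space)"
    and "1 \<le> p"
  shows "compatible_dense_subcontext
           (UB p :: (('x \<Rightarrow> nat \<Rightarrow> complex) \<Rightarrow> 'x \<Rightarrow> nat \<Rightarrow> complex) cspace) (\<circ>)
           (Bu p :: (('x \<Rightarrow> complex) \<Rightarrow> 'x \<Rightarrow> complex) cspace) (\<circ>)
           (El_space p) (\<circ>) (\<circ>)
           (Eg_space p) (\<circ>) (\<circ>)
           (\<circ>) (\<circ>)
           (UC_alg p) (Cu_alg p) (El_alg p) (Eg_alg p)"
  using assms(2,1) by (rule compatible_dense_subcontext_uniform_algebras)

end
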